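(* Let $f(z)=F_1(z)+|z|^2F_2(z)$ be a univalent biharmonic mapping of $\mathbb{D}$ onto a bounded and rectifiable Jordan domain $\Omega$, where $F_1=H_1+\overline{G_1}$ and $F_2=H_2+\overline{G_2}$ are two harmonic mappings in $\mathbb{D}$ (with $H_1,G_1,H_2,G_2$ analytic in $\mathbb{D}$). Assume that $F_2(z)=o\left(\frac{1}{1-|z|}\right)$ as $|z|\to 1^-$. Let $f^*(e^{it})$ denote the boundary function of $f$. Then $f^*$ has a jump at $e^{i\theta_0}$ if, and only if, the limit $$\lim_{r\to 1^-}(1-r)\,\bigl|H_1'(re^{i\theta_0})+H_2'(re^{i\theta_0})\bigr|=c$$ exists with $c>0$.
   Context: $\mathbb{D}=\{z\in\mathbb{C}:|z|<1\}$. A harmonic mapping in $\mathbb{D}$ is a complex-valued function whose real and imaginary parts are harmonic; it can be written as $H+\overline{G}$ with $H,G$ analytic in $\mathbb{D}$. A biharmonic mapping is a complex-valued function $f$ with $\Delta^2 f=\Delta(\Delta f)=0$, where $\Delta=4\frac{\partial^2}{\partial z\,\partial\overline z}$. Univalent means injective. A bounded rectifiable Jordan domain is a bounded domain whose boundary is a rectifiable Jordan curve. The boundary function $f^*$ of a univalent mapping $f$ of $\mathbb{D}$ is the unrestricted limit $f^*(e^{it})=\lim_{z\to e^{it}}f(z)$ (with $z\in\mathbb{D}$), at those points where it exists. The boundary function $f^*$ has a jump at $e^{i\theta}\in\partial\mathbb{D}$ if the one-sided essential limits $f^*(e^{i\theta-})=\operatorname{ess\,lim}_{s\uparrow\theta}f^*(e^{is})$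 and $f^*(e^{i\theta+})=\operatorname{ess\,lim}_{s\downarrow\theta}f^*(e^{is})$ exist, are finite, and are not equal. *)

theory Defs
  imports "HOL-Complex_Analysis.Complex_Analysis" "HOL-Library.Landau_Symbols"
begin

definition partial_x :: "(complex \<Rightarrow> complex) \<Rightarrow> complex \<Rightarrow> complex" where
  "partial_x f z = vector_derivative (\<lambda>t. f (z + of_real t)) (at 0)"

definition partial_y :: "(complex \<Rightarrow> complex) \<Rightarrow> complex \<Rightarrow> complex" where
  "partial_y f z = vector_derivative (\<lambda>t. f (z + \<i> * of_real t)) (at 0)"

definition wirtinger :: "(complex \<Rightarrow> complex) \<Rightarrow> complex \<Rightarrow> complex" where
  "wirtinger f z = (partial_x f z - \<i> * partial_y f z) / 2"

definition wirtinger_bar :: "(complex \<Rightarrow> complex) \<Rightarrow> complex \<Rightarrow> complex" where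
  "wirtinger_bar f z = (partial_x f z + \<i> * partial_y f z) / 2"

definition laplacian :: "(complex \<Rightarrow> complex) \<Rightarrow> complex \<Rightarrow> complex" where
  "laplacian f z = 4 * wirtinger (wirtinger_bar f) z"

text \<open>Real differentiability is part of the smoothness predicate, because the partial derivatives
  above are only meaningful where they exist.\<close>

fun Ck_on :: "nat \<Rightarrow> complex set \<Rightarrow> (complex \<Rightarrow> complex) \<Rightarrow> bool" where
  "Ck_on 0 S f \<longleftrightarrow> continuous_on S f"
| "Ck_on (Suc k) S f \<longleftrightarrow>
     (\<forall>z\<in>S. f differentiable at z) \<and> Ck_on k S (partial_x f) \<and> Ck_on k S (partial_y f)"

definition harmonic_on :: "complex set \<Rightarrow> (complex \<Rightarrow> real) \<Rightarrow> bool" where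
  "harmonic_on S u \<longleftrightarrow> Ck_on 2 S (\<lambda>z. complex_of_real (u z)) \<and>
     (\<forall>z\<in>S. laplacian (\<lambda>z. complex_of_real (u z)) z = 0)"

definition harmonic_mapping_on :: "complex set \<Rightarrow> (complex \<Rightarrow> complex) \<Rightarrow> bool" where
  "harmonic_mapping_on S f \<longleftrightarrow> harmonic_on S (\<lambda>z. Re (f z)) \<and> harmonic_on S (\<lambda>z. Im (f z))"

definition biharmonic_mapping_on :: "complex set \<Rightarrow> (complex \<Rightarrow> complex) \<Rightarrow> bool" where
  "biharmonic_mapping_on S f \<longleftrightarrow> Ck_on 4 S f \<and> (\<forall>z\<in>S. laplacian (laplacian f) z = 0)"

definition rectifiable_path :: "(real \<Rightarrow> complex) \<Rightarrow> bool" where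
  "rectifiable_path \<gamma> \<longleftrightarrow> path \<gamma> \<and>
     (\<exists>B. \<forall>(n::nat) t. mono_on {..n} t \<and> t ` {..n} \<subseteq> {0..1} \<longrightarrow>
        (\<Sum>i<n. dist (\<gamma> (t i)) (\<gamma> (t (Suc i)))) \<le> B)"

definition bounded_rectifiable_Jordan_domain :: "complex set \<Rightarrow> bool" where
  "bounded_rectifiable_Jordan_domain \<Omega> \<longleftrightarrow>
     open \<Omega> \<and> connected \<Omega> \<and> \<Omega> \<noteq> {} \<and> bounded \<Omega> \<and>
     (\<exists>\<gamma>. simple_path \<gamma> \<and> pathfinish \<gamma> = pathstart \<gamma> \<and> rectifiable_path \<gamma> \<and>
        frontier \<Omega> = path_image \<gamma>)"

definition boundary_function :: "(complex \<Rightarrow> complex) \<Rightarrow> complex \<rightharpoonup> complex" where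
  "boundary_function f w =
     (if \<exists>L. (f \<longlongrightarrow> L) (at w within ball 0 1)
      then Some (Lim (at w within ball 0 1) f) else None)"

text \<open>For these one-sided essential limits of a partially defined function, the function has to
  be defined almost everywhere on a one-sided neighbourhood of the point.\<close>

definition ess_lim_left :: "(real \<rightharpoonup> complex) \<Rightarrow> real \<Rightarrow> complex \<Rightarrow> bool" where
  "ess_lim_left g \<theta> L \<longleftrightarrow>
     (\<forall>\<epsilon>>0. \<exists>\<delta>>0. AE s in lebesgue. s \<in> {\<theta> - \<delta><..<\<theta>} \<longrightarrow> (\<exists>w. g s = Some w \<and> dist w L < \<epsilon>))"

definition ess_lim_right :: "(real \<rightharpoonup> complex) \<Rightarrow> real \<Rightarrow> complex \<Rightarrow> bool" where
  "ess_lim_right g \<theta> L \<longleftrightarrow>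
     (\<forall>\<epsilon>>0. \<exists>\<delta>>0. AE s in lebesgue. s \<in> {\<theta><..<\<theta> + \<delta>} \<longrightarrow> (\<exists>w. g s = Some w \<and> dist w L < \<epsilon>))"

definition has_jump_at :: "(complex \<rightharpoonup> complex) \<Rightarrow> real \<Rightarrow> bool" where
  "has_jump_at g \<theta> \<longleftrightarrow>
     (\<exists>a b. ess_lim_left (\<lambda>s. g (cis s)) \<theta> a \<and> ess_lim_right (\<lambda>s. g (cis s)) \<theta> b \<and> a \<noteq> b)"

end

theory Submission
  imports Defs
begin

text \<open>With \<open>h = H1 + H2\<close> and \<open>g = G1 + G2\<close>, the growth condition on \<open>F2\<close> makes \<open>f\<close> uniformly close at the circle
  to the bounded harmonic function \<open>F = h + cnj g\<close>, so both have the same boundary function.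
  By Fatou's theorem the radial limits exist on a dense set of angles. Two such radii cut the disc into two
  sectors; the images of the radii, closed up by an arc of the boundary curve, form a Jordan curve whose
  interior contains the image of one of the sectors, so the cluster set of that sector lies in the arc. Hence if two
  radial limits are close, \<open>f\<close> is nearly constant near one of the two arcs of the circle, so the boundary
  function exists off a countable set and has one-sided limits \<open>a\<close> and \<open>b\<close> everywhere. The Cauchy formula
  \<open>2 \<pi> h'(z) = \<integral> F*(t) e\<^sup>i\<^sup>t / (e\<^sup>i\<^sup>t - z)\<^sup>2 dt\<close> shows that \<open>(1 - r) |h'(r e\<^sup>i\<^sup>\<theta>)|\<close> tends to
  \<open>|a - b| / (2 \<pi>)\<close>, which is positive exactly when there is a jump.\<close>

section \<open>Integral formulas on the unit circle\<close>

text \<open>A homeomorphism of the disc onto a Jordan domain need not extend continuously to the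
  circle: it may jump at a point and be nearly constant near a whole arc. What survives is the
  separation of the disc by two radii. That argument does not say which of the two sectors is
  enclosed; the ambiguity is removed because \<open>f\<close> cannot be close to one point all
  around the circle, as the boundary curve contains two distinct points.

  The comparison of \<open>f\<close> with \<open>F\<close> rests on
  \<open>f - F = - (1 - |z|^2) F2\<close> and \<open>1 - |z|^2 \<le> 2 (1 - |z|)\<close>.
  Boundedness of \<open>F\<close> does not bound \<open>h\<close> and \<open>g\<close> separately,
  but it bounds their mean squares on circles, and this is enough to produce boundary values of
  \<open>F\<close>.

  The constant \<open>1 / (2 pi)\<close> comes from the step function with values \<open>a\<close>
  and \<open>b\<close> on the two half circles: its integral against the Cauchy kernel is exactly
  \<open>2 i (a - b) / (1 - r^2)\<close>. The modulus of that kernel is the Poisson kernel divided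
  by \<open>1 - r^2\<close>, so replacing the boundary function by the step function costs only
  \<open>o(1 / (1 - r))\<close>.\<close>

lemma LIMSEQ_one_minus_inverse_Suc: "(\<lambda>n. 1 - 1 / real (Suc n)) \<longlonglongrightarrow> 1"
  using tendsto_diff[OF tendsto_const LIMSEQ_inverse_real_of_nat, of 1] by (simp add: inverse_eq_divide)

lemma cancel_two_pi_ii: "- (\<i> * (2 * of_real pi * \<i> * z)) = 2 * of_real pi * z"
  by (simp add: complex_eq_iff)

lemma cis_periodic: "cis (t + 2 * pi) = cis t"
  using cis_mult[of t "2 * pi"] by simp

text \<open>On the unit circle \<open>dz\<close> is \<open>\<i> * cis t\<close> times
  \<open>dt\<close>, whence the factor \<open>- \<i>\<close>. The usual parametrisation runs over
  \<open>{0..2 * pi}\<close>; moving its second half down by one period centres the interval at 0,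
  about which the Poisson kernel is even and where the jump is placed later.\<close>

lemma has_integral_unit_circle:
  fixes f :: "complex \<Rightarrow> complex"
  assumes "(f has_contour_integral I) (circlepath 0 1)"
  shows "((\<lambda>t. f (cis t) * cis t) has_integral (- \<i> * I)) {-pi..pi}"
proof -
  let ?h = "\<lambda>t. f (cis t) * cis t"
  have "((\<lambda>t. f (cis t) * \<i> * cis t) has_integral I) {0..2 * pi}"
    using assms unfolding circlepath_def
    by (subst (asm) has_contour_integral_part_circlepath_iff) auto
  from has_integral_mult_right[OF this, of "- \<i>"]
  have *: "(?h has_integral (- \<i> * I)) {0..2 * pi}"
    by (simp add: algebra_simps)
  have int: "?h integrable_on {0..pi}" "?h integrable_on {pi..2 * pi}"
    by (rule integrable_on_subinterval[OF has_integral_integrable[OF *]]; force)+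
  have "((\<lambda>t. ?h (t + 2 * pi)) has_integral integral {pi..2 * pi} ?h) {-pi..0}"
    using has_integral_shift_real_ivl_iff[of ?h "integral {pi..2 * pi} ?h" pi "2 * pi" "2 * pi"] int(2)
    by (simp add: has_integral_integral add.commute)
  then have "(?h has_integral integral {pi..2 * pi} ?h) {-pi..0}"
    by (simp only: cis_periodic)
  then have "(?h has_integral integral {pi..2 * pi} ?h + integral {0..pi} ?h) {-pi..pi}"
    using int(1) by (intro has_integral_combine[of "-pi" 0 pi]) (auto simp: has_integral_integral)
  moreover have "integral {0..pi} ?h + integral {pi..2 * pi} ?h = - \<i> * I"
    using * by (subst Henstock_Kurzweil_Integration.integral_combine) (auto simp: integrable_on_def integral_unique)
  ultimately show ?thesis
    by (simp add: add.commute)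
qed

lemma Cauchy_unit_circle:
  fixes f :: "complex \<Rightarrow> complex"
  assumes "f holomorphic_on ball 0 s" "1 < s" "norm z < 1"
  shows "((\<lambda>t. f (cis t) * cis t / (cis t - z)) has_integral (2 * pi * f z)) {-pi..pi}"
proof -
  have "f holomorphic_on cball 0 1"
    using assms by (auto intro: holomorphic_on_subset)
  from has_integral_unit_circle[OF Cauchy_integral_circlepath_simple[OF this]] assms(3)
  show ?thesis by (simp add: cancel_two_pi_ii)
qed

lemma Cauchy_derivative_unit_circle:
  fixes f :: "complex \<Rightarrow> complex"
  assumes "f holomorphic_on ball 0 s" "1 < s" "norm z < 1"
  shows "((\<lambda>t. f (cis t) * cis t / (cis t - z)\<^sup>2) has_integral (2 * pi * deriv f z)) {-pi..pi}"
proof -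
  have f: "f holomorphic_on cball 0 1"
    using assms by (auto intro: holomorphic_on_subset)
  then have fb: "continuous_on (cball 0 1) f" "f holomorphic_on ball 0 1"
    by (auto simp: holomorphic_on_imp_continuous_on elim: holomorphic_on_subset)
  have "((\<lambda>u. f u / (u - z)\<^sup>2) has_contour_integral (2 * pi * \<i> * deriv f z)) (circlepath 0 1)"
    using Cauchy_derivative_integral_circlepath(1)[OF fb, of z] Cauchy_contour_integral_circlepath_2[OF fb, of z] assms(3)
    by (simp add: has_contour_integral_integral flip: contour_integrable_on_def)
      (metis has_contour_integral_integral)
  from has_integral_unit_circle[OF this]
  show ?thesis by (simp add: cancel_two_pi_ii)
qed

lemma mean_unit_circle:
  fixes f :: "complex \<Rightarrow> complex"
  assumes "f holomorphic_on ball 0 s" "1 < s"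
  shows "((\<lambda>t. f (cis t)) has_integral (2 * pi * f 0)) {-pi..pi}"
  using Cauchy_unit_circle[OF assms, of 0] by simp

section \<open>The Poisson kernel and the kernel of the derivative\<close>

definition poisson :: "real \<Rightarrow> real \<Rightarrow> real" where
  "poisson \<rho> t = (1 - \<rho>\<^sup>2) / (1 - 2 * \<rho> * cos t + \<rho>\<^sup>2)"

lemma norm_cis_minus_real: "(cmod (cis t - of_real \<rho>))\<^sup>2 = 1 - 2 * \<rho> * cos t + \<rho>\<^sup>2"
  using sin_cos_squared_add[of t] by (simp add: cmod_def) (simp add: power2_eq_square algebra_simps)

text \<open>On the unit circle conjugation is inversion, so the denominator
  \<open>|w - \<rho>|^2\<close> equals \<open>(w - \<rho>) (1 - \<rho> w) / w\<close>. In this form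
  the kernel is rational in \<open>w = cis t\<close>, and Cauchy's formula applies.\<close>

lemma poisson_eq:
  assumes "0 \<le> \<rho>" "\<rho> < 1"
  shows "of_real (poisson \<rho> t) = (1 - of_real \<rho>^2) * cis t / ((cis t - of_real \<rho>) * (1 - of_real \<rho> * cis t))"
proof -
  have "of_real (1 - 2 * \<rho> * cos t + \<rho>\<^sup>2) = (cis t - of_real \<rho>) * cnj (cis t - of_real \<rho>)"
    by (simp only: norm_cis_minus_real[symmetric] complex_norm_square)
  also have "\<dots> = (cis t - of_real \<rho>) * (1 - of_real \<rho> * cis t) / cis t"
    using cis_mult[of t "-t"] by (simp add: divide_simps cis_cnj) (simp add: algebra_simps)
  finally have "of_real (1 - 2 * \<rho> * cos t + \<rho>\<^sup>2) = (cis t - of_real \<rho>) * (1 - of_real \<rho> * cis t) / cis t" .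
  then show ?thesis unfolding poisson_def of_real_divide
    by simp
qed

text \<open>The zero \<open>1 / \<rho>\<close> of \<open>1 - \<rho> w\<close> is the mirror image of
  \<open>\<rho>\<close> in the unit circle, so it lies strictly outside the closed disc and a
  slightly larger disc still avoids it.\<close>

lemma disc_avoiding_reflected_pole:
  assumes "1 < s" "0 \<le> \<rho>" "\<rho> < 1"
  obtains s' where "1 < s'" "s' \<le> s" "\<And>w :: complex. w \<in> ball 0 s' \<Longrightarrow> 1 - of_real \<rho> * w \<noteq> 0"
proof -
  define s' where "s' = (if \<rho> = 0 then s else min s (1 / \<rho>))"
  have s': "1 < s'" "s' \<le> s" using assms by (auto simp: s'_def)
  have "1 - of_real \<rho> * w \<noteq> 0" if "w \<in> ball 0 s'" for w :: complex
  proof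
    assume "1 - of_real \<rho> * w = 0"
    then have "of_real \<rho> * w = 1" by simp
    then have "norm (of_real \<rho> * w) = norm (1::complex)" by (rule arg_cong)
    then have "\<rho> * norm w = 1" using assms by (simp add: norm_mult)
    then show False using that assms by (auto simp: s'_def field_simps split: if_splits)
  qed
  then show ?thesis using s' that by blast
qed

text \<open>This is Cauchy's formula at \<open>\<rho>\<close> for
  \<open>f w (1 - \<rho>^2) / (1 - \<rho> w)\<close>, whose value at \<open>\<rho>\<close> is
  \<open>f \<rho>\<close>. Real \<open>\<rho>\<close> suffices, since other points of the disc are
  reached by rotating \<open>f\<close>.\<close>

lemma poisson_holomorphic:
  fixes f :: "complex \<Rightarrow> complex"
  assumes "f holomorphic_on ball 0 s" "1 < s" "0 \<le> \<rho>" "\<rho> < 1"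
  shows "((\<lambda>t. of_real (poisson \<rho> t) * f (cis t)) has_integral (2 * pi * f (of_real \<rho>))) {-pi..pi}"
proof -
  obtain s' where s': "1 < s'" "s' \<le> s" and ne: "\<And>w :: complex. w \<in> ball 0 s' \<Longrightarrow> 1 - of_real \<rho> * w \<noteq> 0"
    using disc_avoiding_reflected_pole[OF assms(2-4)] by blast
  let ?q = "\<lambda>w. f w * (1 - of_real \<rho>^2) / (1 - of_real \<rho> * w)"
  have "?q holomorphic_on ball 0 s'"
    using s' ne by (intro holomorphic_intros holomorphic_on_subset[OF assms(1)]) auto
  from Cauchy_unit_circle[OF this s'(1), of "of_real \<rho>"]
  have "((\<lambda>t. ?q (cis t) * cis t / (cis t - of_real \<rho>)) has_integral (2 * pi * ?q \<rho>)) {-pi..pi}"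
    using assms by simp
  moreover have "?q \<rho> = f \<rho>" using ne[of "of_real \<rho>"] assms s'
    by (auto simp: power2_eq_square)
  ultimately show ?thesis
    by (simp add: poisson_eq[OF assms(3,4)] mult_ac)
qed

lemma poisson_harmonic:
  fixes h g :: "complex \<Rightarrow> complex"
  assumes "h holomorphic_on ball 0 s" "g holomorphic_on ball 0 s" "1 < s" "0 \<le> \<rho>" "\<rho> < 1"
  shows "((\<lambda>t. of_real (poisson \<rho> t) * (h (cis t) + cnj (g (cis t))))
     has_integral (2 * pi * (h (of_real \<rho>) + cnj (g (of_real \<rho>))))) {-pi..pi}"
proof -
  have "((\<lambda>t. cnj (of_real (poisson \<rho> t) * g (cis t))) has_integral cnj (2 * pi * g (of_real \<rho>))) {-pi..pi}"
    using poisson_holomorphic[OF assms(2-5)] by (subst has_integral_cnj[unfolded o_def])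
  from has_integral_add[OF poisson_holomorphic[OF assms(1,3-5)] this]
  show ?thesis by (simp add: distrib_left)
qed

text \<open>The antiholomorphic part drops out: on the circle, the kernel times
  \<open>cnj (g w)\<close> is the conjugate of \<open>w g w / (1 - \<rho> w)^2\<close>, a
  holomorphic function that vanishes at 0 and so has mean 0. Hence the values of the harmonic
  function alone determine \<open>deriv h\<close>.\<close>

lemma deriv_harmonic:
  fixes h g :: "complex \<Rightarrow> complex"
  assumes "h holomorphic_on ball 0 s" "g holomorphic_on ball 0 s" "1 < s" "0 \<le> \<rho>" "\<rho> < 1"
  shows "((\<lambda>t. (cis t / (cis t - of_real \<rho>)\<^sup>2) * (h (cis t) + cnj (g (cis t))))
     has_integral (2 * pi * deriv h (of_real \<rho>))) {-pi..pi}"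
proof -
  obtain s' where s': "1 < s'" "s' \<le> s" and ne: "\<And>w :: complex. w \<in> ball 0 s' \<Longrightarrow> 1 - of_real \<rho> * w \<noteq> 0"
    using disc_avoiding_reflected_pole[OF assms(3-5)] by blast
  let ?q = "\<lambda>w. w * g w / (1 - of_real \<rho> * w)^2"
  have "?q holomorphic_on ball 0 s'"
    using s' ne by (intro holomorphic_intros holomorphic_on_subset[OF assms(2)]) auto
  from mean_unit_circle[OF this s'(1)]
  have 0: "((\<lambda>t. cnj (?q (cis t))) has_integral cnj 0) {-pi..pi}"
    by (subst has_integral_cnj[unfolded o_def]) simp
  have 1: "cnj (?q (cis t)) = (cis t / (cis t - of_real \<rho>)\<^sup>2) * cnj (g (cis t))" for t
  proof -
    have *: "cnj (cis t) = 1 / cis t"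
      by (simp add: cis_cnj divide_inverse)
    have "1 - of_real \<rho> * (1 / cis t) = (cis t - of_real \<rho>) / cis t"
      by (simp add: field_simps)
    then show ?thesis
      unfolding complex_cnj_mult complex_cnj_divide complex_cnj_power complex_cnj_diff complex_cnj_complex_of_real complex_cnj_one *
      by (simp add: power_divide power2_eq_square)
  qed
  have "((\<lambda>t. h (cis t) * cis t / (cis t - of_real \<rho>)\<^sup>2) has_integral (2 * pi * deriv h (of_real \<rho>))) {-pi..pi}"
    using assms by (intro Cauchy_derivative_unit_circle) auto
  from has_integral_add[OF this 0[unfolded 1]]
  show ?thesis by (simp add: algebra_simps add_divide_distrib)
qed

text \<open>The integral formulas require holomorphy beyond the closed disc. Composing with
  \<open>w \<mapsto> c w\<close> provides it; with \<open>c\<close> of the form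
  \<open>r * cis \<theta>\<close> this also rotates the direction \<open>\<theta>\<close> to the
  positive real axis.\<close>

lemma holomorphic_on_scaled_disc:
  fixes h :: "complex \<Rightarrow> complex"
  assumes "h holomorphic_on ball 0 1" "norm c < 1"
  obtains s where "1 < s" "(\<lambda>w. h (c * w)) holomorphic_on ball 0 s"
proof -
  obtain y where y: "norm c < y" "y < 1" using dense assms(2) by blast
  then have "0 < y" using norm_ge_zero[of c] by linarith
  have "(\<lambda>w. c * w) ` ball 0 (1 / y) \<subseteq> ball (0::complex) 1"
  proof
    fix z :: complex assume "z \<in> (\<lambda>w. c * w) ` ball 0 (1 / y)"
    then obtain w :: complex where w: "norm w < 1 / y" "z = c * w" by auto
    have "norm z = norm c * norm w" using w by (simp add: norm_mult)
    also have "\<dots> \<le> y * norm w" using y by (intro mult_right_mono) auto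
    also have "\<dots> < 1" using w(1) y \<open>0 < y\<close> by (simp add: field_simps)
    finally show "z \<in> ball 0 1" by simp
  qed
  then have "(\<lambda>w. h (c * w)) holomorphic_on ball 0 (1 / y)"
    by (intro holomorphic_on_compose_gen[OF _ assms(1), unfolded o_def] holomorphic_intros)
  then show ?thesis using that[of "1 / y"] y \<open>0 < y\<close> by simp
qed

lemma holomorphic_on_scaled_disc2:
  fixes h g :: "complex \<Rightarrow> complex"
  assumes "h holomorphic_on ball 0 1" "g holomorphic_on ball 0 1" "norm c < 1"
  obtains s where "1 < s" "(\<lambda>w. h (c * w)) holomorphic_on ball 0 s" "(\<lambda>w. g (c * w)) holomorphic_on ball 0 s"
proof -
  obtain s1 s2 where s: "1 < s1" "(\<lambda>w. h (c * w)) holomorphic_on ball 0 s1" "1 < s2" "(\<lambda>w. g (c * w)) holomorphic_on ball 0 s2"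
    using holomorphic_on_scaled_disc assms by metis
  show ?thesis
    by (rule that[of "min s1 s2"]) (use s in \<open>auto elim!: holomorphic_on_subset\<close>)
qed

section \<open>Mean square convergence on circles\<close>

lemma has_integral_cis_power_cnj:
  "((\<lambda>t. cis t ^ n * cnj (cis t ^ m)) has_integral (if n = m then 2 * pi else 0)) {-pi..pi}"
proof -
  have *: "((\<lambda>t. cis t ^ n * cnj (cis t ^ m)) has_integral (if n = m then 2 * pi else 0)) {-pi..pi}"
    if "m \<le> n" for n m
  proof -
    have "cis t ^ n * cnj (cis t ^ m) = cis t ^ (n - m)" for t
    proof -
      have "cis t ^ n = cis t ^ (n - m) * cis t ^ m" using that by (simp flip: power_add)
      moreover have "cis t * cnj (cis t) = 1" by (simp add: cis_cnj cis_mult)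
      then have "cis t ^ m * cnj (cis t ^ m) = 1"
        by (simp flip: power_mult_distrib)
      ultimately show ?thesis by (simp add: mult.assoc)
    qed
    moreover have "((\<lambda>t. cis t ^ (n - m)) has_integral 2 * pi * 0 ^ (n - m)) {-pi..pi}"
      using mean_unit_circle[of "\<lambda>w. w ^ (n - m)" 2] by (simp add: holomorphic_intros)
    ultimately show ?thesis using that by (auto simp: power_0_left split: if_splits)
  qed
  show ?thesis
  proof (cases "m \<le> n")
    case False
    then have "((\<lambda>t. cis t ^ m * cnj (cis t ^ n)) has_integral 0) {-pi..pi}"
      using *[of n m] by simp
    then have "(cnj \<circ> (\<lambda>t. cis t ^ m * cnj (cis t ^ n)) has_integral cnj 0) {-pi..pi}"
      by (subst has_integral_cnj)
    then show ?thesis using False by (simp add: o_def mult.commute)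
  qed (rule *)
qed

text \<open>Absolute summability bounds all partial sums by the same constant, so dominated
  convergence carries the identity over from trigonometric polynomials, where it is
  orthogonality.\<close>

lemma parseval_unit_circle:
  fixes k :: "nat \<Rightarrow> complex"
  assumes "summable (\<lambda>n. cmod (k n))"
  shows "summable (\<lambda>n. (cmod (k n))\<^sup>2)"
    and "((\<lambda>t. (cmod (\<Sum>n. k n * cis t ^ n))\<^sup>2) has_integral 2 * pi * (\<Sum>n. (cmod (k n))\<^sup>2)) {-pi..pi}"
proof -
  define S where "S N t = (\<Sum>n<N. k n * cis t ^ n)" for N t
  let ?u = "\<lambda>t. \<Sum>n. k n * cis t ^ n"
  have nk: "cmod (k n * cis t ^ n) = cmod (k n)" for n t
    by (simp add: norm_mult norm_power)
  have sm: "summable (\<lambda>n. k n * cis t ^ n)" for t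
    using assms by (intro summable_norm_cancel[of "\<lambda>n. k n * cis t ^ n"]) (simp add: nk)
  have lim: "(\<lambda>N. S N t) \<longlonglongrightarrow> ?u t" for t
    unfolding S_def using sm by (rule summable_LIMSEQ)
  let ?M = "\<Sum>n. cmod (k n)"
  have bound: "cmod (S N t) \<le> ?M" for N t
  proof -
    have "cmod (S N t) \<le> (\<Sum>n<N. cmod (k n))"
      unfolding S_def by (rule order_trans[OF norm_sum]) (simp add: nk)
    also have "\<dots> \<le> ?M" using assms by (intro sum_le_suminf) auto
    finally show ?thesis .
  qed
  have sq: "of_real ((cmod (S N t))\<^sup>2) = (\<Sum>n<N. \<Sum>m<N. (k n * cnj (k m)) * (cis t ^ n * cnj (cis t ^ m)))" for N t
    unfolding complex_norm_square S_def by (simp add: sum_product algebra_simps)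
  have "((\<lambda>t. \<Sum>n<N. \<Sum>m<N. (k n * cnj (k m)) * (cis t ^ n * cnj (cis t ^ m)))
      has_integral (\<Sum>n<N. \<Sum>m<N. (k n * cnj (k m)) * of_real (if n = m then 2 * pi else 0))) {-pi..pi}" for N
    by (intro has_integral_sum has_integral_mult_right has_integral_cis_power_cnj) auto
  moreover have "(\<Sum>n<N. \<Sum>m<N. (k n * cnj (k m)) * of_real (if n = m then 2 * pi else 0))
      = of_real (2 * pi * (\<Sum>n<N. (cmod (k n))\<^sup>2))" for N
  proof -
    have "(\<Sum>n<N. \<Sum>m<N. (k n * cnj (k m)) * of_real (if n = m then 2 * pi else 0))
       = (\<Sum>n<N. \<Sum>m<N. if m = n then k n * cnj (k n) * of_real (2 * pi) else 0)"
      by (intro sum.cong refl) auto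
    also have "\<dots> = (\<Sum>n<N. k n * cnj (k n) * of_real (2 * pi))" by simp
    also have "\<dots> = of_real (2 * pi * (\<Sum>n<N. (cmod (k n))\<^sup>2))"
      by (simp only: complex_norm_square[symmetric] sum_distrib_left of_real_sum of_real_mult of_real_power mult_ac)
    finally show ?thesis .
  qed
  ultimately have "((\<lambda>t. complex_of_real ((cmod (S N t))\<^sup>2)) has_integral of_real (2 * pi * (\<Sum>n<N. (cmod (k n))\<^sup>2))) {-pi..pi}" for N
    unfolding sq by simp
  from has_integral_Re[OF this]
  have fin: "((\<lambda>t. (cmod (S N t))\<^sup>2) has_integral (2 * pi * (\<Sum>n<N. (cmod (k n))\<^sup>2))) {-pi..pi}" for N
    by (simp only: Re_complex_of_real)
  show sm2: "summable (\<lambda>n. (cmod (k n))\<^sup>2)"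
  \<comment> \<open>The terms tend to 0, so eventually each is below 1 and dominates its own
    square.\<close>
  proof (rule summable_comparison_test_ev)
    have "\<forall>\<^sub>F n in sequentially. cmod (k n) < 1"
      using summable_LIMSEQ_zero[OF assms] by (rule order_tendstoD) simp
    then show "\<forall>\<^sub>F n in sequentially. norm ((cmod (k n))\<^sup>2) \<le> cmod (k n)"
      by eventually_elim (simp add: power2_eq_square mult_left_le)
  qed (rule assms)
  note dc = dominated_convergence[of "\<lambda>N t. (cmod (S N t))\<^sup>2" "{-pi..pi}" "\<lambda>_. ?M\<^sup>2" "\<lambda>t. (cmod (?u t))\<^sup>2"]
  have a: "\<And>N. (\<lambda>t. (cmod (S N t))\<^sup>2) integrable_on {-pi..pi}" using fin by blast
  have b: "\<And>N t. norm ((cmod (S N t))\<^sup>2) \<le> ?M\<^sup>2" using bound by (simp add: power_mono)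
  have c: "\<And>t. (\<lambda>N. (cmod (S N t))\<^sup>2) \<longlonglongrightarrow> (cmod (?u t))\<^sup>2" using lim by (intro tendsto_intros)
  have i: "(\<lambda>_. ?M\<^sup>2) integrable_on {-pi..pi}" by (rule integrable_const_ivl)
  have e: "integral {-pi..pi} (\<lambda>t. (cmod (S N t))\<^sup>2) = 2 * pi * (\<Sum>n<N. (cmod (k n))\<^sup>2)" for N
    using fin by (rule integral_unique)
  have "(\<lambda>N. 2 * pi * (\<Sum>n<N. (cmod (k n))\<^sup>2)) \<longlonglongrightarrow> 2 * pi * (\<Sum>n. (cmod (k n))\<^sup>2)"
    using sm2 by (intro tendsto_intros summable_LIMSEQ)
  with dc(2)[OF a i b c] have "integral {-pi..pi} (\<lambda>t. (cmod (?u t))\<^sup>2) = 2 * pi * (\<Sum>n. (cmod (k n))\<^sup>2)"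
    unfolding e by (rule LIMSEQ_unique)
  then show "((\<lambda>t. (cmod (?u t))\<^sup>2) has_integral 2 * pi * (\<Sum>n. (cmod (k n))\<^sup>2)) {-pi..pi}"
    using dc(1)[OF a i b c] by (simp only: has_integral_integrable_integral)
qed

section \<open>Boundary values as limits along a sequence of circles\<close>

lemma continuous_on_circle:
  fixes f :: "complex \<Rightarrow> 'a :: banach"
  assumes "continuous_on (ball 0 1) f" "0 \<le> r" "r < 1"
  shows "continuous_on {a..b} (\<lambda>t. f (of_real r * cis t))"
  by (rule continuous_on_compose2[OF assms(1)]) (use assms in \<open>auto intro!: continuous_intros simp: norm_mult\<close>)

text \<open>Monotonicity in the radius comes from \<open>(r ^ n - s ^ n)\<^sup>2 \<le> r ^ (2 * n) - s ^ (2 * n)\<close>, applied to each Fourier coefficient.\<close>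

lemma integral_circle_difference:
  fixes h :: "complex \<Rightarrow> complex"
  assumes h: "h holomorphic_on ball 0 1" and s: "0 \<le> s" "s \<le> r" "r < 1"
  defines "I \<equiv> \<lambda>r. integral {-pi..pi} (\<lambda>t. (cmod (h (of_real r * cis t)))\<^sup>2)"
  shows "integral {-pi..pi} (\<lambda>t. (cmod (h (of_real r * cis t) - h (of_real s * cis t)))\<^sup>2) \<le> I r - I s"
proof -
  define k where "k n = (deriv ^^ n) h 0 / fact n" for n
  have sums: "(\<lambda>n. k n * z ^ n) sums h z" if "z \<in> ball 0 1" for z
    using holomorphic_power_series[OF h that] by (simp add: k_def)
  have sm: "summable (\<lambda>n. cmod (k n * of_real x ^ n))" if "0 \<le> x" "x < 1" for x
  proof -
    obtain y where y: "x < y" "y < 1" using dense \<open>x < 1\<close> by blast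
    then have "of_real y \<in> ball (0::complex) 1" using that by simp
    then have "summable (\<lambda>n. k n * of_real y ^ n)" using sums sums_summable by blast
    then show ?thesis using y that by (intro powser_insidea[of k "of_real y"]) auto
  qed
  have circ: "(\<Sum>n. (k n * of_real x ^ n) * cis t ^ n) = h (of_real x * cis t)" if "0 \<le> x" "x < 1" for x t
  proof -
    have "(\<lambda>n. k n * (of_real x * cis t) ^ n) sums h (of_real x * cis t)"
      using that by (intro sums) (simp add: norm_mult)
    then show ?thesis by (simp add: sums_iff power_mult_distrib mult.assoc)
  qed
  have pars: "summable (\<lambda>n. (cmod (k n))\<^sup>2 * (x ^ n)\<^sup>2)" "I x = 2 * pi * (\<Sum>n. (cmod (k n))\<^sup>2 * (x ^ n)\<^sup>2)" if "0 \<le> x" "x < 1" for x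
  proof -
    note p = parseval_unit_circle[OF sm[OF that]]
    show "summable (\<lambda>n. (cmod (k n))\<^sup>2 * (x ^ n)\<^sup>2)"
      using p(1) by (simp add: norm_mult norm_power power_mult_distrib that)
    show "I x = 2 * pi * (\<Sum>n. (cmod (k n))\<^sup>2 * (x ^ n)\<^sup>2)"
      using integral_unique[OF p(2)] unfolding I_def circ[OF that]
      by (simp add: norm_mult norm_power power_mult_distrib that)
  qed
  have x: "0 \<le> r" "s < 1" using s by auto
  \<comment> \<open>The difference of two dilates of \<open>h\<close> is again given by an
    absolutely summable series on the unit circle, so Parseval applies to it directly.\<close>
  let ?d = "\<lambda>n. k n * of_real r ^ n - k n * of_real s ^ n"
  have d: "summable (\<lambda>n. cmod (?d n))"
    using summable_add[OF sm[OF x(1) s(3)] sm[OF s(1) x(2)]]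
    by (rule summable_comparison_test'[of _ 0]) (simp add: norm_triangle_ineq4)
  have d_circ: "(\<Sum>n. ?d n * cis t ^ n) = h (of_real r * cis t) - h (of_real s * cis t)" for t
  proof -
    have "summable (\<lambda>n. (k n * of_real x ^ n) * cis t ^ n)" if "0 \<le> x" "x < 1" for x
      by (rule summable_norm_cancel) (use sm[OF that] in \<open>simp add: norm_mult norm_power\<close>)
    from suminf_diff[OF this[OF x(1) s(3)] this[OF s(1) x(2)]]
    show ?thesis unfolding circ[OF x(1) s(3)] circ[OF s(1) x(2)] by (simp add: left_diff_distrib)
  qed
  note p = parseval_unit_circle[OF d, unfolded d_circ]
  have le: "(cmod (?d n))\<^sup>2 \<le> (cmod (k n))\<^sup>2 * (r ^ n)\<^sup>2 - (cmod (k n))\<^sup>2 * (s ^ n)\<^sup>2" for n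
  proof -
    have "s ^ n \<le> r ^ n" "0 \<le> s ^ n" using s by (auto intro: power_mono)
    then have "s ^ n * s ^ n \<le> s ^ n * r ^ n" by (intro mult_left_mono) auto
    then have "(r ^ n - s ^ n)\<^sup>2 \<le> (r ^ n)\<^sup>2 - (s ^ n)\<^sup>2"
      by (simp add: power2_eq_square algebra_simps)
    then have "(cmod (k n))\<^sup>2 * (r ^ n - s ^ n)\<^sup>2 \<le> (cmod (k n))\<^sup>2 * ((r ^ n)\<^sup>2 - (s ^ n)\<^sup>2)"
      by (rule mult_left_mono) simp
    moreover have "?d n = k n * of_real (r ^ n - s ^ n)" by (simp add: right_diff_distrib)
    then have "(cmod (?d n))\<^sup>2 = (cmod (k n))\<^sup>2 * (r ^ n - s ^ n)\<^sup>2"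
      by (simp only: norm_mult norm_of_real power_mult_distrib power2_abs)
    ultimately show ?thesis by (simp add: right_diff_distrib)
  qed
  have "(\<Sum>n. (cmod (?d n))\<^sup>2) \<le> (\<Sum>n. (cmod (k n))\<^sup>2 * (r ^ n)\<^sup>2 - (cmod (k n))\<^sup>2 * (s ^ n)\<^sup>2)"
    using le p(1) pars(1) x s by (intro suminf_le summable_diff) auto
  also have "\<dots> = (\<Sum>n. (cmod (k n))\<^sup>2 * (r ^ n)\<^sup>2) - (\<Sum>n. (cmod (k n))\<^sup>2 * (s ^ n)\<^sup>2)"
    using pars(1) x s by (intro suminf_diff[symmetric]) auto
  finally have "2 * pi * (\<Sum>n. (cmod (?d n))\<^sup>2) \<le> 2 * pi * ((\<Sum>n. (cmod (k n))\<^sup>2 * (r ^ n)\<^sup>2) - (\<Sum>n. (cmod (k n))\<^sup>2 * (s ^ n)\<^sup>2))"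
    by (rule mult_left_mono) simp
  then show ?thesis
    using integral_unique[OF p(2)] pars(2)[OF x(1) s(3)] pars(2)[OF s(1) x(2)]
    by (simp add: right_diff_distrib)
qed

text \<open>The sum of the increments has a finite integral by monotone convergence, so it is finite
  almost everywhere; there the telescoping series converges absolutely.\<close>

lemma AE_convergent_of_summable_integrals:
  fixes u :: "nat \<Rightarrow> real \<Rightarrow> complex"
  assumes cont: "\<And>n. continuous_on {a..b} (u n)"
    and sm: "summable (\<lambda>n. integral {a..b} (\<lambda>t. cmod (u (Suc n) t - u n t)))"
  obtains N where "negligible N" "\<And>t. t \<in> {a..b} - N \<Longrightarrow> convergent (\<lambda>n. u n t)"
proof -
  define d where "d n t = cmod (u (Suc n) t - u n t)" for n t
  define I where "I n = integral {a..b} (d n)" for n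
  have cd: "continuous_on {a..b} (d n)" for n
    unfolding d_def by (intro continuous_intros cont)
  have hi: "(d n has_integral I n) {a..b}" for n
    unfolding I_def by (intro integrable_integral integrable_continuous_real cd)
  \<comment> \<open>Extended nonnegative values allow sum and integral to be exchanged before any
    convergence is known.\<close>
  let ?e = "\<lambda>n t. ennreal (indicator {a..b} t * d n t)"
  have ni: "(\<integral>\<^sup>+ t. ?e n t \<partial>lborel) = ennreal (I n)" for n
    using nn_integral_has_integral_lebesgue[OF _ hi[of n]]
    by (simp add: d_def ennreal_mult' indicator_def flip: ennreal_indicator)
  have me: "?e n \<in> borel_measurable lborel" for n
    using borel_measurable_continuous_on_indicator[OF _ cd[of n]] by simp
  have In: "0 \<le> I n" for n unfolding I_def by (rule integral_nonneg) (use hi in \<open>auto simp: d_def\<close>)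
  have sI: "summable I" using sm by (simp add: I_def[abs_def] d_def[abs_def])
  have "(\<integral>\<^sup>+ t. (\<Sum>n. ?e n t) \<partial>lborel) = (\<Sum>n. ennreal (I n))"
    using me by (subst nn_integral_suminf) (simp_all add: ni)
  also have "\<dots> \<noteq> \<infinity>"
    using sI In by (subst suminf_ennreal2) auto
  finally have "AE t in lborel. (\<Sum>n. ?e n t) \<noteq> \<infinity>"
    using me by (intro nn_integral_PInf_AE) auto
  then obtain N where N: "{t. \<not> (\<Sum>n. ?e n t) \<noteq> \<infinity>} \<subseteq> N" "emeasure lborel N = 0" "N \<in> sets lborel"
    by (auto elim: AE_E)
  have "N \<in> null_sets lebesgue" using N by (intro null_sets_completionI) auto
  then have "negligible N" by (simp add: negligible_iff_null_sets)
  moreover have "convergent (\<lambda>n. u n t)" if "t \<in> {a..b} - N" for t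
  proof -
    have "(\<Sum>n. ?e n t) \<noteq> \<infinity>" using N(1) that by blast
    then have "summable (\<lambda>n. indicator {a..b} t * d n t)"
      by (intro summable_suminf_not_top) (auto simp: d_def)
    then have "summable (\<lambda>n. u (Suc n) t - u n t)"
      using that by (intro summable_norm_cancel[of "\<lambda>n. u (Suc n) t - u n t"]) (simp add: d_def)
    then have "convergent (\<lambda>n. \<Sum>i<n. u (Suc i) t - u i t)"
      by (simp add: summable_iff_convergent)
    then have "convergent (\<lambda>n. u n t - u 0 t)" by (simp only: sum_lessThan_telescope[of "\<lambda>n. u n t"])
    then have "convergent (\<lambda>n. (u n t - u 0 t) + u 0 t)" by (intro convergent_add convergent_const)
    then show ?thesis by simp
  qed
  ultimately show ?thesis using that by blast
qed

text \<open>\<open>\<Phi>\<close> will be the sum of the integrals of \<open>|h|^2\<close> and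
  \<open>|g|^2\<close> over the circle of radius \<open>r\<close>. It is bounded because
  \<open>|h + cnj g|^2 = |h|^2 + |g|^2 + 2 Re (h g)\<close>, and the integral of the holomorphic
  product \<open>h g\<close> does not depend on the radius. Neither \<open>h\<close> nor
  \<open>g\<close> has to be bounded. The factor 2 in the last estimate comes from
  \<open>(x + y)^2 \<le> 2 x^2 + 2 y^2\<close>.\<close>

lemma integral_circle_difference_harmonic:
  fixes h g :: "complex \<Rightarrow> complex"
  assumes hol: "h holomorphic_on ball 0 1" "g holomorphic_on ball 0 1"
    and bound: "\<And>z. z \<in> ball 0 1 \<Longrightarrow> cmod (h z + cnj (g z)) \<le> M"
  obtains \<Phi> B where "\<And>r. 0 \<le> r \<Longrightarrow> r < 1 \<Longrightarrow> \<Phi> r \<le> (B::real)"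
    "\<And>s r. 0 \<le> s \<Longrightarrow> s \<le> r \<Longrightarrow> r < 1 \<Longrightarrow> \<Phi> s \<le> \<Phi> r"
    "\<And>s r. 0 \<le> s \<Longrightarrow> s \<le> r \<Longrightarrow> r < 1 \<Longrightarrow>
       integral {-pi..pi} (\<lambda>t. (cmod ((h (of_real r * cis t) + cnj (g (of_real r * cis t))) -
          (h (of_real s * cis t) + cnj (g (of_real s * cis t)))))\<^sup>2) \<le> 2 * (\<Phi> r - \<Phi> s)"
proof -
  define I where "I f r = integral {-pi..pi} (\<lambda>t. (cmod (f (of_real r * cis t)))\<^sup>2)" for f :: "complex \<Rightarrow> complex" and r
  define J where "J f r s = integral {-pi..pi} (\<lambda>t. (cmod (f (of_real r * cis t) - f (of_real s * cis t)))\<^sup>2)" for f :: "complex \<Rightarrow> complex" and r s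
  note cont = hol[THEN holomorphic_on_imp_continuous_on]
  have J_le: "J f r s \<le> I f r - I f s" if "f holomorphic_on ball 0 1" "0 \<le> s" "s \<le> r" "r < 1" for f s r
    unfolding J_def I_def using that by (rule integral_circle_difference)
  have J_nonneg: "0 \<le> J f r s" if "f holomorphic_on ball 0 1" "0 \<le> s" "s \<le> r" "r < 1" for f s r
    unfolding J_def
    by (intro integral_nonneg integrable_continuous_real continuous_intros continuous_on_circle holomorphic_on_imp_continuous_on that)
      (use that in auto)
  show ?thesis
  \<comment> \<open>The second summand of the bound absorbs
    \<open>- 2 * Re (2 * pi * (h 0 * g 0))\<close>, which the product \<open>h g\<close> leaves
    behind.\<close>
  proof (rule that[of "\<lambda>r. I h r + I g r" "2 * pi * M\<^sup>2 + 4 * pi * cmod (h 0 * g 0)"])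
    fix r :: real assume r: "0 \<le> r" "r < 1"
    note c = continuous_on_circle[OF cont(1) r] continuous_on_circle[OF cont(2) r]
    have 1: "((\<lambda>t. h (of_real r * cis t) * g (of_real r * cis t)) has_integral 2 * pi * (h 0 * g 0)) {-pi..pi}"
    proof -
      have "norm (complex_of_real r) < 1" using r by simp
      from holomorphic_on_scaled_disc2[OF hol this] obtain s where s: "1 < s"
        "(\<lambda>w. h (of_real r * w)) holomorphic_on ball 0 s" "(\<lambda>w. g (of_real r * w)) holomorphic_on ball 0 s" by blast
      from mean_unit_circle[OF holomorphic_on_mult[OF s(2,3)] s(1)] show ?thesis by simp
    qed
    have 2: "(cmod (h z))\<^sup>2 + (cmod (g z))\<^sup>2 \<le> M\<^sup>2 - 2 * Re (h z * g z)" if "z \<in> ball 0 1" for z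
    proof -
      have "(cmod (h z + cnj (g z)))\<^sup>2 = (cmod (h z))\<^sup>2 + (cmod (g z))\<^sup>2 + 2 * Re (h z * g z)"
        unfolding cmod_power2 by (simp add: power2_eq_square algebra_simps)
      moreover have "(cmod (h z + cnj (g z)))\<^sup>2 \<le> M\<^sup>2" using bound[OF that] by (intro power_mono) auto
      ultimately show ?thesis by simp
    qed
    have "I h r + I g r = integral {-pi..pi} (\<lambda>t. (cmod (h (of_real r * cis t)))\<^sup>2 + (cmod (g (of_real r * cis t)))\<^sup>2)"
      unfolding I_def using c by (intro Henstock_Kurzweil_Integration.integral_add[symmetric] integrable_continuous_real continuous_intros)
    also have "\<dots> \<le> integral {-pi..pi} (\<lambda>t. M\<^sup>2 - 2 * Re (h (of_real r * cis t) * g (of_real r * cis t)))"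
      using c r by (intro integral_le integrable_continuous_real continuous_intros 2) (auto simp: norm_mult)
    also have "\<dots> = 2 * pi * M\<^sup>2 - 2 * Re (2 * pi * (h 0 * g 0))"
    proof (rule integral_unique)
      have "((\<lambda>_. M\<^sup>2) has_integral 2 * pi * M\<^sup>2) {-pi..pi}"
        using has_integral_const_real[of "M\<^sup>2" "- pi" pi] by simp
      then show "((\<lambda>t. M\<^sup>2 - 2 * Re (h (of_real r * cis t) * g (of_real r * cis t))) has_integral
        2 * pi * M\<^sup>2 - 2 * Re (2 * pi * (h 0 * g 0))) {-pi..pi}"
        by (intro has_integral_diff has_integral_mult_right has_integral_Re 1)
    qed
    also have "\<dots> \<le> 2 * pi * M\<^sup>2 + 4 * pi * cmod (h 0 * g 0)"
    proof -
      have "\<bar>Re (2 * pi * (h 0 * g 0))\<bar> \<le> cmod (2 * pi * (h 0 * g 0))" by (rule abs_Re_le_cmod)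
      also have "\<dots> = 2 * pi * cmod (h 0 * g 0)" by (simp add: norm_mult)
      finally show ?thesis by linarith
    qed
    finally show "I h r + I g r \<le> 2 * pi * M\<^sup>2 + 4 * pi * cmod (h 0 * g 0)" .
  next
    fix s r :: real assume *: "0 \<le> s" "s \<le> r" "r < 1"
    show "I h s + I g s \<le> I h r + I g r"
      using J_le[OF hol(1) *] J_le[OF hol(2) *] J_nonneg[OF hol(1) *] J_nonneg[OF hol(2) *] by linarith
    have r: "0 \<le> r" "s < 1" using * by auto
    note c = continuous_on_circle[OF cont(1) r(1) *(3)] continuous_on_circle[OF cont(2) r(1) *(3)]
      continuous_on_circle[OF cont(1) *(1) r(2)] continuous_on_circle[OF cont(2) *(1) r(2)]
    have sq: "(cmod (x + cnj y))\<^sup>2 \<le> 2 * (cmod x)\<^sup>2 + 2 * (cmod y)\<^sup>2" for x y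
    proof -
      have "(cmod (x + cnj y))\<^sup>2 \<le> (cmod x + cmod y)\<^sup>2"
        using norm_triangle_ineq[of x "cnj y"] by (intro power_mono) auto
      also have "\<dots> \<le> 2 * (cmod x)\<^sup>2 + 2 * (cmod y)\<^sup>2"
        using zero_le_power2[of "cmod x - cmod y"] by (simp add: power2_eq_square algebra_simps)
      finally show ?thesis .
    qed
    have "integral {-pi..pi} (\<lambda>t. (cmod ((h (of_real r * cis t) + cnj (g (of_real r * cis t))) -
          (h (of_real s * cis t) + cnj (g (of_real s * cis t)))))\<^sup>2)
      \<le> integral {-pi..pi} (\<lambda>t. 2 * (cmod (h (of_real r * cis t) - h (of_real s * cis t)))\<^sup>2 +
          2 * (cmod (g (of_real r * cis t) - g (of_real s * cis t)))\<^sup>2)"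
    proof (intro integral_le integrable_continuous_real continuous_intros c)
      fix t :: real
      show "(cmod ((h (of_real r * cis t) + cnj (g (of_real r * cis t))) -
          (h (of_real s * cis t) + cnj (g (of_real s * cis t)))))\<^sup>2
         \<le> 2 * (cmod (h (of_real r * cis t) - h (of_real s * cis t)))\<^sup>2 +
          2 * (cmod (g (of_real r * cis t) - g (of_real s * cis t)))\<^sup>2"
        using sq[of "h (of_real r * cis t) - h (of_real s * cis t)" "g (of_real r * cis t) - g (of_real s * cis t)"]
        by (simp add: algebra_simps)
    qed
    also have "\<dots> = 2 * J h r s + 2 * J g r s"
      unfolding J_def using c
      by (subst Henstock_Kurzweil_Integration.integral_add)
        (auto intro!: integrable_continuous_real continuous_intros)
    also have "\<dots> \<le> 2 * (I h r + I g r - (I h s + I g s))"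
      using add_mono[OF J_le[OF hol(1) *] J_le[OF hol(2) *]] by (simp add: algebra_simps)
    finally show "integral {-pi..pi} (\<lambda>t. (cmod ((h (of_real r * cis t) + cnj (g (of_real r * cis t))) -
          (h (of_real s * cis t) + cnj (g (of_real s * cis t)))))\<^sup>2) \<le> 2 * (I h r + I g r - (I h s + I g s))" .
  qed
qed

text \<open>\<open>\<Phi>\<close> increases to a finite supremum, so radii can be chosen along which
  it converges geometrically. Then successive mean square differences decay geometrically,
  successive mean differences are summable, and the functions on the circles converge almost
  everywhere; dominated convergence improves this to convergence in mean. The limit \<open>u\<close>
  plays the role of the boundary values until pointwise limits are available.\<close>

lemma harmonic_circle_limits:
  fixes h g :: "complex \<Rightarrow> complex"
  assumes hol: "h holomorphic_on ball 0 1" "g holomorphic_on ball 0 1"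
    and bound: "\<And>z. z \<in> ball 0 1 \<Longrightarrow> cmod (h z + cnj (g z)) \<le> M"
  obtains r u where "\<And>n :: nat. 0 \<le> r n" "\<And>n. r n < 1" "r \<longlonglongrightarrow> 1"
    "u integrable_on {-pi..pi}" "\<And>t. t \<in> {-pi..pi} \<Longrightarrow> cmod (u t) \<le> M"
    "(\<lambda>n. integral {-pi..pi} (\<lambda>t. cmod (h (of_real (r n) * cis t) + cnj (g (of_real (r n) * cis t)) - u t))) \<longlonglongrightarrow> 0"
    "\<And>n. (\<lambda>t. cmod (h (of_real (r n) * cis t) + cnj (g (of_real (r n) * cis t)) - u t)) integrable_on {-pi..pi}"
proof -
  let ?F = "\<lambda>z. h z + cnj (g z)"
  have contF: "continuous_on (ball 0 1) ?F"
    using hol[THEN holomorphic_on_imp_continuous_on] by (intro continuous_intros)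
  obtain \<Phi> B where \<Phi>: "\<And>r. 0 \<le> r \<Longrightarrow> r < 1 \<Longrightarrow> \<Phi> r \<le> (B::real)"
    "\<And>s r. 0 \<le> s \<Longrightarrow> s \<le> r \<Longrightarrow> r < 1 \<Longrightarrow> \<Phi> s \<le> \<Phi> r"
    "\<And>s r. 0 \<le> s \<Longrightarrow> s \<le> r \<Longrightarrow> r < 1 \<Longrightarrow>
       integral {-pi..pi} (\<lambda>t. (cmod (?F (of_real r * cis t) - ?F (of_real s * cis t)))\<^sup>2) \<le> 2 * (\<Phi> r - \<Phi> s)"
    using integral_circle_difference_harmonic[OF hol bound] by blast
  define L where "L = (SUP r\<in>{0..<1}. \<Phi> r)"
  have bdd: "bdd_above (\<Phi> ` {0..<1})" using \<Phi>(1) by (auto intro!: bdd_aboveI[of _ B])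
  have le_L: "\<Phi> r \<le> L" if "0 \<le> r" "r < 1" for r
    unfolding L_def using that by (intro cSUP_upper bdd) auto
  have "\<exists>\<rho>. 0 \<le> \<rho> \<and> \<rho> < 1 \<and> L - (1/4) ^ n < \<Phi> \<rho>" for n
  proof -
    have "L - (1/4) ^ n < (SUP r\<in>{0..<1}. \<Phi> r)" unfolding L_def by simp
    then obtain \<rho> where "\<rho> \<in> {0..<1}" "L - (1/4) ^ n < \<Phi> \<rho>"
      by (subst (asm) less_cSUP_iff[OF _ bdd]) auto
    then show ?thesis by auto
  qed
  then obtain \<rho> where \<rho>: "\<And>n. 0 \<le> \<rho> n" "\<And>n. \<rho> n < 1" "\<And>n. L - (1/4) ^ n < \<Phi> (\<rho> n)"
    by metis
  \<comment> \<open>Taking the maximum over all earlier \<open>\<rho>\<close> makes the radii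
    increase and keeps \<open>\<Phi> (r n)\<close> within \<open>(1/4) ^ n\<close> of the supremum
    \<open>L\<close>; the other entry forces the radii to 1.\<close>
  define r where "r n = max (1 - 1 / real (Suc n)) (Max (\<rho> ` {..n}))" for n
  have \<rho>_le: "\<rho> n \<le> Max (\<rho> ` {..n})" for n by (intro Max_ge) auto
  have r: "0 \<le> r n" "r n < 1" "\<rho> n \<le> r n" "1 - 1 / real (Suc n) \<le> r n" "r n \<le> r (Suc n)" for n
  proof -
    show "\<rho> n \<le> r n" using \<rho>_le[of n] unfolding r_def by (rule max.coboundedI2)
    then show "0 \<le> r n" using \<rho>(1)[of n] by linarith
    show "r n < 1" using \<rho>(2) by (simp add: r_def)
    show "1 - 1 / real (Suc n) \<le> r n" by (simp add: r_def)
    have "Max (\<rho> ` {..n}) \<le> Max (\<rho> ` {..Suc n})" by (intro Max_mono) auto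
    moreover have "1 - 1 / real (Suc n) \<le> 1 - 1 / real (Suc (Suc n))" by (simp add: frac_le)
    ultimately show "r n \<le> r (Suc n)" unfolding r_def by (rule max.mono[rotated])
  qed
  have r_lim: "r \<longlonglongrightarrow> 1"
  proof (rule tendsto_sandwich[of "\<lambda>n. 1 - 1 / real (Suc n)" _ _ "\<lambda>_. 1"])
    show "(\<lambda>n. 1 - 1 / real (Suc n)) \<longlonglongrightarrow> 1"
      by (rule LIMSEQ_one_minus_inverse_Suc)
  qed (use r(2,4) in \<open>auto intro!: always_eventually less_imp_le\<close>)
  define U where "U n t = ?F (of_real (r n) * cis t)" for n t
  have contU: "continuous_on {-pi..pi} (U n)" for n
    unfolding U_def by (rule continuous_on_circle[OF contF r(1,2)])
  have U_bound: "cmod (U n t) \<le> M" for n t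
    unfolding U_def using r(1,2)[of n] by (intro bound) (simp add: norm_mult)
  have int_d: "integral {-pi..pi} (\<lambda>t. cmod (U (Suc n) t - U n t)) \<le> (pi + 1) * (1/2) ^ n" for n
  proof -
    have "\<Phi> (r (Suc n)) - \<Phi> (r n) \<le> L - (L - (1/4) ^ n)"
      using le_L[OF r(1,2)] \<Phi>(2)[OF \<rho>(1) r(3,2)] \<rho>(3)[of n] by (intro diff_mono) (auto intro: order_trans less_imp_le)
    moreover have "integral {-pi..pi} (\<lambda>t. (cmod (U (Suc n) t - U n t))\<^sup>2) \<le> 2 * (\<Phi> (r (Suc n)) - \<Phi> (r n))"
      unfolding U_def by (rule \<Phi>(3)[OF r(1,5,2)])
    ultimately have sq: "integral {-pi..pi} (\<lambda>t. (cmod (U (Suc n) t - U n t))\<^sup>2) \<le> 2 * (1/4) ^ n" by simp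
    \<comment> \<open>The weight balances the two terms: the integral of the square is at most
      \<open>2 * (1/4) ^ n\<close>, so after multiplication by \<open>2 ^ n / 2\<close> both
      contributions have order \<open>(1/2) ^ n\<close>.\<close>
    have amgm: "x \<le> (1/2) ^ n / 2 + 2 ^ n / 2 * x\<^sup>2" for x :: real
    proof -
      have "0 \<le> (1 - 2 ^ n * x)\<^sup>2 * (1/2) ^ n" by simp
      also have "\<dots> = (1/2) ^ n + 2 ^ n * x\<^sup>2 - 2 * x"
        by (simp add: power2_eq_square algebra_simps power_one_over)
      finally show ?thesis by simp
    qed
    have "integral {-pi..pi} (\<lambda>t. cmod (U (Suc n) t - U n t))
       \<le> integral {-pi..pi} (\<lambda>t. (1/2) ^ n / 2 + 2 ^ n / 2 * (cmod (U (Suc n) t - U n t))\<^sup>2)"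
      by (intro integral_le integrable_continuous_real continuous_intros contU amgm)
    also have "\<dots> = integral {-pi..pi} (\<lambda>t. (1/2) ^ n / 2) + 2 ^ n / 2 * integral {-pi..pi} (\<lambda>t. (cmod (U (Suc n) t - U n t))\<^sup>2)"
    proof -
      have "integral {-pi..pi} (\<lambda>t. (1/2) ^ n / 2 + 2 ^ n / 2 * (cmod (U (Suc n) t - U n t))\<^sup>2) =
        integral {-pi..pi} (\<lambda>t. (1/2) ^ n / 2) + integral {-pi..pi} (\<lambda>t. 2 ^ n / 2 * (cmod (U (Suc n) t - U n t))\<^sup>2)"
        by (intro Henstock_Kurzweil_Integration.integral_add integrable_continuous_real continuous_intros contU)
      then show ?thesis by simp
    qed
    also have "\<dots> \<le> pi * (1/2) ^ n + 2 ^ n / 2 * (2 * (1/4) ^ n)"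
      using sq by (intro add_mono mult_left_mono) auto
    also have "(2::real) ^ n / 2 * (2 * (1/4) ^ n) = (2 * (1/4)) ^ n"
      by (simp only: power_mult_distrib)
    also have "pi * (1/2) ^ n + (2 * (1/4)) ^ n = (pi + 1) * (1/2) ^ n"
      by (simp add: distrib_right)
    finally show ?thesis .
  qed
  have "summable (\<lambda>n. integral {-pi..pi} (\<lambda>t. cmod (U (Suc n) t - U n t)))"
  proof (rule summable_comparison_test'[of _ 0])
    show "summable (\<lambda>n. (pi + 1) * (1/2) ^ n)" by (intro summable_mult summable_geometric) simp
    show "norm (integral {-pi..pi} (\<lambda>t. cmod (U (Suc n) t - U n t))) \<le> (pi + 1) * (1/2) ^ n" for n
    proof -
      have "0 \<le> integral {-pi..pi} (\<lambda>t. cmod (U (Suc n) t - U n t))"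
        by (intro integral_nonneg integrable_continuous_real continuous_intros contU) auto
      then show ?thesis using int_d[of n] by simp
    qed
  qed
  then obtain N where N: "negligible N" "\<And>t. t \<in> {-pi..pi} - N \<Longrightarrow> convergent (\<lambda>n. U n t)"
    by (rule AE_convergent_of_summable_integrals[OF contU]) (rule that)
  \<comment> \<open>Setting both the approximants and the limit to 0 on the null set gives
    convergence at every point, as dominated convergence asks, without altering any
    integral.\<close>
  define u where "u t = (if t \<in> N then 0 else lim (\<lambda>n. U n t))" for t
  define V where "V n t = (if t \<in> N then 0 else U n t)" for n t
  have V_lim: "(\<lambda>n. V n t) \<longlonglongrightarrow> u t" if "t \<in> {-pi..pi}" for t
    using N(2)[of t] that by (auto simp: V_def u_def convergent_LIMSEQ_iff)
  have "0 \<le> M" using order_trans[OF norm_ge_zero U_bound] .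
  then have V_bound: "cmod (V n t) \<le> M" for n t using U_bound by (simp add: V_def)
  have V_int: "V n integrable_on {-pi..pi}" for n
    by (rule integrable_spike[OF integrable_continuous_real[OF contU[of n]] N(1)]) (simp add: V_def)
  have u_int: "u integrable_on {-pi..pi}"
    by (rule dominated_convergence(1)[of V, OF V_int integrable_const_ivl[of M] V_bound V_lim])
  have u_bound: "cmod (u t) \<le> M" if "t \<in> {-pi..pi}" for t
    using tendsto_norm[OF V_lim[OF that]] by (rule LIMSEQ_le_const2) (use V_bound in auto)
  have d_int: "(\<lambda>t. cmod (V n t - u t)) integrable_on {-pi..pi}" for n
  proof -
    have "(\<lambda>t. V n t - u t) absolutely_integrable_on {-pi..pi}"
    proof (rule absolutely_integrable_integrable_bound)
      show "(\<lambda>t. V n t - u t) integrable_on {-pi..pi}" using V_int u_int by (rule integrable_diff)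
      show "(\<lambda>t. 2 * M) integrable_on {-pi..pi}" by (rule integrable_const_ivl)
      show "norm (V n t - u t) \<le> 2 * M" if "t \<in> {-pi..pi}" for t
        using norm_triangle_ineq4[of "V n t" "u t"] V_bound[of n t] u_bound[OF that] by linarith
    qed
    then show ?thesis by (simp add: absolutely_integrable_on_def)
  qed
  have "(\<lambda>n. integral {-pi..pi} (\<lambda>t. cmod (V n t - u t))) \<longlonglongrightarrow> integral {-pi..pi} (\<lambda>t. 0)"
  proof (rule dominated_convergence(2)[of "\<lambda>n t. cmod (V n t - u t)", OF d_int integrable_const_ivl[of "2 * M"]])
    show "norm (cmod (V n t - u t)) \<le> 2 * M" if "t \<in> {-pi..pi}" for n t
      using norm_triangle_ineq4[of "V n t" "u t"] V_bound[of n t] u_bound[OF that] by simp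
    show "(\<lambda>n. cmod (V n t - u t)) \<longlonglongrightarrow> 0" if "t \<in> {-pi..pi}" for t
      using V_lim[OF that] by (simp add: LIM_zero_iff tendsto_norm_zero)
  qed
  moreover have spike: "(\<lambda>t. cmod (U n t - u t)) integrable_on {-pi..pi}"
    "integral {-pi..pi} (\<lambda>t. cmod (U n t - u t)) = integral {-pi..pi} (\<lambda>t. cmod (V n t - u t))" for n
    by (rule integrable_spike[OF d_int[of n] N(1)], simp add: V_def)
      (rule integral_spike[OF N(1)], simp add: V_def)
  ultimately have "(\<lambda>n. integral {-pi..pi} (\<lambda>t. cmod (U n t - u t))) \<longlonglongrightarrow> 0" by simp
  from that[of r u, OF r(1,2) r_lim u_int u_bound this[unfolded U_def] spike(1)[unfolded U_def]]
  show ?thesis .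
qed

section \<open>Arcs and Jordan domains\<close>

lemma cis_eqD:
  assumes "cis s = cis t" "\<bar>s - t\<bar> < 2 * pi"
  shows "s = t"
proof -
  have "sin s = sin t \<and> cos s = cos t"
    using assms(1) by (simp add: complex_eq_iff)
  then obtain n :: int where n: "s = t + 2 * pi * n"
    unfolding sin_cos_eq_iff by blast
  with assms(2) have "2 * pi * \<bar>real_of_int n\<bar> < 2 * pi * 1"
    by (simp add: abs_mult)
  then have "\<bar>real_of_int n\<bar> < 1"
    by (subst (asm) mult_less_cancel_left_pos) simp_all
  then have "n = 0" by linarith
  then show ?thesis using n by simp
qed

lemma cis_shift_into:
  obtains t' where "a \<le> t'" "t' < a + 2 * pi" "cis t' = cis t"
proof -
  define t' where "t' = a + 2 * pi * frac ((t - a) / (2 * pi))"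
  have "t' = t + 2 * pi * of_int (- \<lfloor>(t - a) / (2 * pi)\<rfloor>)"
    by (simp add: t'_def frac_def field_simps)
  then have "cis t' = cis t"
    by (metis Ints_of_int cis_mult cis_multiple_2pi mult.right_neutral)
  moreover have "a \<le> t'" "t' < a + 2 * pi"
    using frac_lt_1[of "(t - a) / (2 * pi)"] by (simp_all add: t'_def)
  ultimately show ?thesis using that by blast
qed

lemma polar_decomposition:
  obtains t where "a \<le> t" "t < a + 2 * pi" "z = of_real (norm z) * cis t"
  using cis_shift_into[of a "Arg z"] rcis_cmod_Arg[of z] unfolding rcis_def by metis

lemma polar_eqD:
  assumes "of_real r * cis t = of_real r' * cis t'" "0 < r" "0 \<le> r'"
  shows "r = r'" "cis t = cis t'"
proof -
  have "cmod (of_real r * cis t) = cmod (of_real r' * cis t')" using assms(1) by (rule arg_cong)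
  then show "r = r'" using assms(2,3) by (simp add: norm_mult)
  with assms show "cis t = cis t'" by simp
qed

text \<open>A Jordan curve is uniformly locally arcwise connected. The short arc is found on the
  round circle, where it is explicit, and carried back by a homeomorphism; uniform continuity in
  both directions makes \<open>\<delta>\<close> independent of the two points.\<close>

lemma small_arc_in_simple_closed_curve:
  assumes "simple_path \<gamma>" "pathfinish \<gamma> = pathstart \<gamma>" "0 < \<epsilon>"
  obtains \<delta> where "0 < \<delta>"
    "\<And>p q. p \<in> path_image \<gamma> \<Longrightarrow> q \<in> path_image \<gamma> \<Longrightarrow> p \<noteq> q \<Longrightarrow> dist p q < \<delta> \<Longrightarrow>
       \<exists>c :: real \<Rightarrow> complex. arc c \<and> pathstart c = p \<and> pathfinish c = q \<and> path_image c \<subseteq> path_image \<gamma> \<inter> ball p \<epsilon>"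
proof -
  have "path_image \<gamma> homeomorphic sphere (0::complex) 1"
    using assms by (intro homeomorphic_simple_path_image_circle) auto
  then obtain k h where hom: "homeomorphism (path_image \<gamma>) (sphere (0::complex) 1) k h"
    unfolding homeomorphic_def by blast
  have "uniformly_continuous_on (sphere 0 1) h"
    using hom by (intro compact_uniformly_continuous) (auto simp: homeomorphism_def)
  then obtain \<eta> where \<eta>: "0 < \<eta>" "\<And>u v. u \<in> sphere 0 1 \<Longrightarrow> v \<in> sphere 0 1 \<Longrightarrow> dist v u < \<eta> \<Longrightarrow> dist (h v) (h u) < \<epsilon>"
    using \<open>0 < \<epsilon>\<close> unfolding uniformly_continuous_on_def by metis
  have "uniformly_continuous_on (path_image \<gamma>) k"
    using hom assms by (intro compact_uniformly_continuous) (auto simp: homeomorphism_def compact_simple_path_image)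
  then obtain \<delta> where \<delta>: "0 < \<delta>" "\<And>p q. p \<in> path_image \<gamma> \<Longrightarrow> q \<in> path_image \<gamma> \<Longrightarrow> dist q p < \<delta> \<Longrightarrow> dist (k q) (k p) < \<eta>"
    using \<eta>(1) unfolding uniformly_continuous_on_def by metis
  show ?thesis
  proof (rule that[OF \<delta>(1)])
    fix p q assume pq: "p \<in> path_image \<gamma>" "q \<in> path_image \<gamma>" "p \<noteq> q" "dist p q < \<delta>"
    define u v where "u = k p" and "v = k q"
    define \<tau> where "\<tau> = Arg (v / u)"
    have uv: "norm u = 1" "norm v = 1" "h u = p" "h v = q"
      using hom pq by (auto simp: u_def v_def homeomorphism_def)
    have "u \<noteq> v" using uv pq by auto
    have ne: "v / u \<noteq> 0" using uv by auto
    have v: "v = u * cis \<tau>"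
      using cis_Arg[OF ne] uv by (auto simp: \<tau>_def sgn_div_norm norm_divide)
    have \<tau>: "\<bar>\<tau>\<bar> \<le> pi" using Arg_bounded[of "v / u"] by (auto simp: \<tau>_def)
    have "\<tau> \<noteq> 0" using v \<open>u \<noteq> v\<close> by auto
    \<comment> \<open>The shorter circular arc from \<open>u\<close> to \<open>v\<close>, since the
      principal argument \<open>\<tau>\<close> has modulus at most \<open>pi\<close>.\<close>
    define e where "e = (\<lambda>x::real. u * cis (\<tau> * x))"
    have e_sph: "e x \<in> sphere 0 1" for x
      by (simp add: e_def norm_mult uv)
    have e_close: "dist (e x) u < \<eta>" if "x \<in> {0..1}" for x
    proof -
      have "\<bar>\<tau> * x\<bar> \<le> \<bar>\<tau>\<bar>" using that by (simp add: abs_mult mult_left_le)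
      \<comment> \<open>Cosine decreases on \<open>{0..pi}\<close>, so along the shorter arc no
        point is farther from \<open>u\<close> than the endpoint \<open>v\<close> is.\<close>
      then have "cos \<bar>\<tau>\<bar> \<le> cos \<bar>\<tau> * x\<bar>" using \<tau> by (intro cos_monotone_0_pi_le) auto
      then have c: "cos \<tau> \<le> cos (\<tau> * x)" by simp
      have sq: "(cmod (cis a - 1))\<^sup>2 = 2 - 2 * cos a" for a
        using sin_cos_squared_add[of a] by (simp add: cmod_def) (simp add: power2_eq_square algebra_simps)
      have "(cmod (cis (\<tau> * x) - 1))\<^sup>2 \<le> (cmod (cis \<tau> - 1))\<^sup>2"
        unfolding sq using c by simp
      then have le: "cmod (cis (\<tau> * x) - 1) \<le> cmod (cis \<tau> - 1)"
        by (rule power2_le_imp_le) simp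
      have d: "dist (u * w) u = cmod (w - 1)" for w
        using uv(1) norm_mult[of u "w - 1"] by (simp add: dist_norm algebra_simps)
      have "dist (e x) u \<le> dist v u"
        unfolding e_def v d by (rule le)
      also have "dist v u < \<eta>" using \<delta>(2)[of p q] pq by (simp add: u_def v_def dist_commute)
      finally show ?thesis .
    qed
    have h_inj: "inj_on h (sphere 0 1)" "continuous_on (sphere 0 1) h" "h ` sphere 0 1 = path_image \<gamma>"
      using hom by (auto simp: homeomorphism_def intro!: inj_on_inverseI[of _ k])
    have inj: "inj_on e {0..1}"
    proof (rule inj_onI)
      fix x y assume xy: "x \<in> {0..1}" "y \<in> {0..1}" "e x = e y"
      then have c: "cis (\<tau> * x) = cis (\<tau> * y)" using uv by (auto simp: e_def)
      have "\<bar>x - y\<bar> \<le> 1" using xy by auto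
      then have "\<bar>\<tau>\<bar> * \<bar>x - y\<bar> \<le> \<bar>\<tau>\<bar> * 1" by (rule mult_left_mono) simp
      then have "\<bar>\<tau> * x - \<tau> * y\<bar> \<le> pi" using \<tau> by (simp add: abs_mult flip: right_diff_distrib)
      then have "\<bar>\<tau> * x - \<tau> * y\<bar> < 2 * pi" using pi_gt_zero by linarith
      from cis_eqD[OF c this] \<open>\<tau> \<noteq> 0\<close> show "x = y" by simp
    qed
    have ce: "continuous_on {0..1} e" unfolding e_def by (intro continuous_intros)
    have "arc (h \<circ> e)"
      unfolding arc_def path_def
    proof
      show "continuous_on {0..1} (h \<circ> e)"
        using ce e_sph by (intro continuous_on_compose continuous_on_subset[OF h_inj(2)]) auto
      show "inj_on (h \<circ> e) {0..1}"
        using inj e_sph by (intro comp_inj_on inj_on_subset[OF h_inj(1)]) auto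
    qed
    moreover have "path_image (h \<circ> e) \<subseteq> path_image \<gamma> \<inter> ball p \<epsilon>"
    proof
      fix y assume "y \<in> path_image (h \<circ> e)"
      then obtain x where x: "x \<in> {0..1}" "y = h (e x)" by (auto simp: path_image_def)
      have "dist (h (e x)) (h u) < \<epsilon>" using \<eta>(2)[of u "e x"] e_sph uv e_close x by simp
      then show "y \<in> path_image \<gamma> \<inter> ball p \<epsilon>"
        using x e_sph h_inj(3) uv(3) by (auto simp: dist_commute)
    qed
    moreover have "pathstart (h \<circ> e) = p" "pathfinish (h \<circ> e) = q"
      using uv v by (auto simp: pathstart_def pathfinish_def e_def)
    ultimately show "\<exists>c. arc c \<and> pathstart c = p \<and> pathfinish c = q \<and> path_image c \<subseteq> path_image \<gamma> \<inter> ball p \<epsilon>"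
      by blast
  qed
qed

text \<open>A connected set that misses the frontier of \<Omega> and meets \<Omega> lies in
  \<Omega>. For the outside of the curve this contradicts boundedness, so \<Omega> is contained in
  the inside; applied to the inside, it gives the other inclusion.\<close>

lemma Jordan_domain_eq_inside:
  fixes \<gamma> :: "real \<Rightarrow> complex"
  assumes "open \<Omega>" "connected \<Omega>" "\<Omega> \<noteq> {}" "bounded \<Omega>"
    and \<gamma>: "simple_path \<gamma>" "pathfinish \<gamma> = pathstart \<gamma>" "frontier \<Omega> = path_image \<gamma>"
  shows "\<Omega> = inside (path_image \<gamma>)"
proof -
  let ?C = "path_image \<gamma>"
  note J = Jordan_inside_outside[OF \<gamma>(1,2)]
  have dis: "\<Omega> \<inter> ?C = {}"
    using \<open>open \<Omega>\<close> \<gamma>(3) by (metis frontier_disjoint_eq Int_commute)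
  have sub: "X \<subseteq> \<Omega>" if "connected X" "X \<inter> ?C = {}" "X \<inter> \<Omega> \<noteq> {}" for X
    using connected_Int_frontier[of X \<Omega>] that \<gamma>(3) by blast
  have "\<Omega> \<inter> outside ?C = {}"
    using sub[of "outside ?C"] J \<open>bounded \<Omega>\<close> by (metis Int_commute bounded_subset outside_no_overlap)
  moreover have "\<Omega> \<subseteq> inside ?C \<union> outside ?C"
    using dis J by blast
  ultimately have "\<Omega> \<subseteq> inside ?C" by blast
  moreover have "inside ?C \<subseteq> \<Omega>"
    using sub[of "inside ?C"] J \<open>\<Omega> \<subseteq> inside ?C\<close> \<open>\<Omega> \<noteq> {}\<close>
    by (metis Int_absorb1 Int_commute inside_no_overlap)
  ultimately show ?thesis by blast
qed

text \<open>By invariance of domain the inverse of \<open>f\<close> is continuous. If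
  \<open>p\<close> were a value of \<open>f\<close>, the points \<open>z n\<close> would converge to
  its preimage, which has norm below 1.\<close>

lemma cluster_point_in_frontier:
  fixes f :: "complex \<Rightarrow> complex"
  assumes f: "continuous_on (ball 0 1) f" "inj_on f (ball 0 1)"
    and z: "\<And>n :: nat. z n \<in> ball 0 1" "(\<lambda>n. norm (z n)) \<longlonglongrightarrow> 1" "(\<lambda>n. f (z n)) \<longlonglongrightarrow> p"
  shows "p \<in> frontier (f ` ball 0 1)"
proof -
  obtain g where g: "homeomorphism (ball 0 1) (f ` ball 0 1) f g"
    using invariance_of_domain_homeomorphism[OF open_ball f(1) _ f(2)] by auto
  have op: "open (f ` ball 0 1)"
    using invariance_of_domain f by blast
  have "p \<in> closure (f ` ball 0 1)"
    unfolding closure_sequential using z(1,3) by (intro exI[of _ "\<lambda>n. f (z n)"]) auto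
  moreover have "p \<notin> f ` ball 0 1"
  proof
    assume p: "p \<in> f ` ball 0 1"
    have "continuous_on (f ` ball 0 1) g" using g by (auto simp: homeomorphism_def)
    then have "isCont g p" using p op by (auto simp: continuous_on_eq_continuous_at)
    then have "(\<lambda>n. g (f (z n))) \<longlonglongrightarrow> g p" using z(3) by (rule isCont_tendsto_compose)
    moreover have "g (f (z n)) = z n" for n using g z(1) by (auto simp: homeomorphism_def)
    ultimately have "z \<longlonglongrightarrow> g p" by simp
    then have "(\<lambda>n. norm (z n)) \<longlonglongrightarrow> norm (g p)" by (rule tendsto_norm)
    then have "norm (g p) = 1" using z(2) by (rule LIMSEQ_unique)
    moreover have "g p \<in> ball 0 1" using g p by (auto simp: homeomorphism_def)
    ultimately show False by simp
  qed
  ultimately show ?thesis using op by (simp add: frontier_def interior_open)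
qed

text \<open>Arcs are intervals of real angles, not reduced modulo \<open>2 * pi\<close>, so the arc
  complementary to \<open>(\<theta>1, \<theta>2)\<close> can be written as
  \<open>(\<theta>2, \<theta>1 + 2 * pi)\<close>. The radius \<open>\<rho>\<close> is uniform over
  the arc; this is what later gives unrestricted and not just radial limits.\<close>

definition near_on_arc :: "(complex \<Rightarrow> complex) \<Rightarrow> real \<Rightarrow> real \<Rightarrow> complex \<Rightarrow> real \<Rightarrow> bool" where
  "near_on_arc f \<alpha> \<beta> p \<epsilon> \<longleftrightarrow>
     (\<exists>\<rho>. 0 \<le> \<rho> \<and> \<rho> < 1 \<and> (\<forall>r t. \<rho> < r \<and> r < 1 \<and> \<alpha> < t \<and> t < \<beta> \<longrightarrow> dist (f (of_real r * cis t)) p < \<epsilon>))"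

definition radial_limit :: "(complex \<Rightarrow> complex) \<Rightarrow> real \<Rightarrow> complex \<Rightarrow> bool" where
  "radial_limit f \<theta> w \<longleftrightarrow> ((\<lambda>r. f (of_real r * cis \<theta>)) \<longlongrightarrow> w) (at_left 1)"

definition sector :: "real \<Rightarrow> real \<Rightarrow> complex set" where
  "sector \<alpha> \<beta> = (\<lambda>(r, t). of_real r * cis t) ` ({0<..<1} \<times> {\<alpha><..<\<beta>})"

lemma sector_subset: "sector \<alpha> \<beta> \<subseteq> ball 0 1"
  by (auto simp: sector_def norm_mult)

lemma connected_sector: "connected (sector \<alpha> \<beta>)"
  unfolding sector_def case_prod_beta
  by (intro connected_continuous_image continuous_intros connected_Times) auto

text \<open>If no \<open>\<rho>\<close> worked, there would be points of the sector tending to the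
  circle with images at distance at least \<open>\<epsilon>\<close> from \<open>p\<close>. A cluster
  value of these images lies both on the frontier and in the closure of the image of the sector,
  hence in the ball.\<close>

lemma near_on_arcI:
  assumes "continuous_on (ball 0 1) f" "inj_on f (ball 0 1)" "bounded (f ` ball 0 1)"
    and "closure (f ` sector \<alpha> \<beta>) \<inter> frontier (f ` ball 0 1) \<subseteq> ball p \<epsilon>"
  shows "near_on_arc f \<alpha> \<beta> p \<epsilon>"
proof (rule ccontr)
  assume not: "\<not> near_on_arc f \<alpha> \<beta> p \<epsilon>"
  have "\<exists>z. z \<in> sector \<alpha> \<beta> \<and> norm z > 1 - 1 / real (Suc n) \<and> dist (f z) p \<ge> \<epsilon>" for n
  proof -
    have "0 \<le> 1 - 1 / real (Suc n)" "1 - 1 / real (Suc n) < 1" by auto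
    with not obtain r t where rt: "1 - 1 / real (Suc n) < r" "r < 1" "\<alpha> < t" "t < \<beta>" "dist (f (of_real r * cis t)) p \<ge> \<epsilon>"
      unfolding near_on_arc_def by (meson not_le)
    then have "0 < r" using \<open>0 \<le> 1 - 1 / real (Suc n)\<close> by linarith
    with rt show ?thesis
      by (intro exI[of _ "of_real r * cis t"]) (auto simp: sector_def norm_mult)
  qed
  then obtain z where z: "\<And>n. z n \<in> sector \<alpha> \<beta>" "\<And>n. norm (z n) > 1 - 1 / real (Suc n)" "\<And>n. dist (f (z n)) p \<ge> \<epsilon>"
    by metis
  have zb: "z n \<in> ball 0 1" for n using z(1) sector_subset by blast
  have lim: "(\<lambda>n. norm (z n)) \<longlonglongrightarrow> 1"
  proof (rule tendsto_sandwich[of "\<lambda>n. 1 - 1 / real (Suc n)" _ _ "\<lambda>_. 1"])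
    show "(\<lambda>n. 1 - 1 / real (Suc n)) \<longlonglongrightarrow> 1"
      by (rule LIMSEQ_one_minus_inverse_Suc)
  qed (use z(2) zb in \<open>auto intro!: always_eventually less_imp_le\<close>)
  have "bounded (range (\<lambda>n. f (z n)))"
    using zb by (intro bounded_subset[OF assms(3)]) auto
  then obtain l and s :: "nat \<Rightarrow> nat" where s: "strict_mono s" "((\<lambda>n. f (z n)) \<circ> s) \<longlonglongrightarrow> l"
    using bounded_imp_convergent_subsequence by blast
  have "l \<in> frontier (f ` ball 0 1)"
  proof (rule cluster_point_in_frontier[OF assms(1,2), of "z \<circ> s"])
    show "(\<lambda>n. norm ((z \<circ> s) n)) \<longlonglongrightarrow> 1"
      using LIMSEQ_subseq_LIMSEQ[OF lim s(1)] by (simp add: o_def)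
  qed (use s zb in \<open>auto simp: o_def\<close>)
  moreover have "l \<in> closure (f ` sector \<alpha> \<beta>)"
    unfolding closure_sequential using s(2) z(1) by (intro exI[of _ "\<lambda>n. f (z (s n))"]) (auto simp: o_def)
  ultimately have "dist l p < \<epsilon>" using assms(4) by (auto simp: dist_commute)
  moreover have "(\<lambda>n. dist (f (z (s n))) p) \<longlonglongrightarrow> dist l p"
    using s(2) by (intro tendsto_intros) (simp add: o_def)
  then have "dist l p \<ge> \<epsilon>"
    by (rule LIMSEQ_le_const) (use z(3) in auto)
  ultimately show False by simp
qed

text \<open>The endpoint is prescribed because the values of \<open>f\<close> on the unit circle
  carry no information; if \<open>w\<close> is the radial limit, the path is continuous at
  1.\<close>

definition radial_cut :: "(complex \<Rightarrow> complex) \<Rightarrow> real \<Rightarrow> complex \<Rightarrow> real \<Rightarrow> complex" where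
  "radial_cut f \<theta> w x = (if x = 1 then w else f (of_real x * cis \<theta>))"

lemma pathstart_radial_cut [simp]: "pathstart (radial_cut f \<theta> w) = f 0"
  and pathfinish_radial_cut [simp]: "pathfinish (radial_cut f \<theta> w) = w"
  by (simp_all add: pathstart_def pathfinish_def radial_cut_def)

lemma path_image_radial_cut:
  "path_image (radial_cut f \<theta> w) = insert w (f ` (\<lambda>r. of_real r * cis \<theta>) ` {0..<1})"
proof -
  have "{0..1::real} = insert 1 {0..<1}" by auto
  then show ?thesis
    by (auto simp: path_image_def radial_cut_def image_def)
qed

lemma arc_radial_cut:
  assumes f: "continuous_on (ball 0 1) f" "inj_on f (ball 0 1)"
    and w: "radial_limit f \<theta> w" "w \<notin> f ` ball 0 1"
  shows "arc (radial_cut f \<theta> w)"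
proof -
  have inj: "inj_on (radial_cut f \<theta> w) {0..1}"
  proof (rule inj_onI)
    fix x y assume xy: "x \<in> {0..1}" "y \<in> {0..1}" "radial_cut f \<theta> w x = radial_cut f \<theta> w y"
    have b: "of_real a * cis \<theta> \<in> ball 0 1" if "a \<in> {0..1}" "a \<noteq> 1" for a :: real
      using that by (simp add: norm_mult)
    have w': "f (of_real a * cis \<theta>) \<noteq> w" if "a \<in> {0..1}" "a \<noteq> 1" for a :: real
      using b[OF that] w(2) by blast
    show "x = y"
    proof (cases "x = 1 \<or> y = 1")
      case True
      then show ?thesis using xy w' by (auto simp: radial_cut_def split: if_splits)
    next
      case False
      then have "f (of_real x * cis \<theta>) = f (of_real y * cis \<theta>)" using xy(3) by (simp add: radial_cut_def)
      then have "of_real x * cis \<theta> = of_real y * cis \<theta>"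
        using f(2) b[OF xy(1)] b[OF xy(2)] False by (auto dest: inj_onD)
      then show ?thesis by simp
    qed
  qed
  have "continuous (at x within {0..1}) (radial_cut f \<theta> w)" if "x \<in> {0..1}" for x
  proof (cases "x = 1")
    case True
    have "((\<lambda>r. f (of_real r * cis \<theta>)) \<longlongrightarrow> w) (at 1 within {0..1})"
      using w(1) unfolding radial_limit_def
      by (rule filterlim_mono) (auto simp: at_within_le_at intro!: at_le[THEN order_trans] simp: at_within_Icc_at_left)
    then have "(radial_cut f \<theta> w \<longlongrightarrow> w) (at 1 within {0..1})"
      by (rule Lim_transform_eventually) (auto simp: eventually_at_filter radial_cut_def)
    then show ?thesis using True by (simp add: continuous_within radial_cut_def)
  next
    case False
    have "continuous_on {0..<1} (\<lambda>x. f (of_real x * cis \<theta>))"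
      by (intro continuous_on_compose2[OF f(1)] continuous_intros) (auto simp: norm_mult)
    then have "continuous (at x within {0..<1}) (\<lambda>x. f (of_real x * cis \<theta>))"
      using False that by (simp add: continuous_on_eq_continuous_within)
    moreover have "at x within {0..<1} = at x within {0..1}"
      by (rule at_within_nhd[of x "{..<1}"]) (use False that in auto)
    ultimately have "((\<lambda>x. f (of_real x * cis \<theta>)) \<longlongrightarrow> f (of_real x * cis \<theta>)) (at x within {0..1})"
      by (simp add: continuous_within)
    moreover have "\<forall>\<^sub>F y in at x within {0..1}. f (of_real y * cis \<theta>) = radial_cut f \<theta> w y"
      using eventually_at_topological[of _ x "{0..1}"] False that
      by (auto simp: radial_cut_def intro!: exI[of _ "- {1}"])
    ultimately have "(radial_cut f \<theta> w \<longlongrightarrow> f (of_real x * cis \<theta>)) (at x within {0..1})"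
      by (rule Lim_transform_eventually)
    then show ?thesis using False by (simp add: continuous_within radial_cut_def)
  qed
  with inj show ?thesis unfolding arc_def path_def by (simp add: continuous_on_eq_continuous_within)
qed

text \<open>The set \<open>{w1} \<inter> {w2}\<close> treats two situations at once: it is the
  common endpoint when the limits agree and empty otherwise.\<close>

lemma radial_cuts_meet:
  assumes "inj_on f (ball 0 1)" "w1 \<notin> f ` ball 0 1" "w2 \<notin> f ` ball 0 1" "\<theta>1 < \<theta>2" "\<theta>2 < \<theta>1 + 2 * pi"
  shows "path_image (radial_cut f \<theta>1 w1) \<inter> path_image (radial_cut f \<theta>2 w2) \<subseteq> {f 0} \<union> ({w1} \<inter> {w2})"
proof -
  have b: "of_real a * cis \<theta> \<in> ball 0 1" if "a \<in> {0..<1}" for a \<theta> :: real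
    using that by (simp add: norm_mult)
  have "of_real r1 * cis \<theta>1 = 0" if "r1 \<in> {0..<1}" "r2 \<in> {0..<1}" "f (of_real r1 * cis \<theta>1) = f (of_real r2 * cis \<theta>2)" for r1 r2 :: real
  proof (rule ccontr)
    assume ne: "of_real r1 * cis \<theta>1 \<noteq> 0"
    have "of_real r1 * cis \<theta>1 = of_real r2 * cis \<theta>2" using that assms(1) b by (auto dest: inj_onD)
    moreover have "0 < r1" using ne that by (cases "r1 = 0") auto
    ultimately have "cis \<theta>1 = cis \<theta>2" using polar_eqD(2)[of r1 \<theta>1 r2 \<theta>2] that by auto
    then have "\<theta>1 = \<theta>2" by (rule cis_eqD) (use assms in auto)
    then show False using assms by simp
  qed
  then show ?thesis using assms(2,3) b by (fastforce simp: path_image_radial_cut)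
qed

lemma disc_cut_by_radii:
  assumes "\<theta>1 < \<theta>2" "\<theta>2 < \<theta>1 + 2 * pi"
  shows "ball 0 1 \<subseteq> sector \<theta>1 \<theta>2 \<union> sector \<theta>2 (\<theta>1 + 2 * pi) \<union>
    (\<lambda>r. of_real r * cis \<theta>1) ` {0..<1} \<union> (\<lambda>r. of_real r * cis \<theta>2) ` {0..<1}"
proof
  fix z :: complex assume z: "z \<in> ball 0 1"
  obtain t where t: "\<theta>1 \<le> t" "t < \<theta>1 + 2 * pi" "z = of_real (norm z) * cis t"
    by (rule polar_decomposition)
  show "z \<in> sector \<theta>1 \<theta>2 \<union> sector \<theta>2 (\<theta>1 + 2 * pi) \<union>
    (\<lambda>r. of_real r * cis \<theta>1) ` {0..<1} \<union> (\<lambda>r. of_real r * cis \<theta>2) ` {0..<1}"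
  proof (cases "z = 0 \<or> t = \<theta>1 \<or> t = \<theta>2")
    case True
    then show ?thesis
    proof (elim disjE)
      assume "z = 0" then show ?thesis by (auto intro!: image_eqI[of _ _ 0])
    qed (use t z in auto)
  next
    case False
    then have "(norm z, t) \<in> {0<..<1} \<times> {\<theta>1<..<\<theta>2} \<or> (norm z, t) \<in> {0<..<1} \<times> {\<theta>2<..<\<theta>1 + 2 * pi}"
      using t z by auto
    then have "z \<in> sector \<theta>1 \<theta>2 \<or> z \<in> sector \<theta>2 (\<theta>1 + 2 * pi)"
      unfolding sector_def using image_eqI[of z "\<lambda>(r, t). of_real r * cis t" "(norm z, t)"] t(3) by auto
    then show ?thesis by blast
  qed
qed

text \<open>The hypotheses keep \<open>\<theta>\<close> outside the open interval of angles but less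
  than a full turn away from each of them, so equal directions would force equal angles. The origin
  is harmless, as sectors contain positive radii only.\<close>

lemma sector_Int_radius:
  assumes "\<alpha> - 2 * pi < \<theta>" "\<theta> \<le> \<alpha> \<or> \<beta> \<le> \<theta>" "\<theta> < \<alpha> + 2 * pi" "\<beta> \<le> \<theta> + 2 * pi"
  shows "sector \<alpha> \<beta> \<inter> (\<lambda>r. of_real r * cis \<theta>) ` {0..<1} = {}"
proof -
  have False if "0 < r" "\<alpha> < t" "t < \<beta>" "0 \<le> r'" "of_real r * cis t = of_real r' * cis \<theta>" for r t r'
  proof -
    have "cis t = cis \<theta>" using that polar_eqD(2) by blast
    then have "t = \<theta>" by (rule cis_eqD) (use assms that in \<open>auto simp: abs_less_iff\<close>)
    then show False using assms that by auto
  qed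
  then show ?thesis by (fastforce simp: sector_def)
qed

text \<open>\<open>E\<close> is the boundary arc that closes the two cuts; it degenerates to a point
  when the two limits agree, since the cuts then close up by themselves. Let \<open>j\<close> be the
  resulting Jordan curve. The image of each sector is connected and misses \<open>j\<close>, so once
  it meets the inside of \<open>j\<close> it lies there entirely, and its closure can reach the
  boundary curve only within \<open>E\<close>.\<close>

lemma radii_cut_alternative:
  fixes \<gamma> :: "real \<Rightarrow> complex"
  assumes f: "continuous_on (ball 0 1) f" "inj_on f (ball 0 1)" "bounded (f ` ball 0 1)"
    and \<gamma>: "simple_path \<gamma>" "pathfinish \<gamma> = pathstart \<gamma>" "frontier (f ` ball 0 1) = path_image \<gamma>"
    and \<theta>: "\<theta>1 < \<theta>2" "\<theta>2 < \<theta>1 + 2 * pi"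
    and w: "radial_limit f \<theta>1 w1" "radial_limit f \<theta>2 w2" "w1 \<in> path_image \<gamma>" "w2 \<in> path_image \<gamma>"
    and E: "E \<subseteq> path_image \<gamma>"
      "w1 = w2 \<and> E = {w1} \<or> (\<exists>c. arc c \<and> pathstart c = w1 \<and> pathfinish c = w2 \<and> E = path_image c)"
  shows "closure (f ` sector \<theta>1 \<theta>2) \<inter> path_image \<gamma> \<subseteq> E \<or>
    closure (f ` sector \<theta>2 (\<theta>1 + 2 * pi)) \<inter> path_image \<gamma> \<subseteq> E"
proof -
  let ?D = "ball 0 1 :: complex set" and ?C = "path_image \<gamma>"
  define R where "R = f ` ((\<lambda>r. of_real r * cis \<theta>1) ` {0..<1} \<union> (\<lambda>r. of_real r * cis \<theta>2) ` {0..<1})"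
  have op: "open (f ` ?D)" using invariance_of_domain[OF f(1) open_ball f(2)] .
  have \<Omega>: "f ` ?D = inside ?C"
    using op f \<gamma> by (intro Jordan_domain_eq_inside connected_continuous_image) auto
  note J\<gamma> = Jordan_inside_outside[OF \<gamma>(1,2)]
  have disj: "f ` ?D \<inter> ?C = {}" unfolding \<Omega> by (rule inside_no_overlap)
  then have w_notin: "w1 \<notin> f ` ?D" "w2 \<notin> f ` ?D" using w by auto
  let ?c1 = "radial_cut f \<theta>1 w1" and ?c2 = "radial_cut f \<theta>2 w2"
  have arcs: "arc ?c1" "arc ?c2" using f w w_notin by (auto intro: arc_radial_cut)
  have R_sub: "R \<subseteq> f ` ?D" by (auto simp: R_def norm_mult)
  then have RC: "R \<inter> ?C = {}" using disj by (metis Int_mono order_refl subset_empty)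
  have meet: "path_image ?c1 \<inter> path_image ?c2 \<subseteq> {f 0} \<union> ({w1} \<inter> {w2})"
    using radial_cuts_meet[OF f(2) w_notin \<theta>] .
  have image: "path_image ?c1 \<union> path_image ?c2 = R \<union> {w1, w2}"
    by (auto simp: R_def path_image_radial_cut image_Un)
  obtain j where j: "simple_path j" "pathfinish j = pathstart j" "path_image j = R \<union> E"
  proof (cases "w1 = w2 \<and> E = {w1}")
    case True
    have "simple_path (reversepath ?c1 +++ ?c2)"
      using arcs meet True by (intro simple_path_join_loop) (auto simp: arc_reversepath)
    moreover have "path_image (reversepath ?c1 +++ ?c2) = R \<union> E"
      using image True by (simp add: path_image_join)
    ultimately show ?thesis using that True by simp
  next
    case False
    with E obtain c where c: "arc c" "pathstart c = w1" "pathfinish c = w2" "E = path_image c" by blast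
    then have "w1 \<noteq> w2" using arc_distinct_ends[of c] by auto
    have a: "arc (reversepath ?c1 +++ ?c2)"
      using arcs meet \<open>w1 \<noteq> w2\<close> by (intro arc_join) (auto simp: arc_reversepath)
    have im: "path_image (reversepath ?c1 +++ ?c2) = R \<union> {w1, w2}"
      using image by (simp add: path_image_join)
    have "R \<inter> E = {}" using RC E(1) by blast
    then have "path_image (reversepath ?c1 +++ ?c2) \<inter> path_image (reversepath c) \<subseteq> {w1, w2}"
      unfolding im using c by auto
    then have "simple_path ((reversepath ?c1 +++ ?c2) +++ reversepath c)"
      using a c by (intro simple_path_join_loop) (auto simp: arc_reversepath)
    moreover have "path_image ((reversepath ?c1 +++ ?c2) +++ reversepath c) = R \<union> E"
      using im c pathstart_in_path_image[of c] pathfinish_in_path_image[of c]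
      by (subst path_image_join) auto
    ultimately show ?thesis using that c by simp
  qed
  let ?J = "path_image j"
  note Jj = Jordan_inside_outside[OF j(1,2)]
  have io: "inside ?C \<inter> outside ?C = {}" "inside ?C \<union> outside ?C = - ?C"
    and out: "frontier (outside ?C) = ?C" "connected (outside ?C)" "\<not> bounded (outside ?C)"
    using J\<gamma> by simp_all
  have jin: "inside ?J \<noteq> {}" "frontier (inside ?J) = ?J"
    using Jj by simp_all
  have dR: "R \<inter> outside ?C = {}" using R_sub io(1) unfolding \<Omega> by (metis Int_mono order_refl subset_empty)
  let ?U = "outside ?C \<union> (?C - E)"
  have "connected ?U"
  proof (rule connected_intermediate_closure[of "outside ?C"])
    have "?C \<subseteq> closure (outside ?C)" using out(1) by (metis closure_Un_frontier sup_ge2)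
    then show "?U \<subseteq> closure (outside ?C)" using closure_subset by blast
  qed (use out in auto)
  moreover have "\<not> bounded ?U" using out(3) bounded_subset by blast
  moreover have UJ: "?U \<inter> ?J = {}"
    unfolding j(3) using dR RC E(1) outside_no_overlap[of ?C] by blast
  ultimately have "inside ?J \<subseteq> - ?J - ?U"
    by (intro inside_subset) auto
  also have "\<dots> \<subseteq> inside ?C - R"
    unfolding j(3) using io(2) E(1) by blast
  finally have in_sub: "inside ?J \<subseteq> f ` ?D - R" unfolding \<Omega> .
  let ?S = "f ` sector \<theta>1 \<theta>2" and ?S' = "f ` sector \<theta>2 (\<theta>1 + 2 * pi)"
  have cover: "f ` ?D \<subseteq> ?S \<union> ?S' \<union> R"
    using disc_cut_by_radii[OF \<theta>] unfolding R_def by blast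
  have sub: "f ` X \<subseteq> inside ?J \<Longrightarrow> closure (f ` X) \<inter> ?C \<subseteq> E" for X
  proof -
    assume "f ` X \<subseteq> inside ?J"
    then have "closure (f ` X) \<subseteq> inside ?J \<union> ?J"
      using closure_mono[of "f ` X" "inside ?J"] jin(2) unfolding closure_Un_frontier by simp
    then show "closure (f ` X) \<inter> ?C \<subseteq> E"
      using in_sub disj RC unfolding j(3) \<Omega> by blast
  qed
  have whole: "f ` X \<subseteq> inside ?J" if "X \<subseteq> ?D" "connected X"
    "X \<inter> (\<lambda>r. of_real r * cis \<theta>1) ` {0..<1} = {}" "X \<inter> (\<lambda>r. of_real r * cis \<theta>2) ` {0..<1} = {}"
    "f ` X \<inter> inside ?J \<noteq> {}" for X
  proof -
    have "connected (f ` X)"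
      using that f(1) by (intro connected_continuous_image continuous_on_subset[OF f(1)])
    have "f ` X \<inter> ?J = {}"
    proof -
      have "(\<lambda>r. of_real r * cis \<theta>1) ` {0..<1} \<union> (\<lambda>r. of_real r * cis \<theta>2) ` {0..<1} \<subseteq> ?D"
        by (auto simp: norm_mult)
      from inj_on_image_Int[OF f(2) \<open>X \<subseteq> ?D\<close> this]
      have "f ` X \<inter> R = f ` (X \<inter> ((\<lambda>r. of_real r * cis \<theta>1) ` {0..<1} \<union> (\<lambda>r. of_real r * cis \<theta>2) ` {0..<1}))"
        unfolding R_def by simp
      then have "f ` X \<inter> R = {}" using that by (simp add: Int_Un_distrib)
      moreover have "f ` X \<inter> E = {}" using image_mono[OF that(1), of f] disj E(1) unfolding \<Omega> by blast
      ultimately show ?thesis unfolding j(3) by blast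
    qed
    then have "f ` X - inside ?J = {}"
      using connected_Int_frontier[OF \<open>connected (f ` X)\<close> that(5)] jin(2) by auto
    then show ?thesis by blast
  qed
  \<comment> \<open>The inside of \<open>j\<close> is nonempty and covered by the images of the two
    sectors, so it meets at least one of them; nothing decides which.\<close>
  obtain y where "y \<in> inside ?J" using jin(1) by blast
  then have "y \<in> ?S \<union> ?S'" using in_sub cover by blast
  then show ?thesis
  proof
    assume "y \<in> ?S"
    then have "?S \<inter> inside ?J \<noteq> {}" using \<open>y \<in> inside ?J\<close> by blast
    moreover have "sector \<theta>1 \<theta>2 \<inter> (\<lambda>r. of_real r * cis \<theta>1) ` {0..<1} = {}"
      "sector \<theta>1 \<theta>2 \<inter> (\<lambda>r. of_real r * cis \<theta>2) ` {0..<1} = {}"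
      by (rule sector_Int_radius; use \<theta> in force)+
    ultimately show ?thesis
      by (intro disjI1 sub whole[OF sector_subset connected_sector])
  next
    assume "y \<in> ?S'"
    then have "?S' \<inter> inside ?J \<noteq> {}" using \<open>y \<in> inside ?J\<close> by blast
    moreover have "sector \<theta>2 (\<theta>1 + 2 * pi) \<inter> (\<lambda>r. of_real r * cis \<theta>1) ` {0..<1} = {}"
      "sector \<theta>2 (\<theta>1 + 2 * pi) \<inter> (\<lambda>r. of_real r * cis \<theta>2) ` {0..<1} = {}"
      by (rule sector_Int_radius; use \<theta> in force)+
    ultimately show ?thesis
      by (intro disjI2 sub whole[OF sector_subset connected_sector])
  qed
qed

text \<open>The point of this form is uniformity: \<open>\<delta>\<close> depends on
  \<open>\<epsilon>\<close> alone, neither on the two angles nor on \<open>p\<close>.\<close>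

lemma near_on_arc_alternative:
  fixes \<gamma> :: "real \<Rightarrow> complex"
  assumes f: "continuous_on (ball 0 1) f" "inj_on f (ball 0 1)" "bounded (f ` ball 0 1)"
    and \<gamma>: "simple_path \<gamma>" "pathfinish \<gamma> = pathstart \<gamma>" "frontier (f ` ball 0 1) = path_image \<gamma>"
    and "0 < \<epsilon>"
  obtains \<delta> where "0 < \<delta>"
    "\<And>\<theta>1 \<theta>2 w1 w2 p. \<theta>1 < \<theta>2 \<Longrightarrow> \<theta>2 < \<theta>1 + 2 * pi \<Longrightarrow> radial_limit f \<theta>1 w1 \<Longrightarrow> radial_limit f \<theta>2 w2 \<Longrightarrow>
       dist w1 p < \<delta> \<Longrightarrow> dist w2 p < \<delta> \<Longrightarrow> near_on_arc f \<theta>1 \<theta>2 p \<epsilon> \<or> near_on_arc f \<theta>2 (\<theta>1 + 2 * pi) p \<epsilon>"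
proof -
  let ?D = "ball 0 1 :: complex set" and ?C = "path_image \<gamma>"
  have "0 < \<epsilon> / 2" using \<open>0 < \<epsilon>\<close> by simp
  from small_arc_in_simple_closed_curve[OF \<gamma>(1,2) this] obtain \<delta> where \<delta>: "0 < \<delta>"
    "\<And>p q. p \<in> ?C \<Longrightarrow> q \<in> ?C \<Longrightarrow> p \<noteq> q \<Longrightarrow> dist p q < \<delta> \<Longrightarrow>
       \<exists>c :: real \<Rightarrow> complex. arc c \<and> pathstart c = p \<and> pathfinish c = q \<and> path_image c \<subseteq> ?C \<inter> ball p (\<epsilon> / 2)" by metis
  have in_C: "w \<in> ?C" if "radial_limit f \<theta> w" for \<theta> w
    unfolding \<gamma>(3)[symmetric]
  proof (rule cluster_point_in_frontier[OF f(1,2)])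
    let ?r = "\<lambda>n. 1 - 1 / real (Suc n)"
    have r: "?r \<longlonglongrightarrow> 1"
      by (rule LIMSEQ_one_minus_inverse_Suc)
    then have "filterlim ?r (at_left 1) sequentially"
      by (simp add: filterlim_at)
    then show "(\<lambda>n. f (of_real (?r n) * cis \<theta>)) \<longlonglongrightarrow> w"
      using that unfolding radial_limit_def by (rule filterlim_compose[rotated])
    have "norm (of_real (?r n) * cis \<theta>) = ?r n" for n
      unfolding norm_mult norm_of_real norm_cis by simp
    then show "(\<lambda>n. norm (of_real (?r n) * cis \<theta>)) \<longlonglongrightarrow> 1"
      using r by simp
    show "of_real (?r n) * cis \<theta> \<in> ?D" for n
      unfolding mem_ball dist_0_norm norm_mult norm_of_real norm_cis by simp
  qed
  show ?thesis
  proof (rule that)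
    \<comment> \<open>The bound \<open>\<delta> / 2\<close> brings the two limits within
      \<open>\<delta>\<close> of each other, so that a short boundary arc joins them;
      \<open>\<epsilon> / 2\<close> then moves this arc from the ball around \<open>w1\<close> into
      the ball of radius \<open>\<epsilon>\<close> around \<open>p\<close>.\<close>
    show "0 < min (\<delta> / 2) (\<epsilon> / 2)" using \<delta> \<open>0 < \<epsilon>\<close> by simp
    fix \<theta>1 \<theta>2 w1 w2 p
    assume *: "\<theta>1 < \<theta>2" "\<theta>2 < \<theta>1 + 2 * pi" "radial_limit f \<theta>1 w1" "radial_limit f \<theta>2 w2"
       "dist w1 p < min (\<delta> / 2) (\<epsilon> / 2)" "dist w2 p < min (\<delta> / 2) (\<epsilon> / 2)"
    then have wC: "w1 \<in> ?C" "w2 \<in> ?C" using in_C by auto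
    have "dist w1 w2 < \<delta>" using * dist_triangle2[of w1 w2 p] by simp
    obtain E where E: "E \<subseteq> ?C" "E \<subseteq> ball w1 (\<epsilon> / 2)"
      "w1 = w2 \<and> E = {w1} \<or> (\<exists>c. arc c \<and> pathstart c = w1 \<and> pathfinish c = w2 \<and> E = path_image c)"
    proof (cases "w1 = w2")
      case True
      then show ?thesis using that[of "{w1}"] wC \<open>0 < \<epsilon>\<close> by simp
    next
      case False
      then show ?thesis using \<delta>(2)[OF wC False \<open>dist w1 w2 < \<delta>\<close>] that by (metis le_inf_iff)
    qed
    have "E \<subseteq> ball p \<epsilon>"
    proof
      fix x assume "x \<in> E"
      then have "dist w1 x < \<epsilon> / 2" using E by auto
      then show "x \<in> ball p \<epsilon>" using * dist_triangle[of p x w1] by (simp add: dist_commute)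
    qed
    then show "near_on_arc f \<theta>1 \<theta>2 p \<epsilon> \<or> near_on_arc f \<theta>2 (\<theta>1 + 2 * pi) p \<epsilon>"
      using radii_cut_alternative[OF f \<gamma> *(1-4) wC E(1,3)] near_on_arcI[OF f]
      unfolding \<gamma>(3) by (meson order_trans)
  qed
qed

section \<open>Radial limits of bounded harmonic functions\<close>

text \<open>Integration by parts moves the derivative from the primitive of \<open>v\<close>, which
  is all that is controlled, to the kernel. As the kernel decreases, the estimate becomes an
  integral of \<open>- p' t * (\<epsilon> * t + \<eta>)\<close>, and a second integration by parts
  evaluates it. The constant \<open>\<eta>\<close> leaves room for an error that does not vanish at
  \<open>t = 0\<close>.\<close>

lemma norm_integral_kernel_le:
  fixes v :: "real \<Rightarrow> complex" and p p' :: "real \<Rightarrow> real"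
  assumes "0 \<le> d" and v: "continuous_on {0..d} v"
    and p: "\<And>t. t \<in> {0..d} \<Longrightarrow> (p has_real_derivative p' t) (at t within {0..d})" "continuous_on {0..d} p'"
      "\<And>t. t \<in> {0..d} \<Longrightarrow> p' t \<le> 0" "0 \<le> p d"
    and V: "\<And>t. t \<in> {0..d} \<Longrightarrow> cmod (integral {0..t} v) \<le> \<epsilon> * t + \<eta>"
  shows "cmod (integral {0..d} (\<lambda>t. p t *\<^sub>R v t)) \<le> p 0 * \<eta> + \<epsilon> * integral {0..d} p"
proof -
  define V where "V t = integral {0..t} v" for t
  have cp: "continuous_on {0..d} p"
    using p(1) by (meson DERIV_continuous_on)
  have V': "(V has_vector_derivative v t) (at t within {0..d})" if "t \<in> {0..d}" for t
    unfolding V_def using v that by (rule integral_has_vector_derivative)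
  then have cV: "continuous_on {0..d} V"
    by (meson continuous_on_vector_derivative)
  have "((\<lambda>t. p t *\<^sub>R v t + p' t *\<^sub>R V t) has_integral p d *\<^sub>R V d - p 0 *\<^sub>R V 0) {0..d}"
    using \<open>0 \<le> d\<close> by (intro fundamental_theorem_of_calculus has_vector_derivative_scaleR p(1) V')
  then have 1: "integral {0..d} (\<lambda>t. p t *\<^sub>R v t + p' t *\<^sub>R V t) = p d *\<^sub>R V d"
    by (simp add: V_def integral_unique)
  have "integral {0..d} (\<lambda>t. p t *\<^sub>R v t + p' t *\<^sub>R V t) =
      integral {0..d} (\<lambda>t. p t *\<^sub>R v t) + integral {0..d} (\<lambda>t. p' t *\<^sub>R V t)"
    by (intro Henstock_Kurzweil_Integration.integral_add integrable_continuous_real continuous_intros cp v p(2) cV)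
  then have 2: "integral {0..d} (\<lambda>t. p t *\<^sub>R v t) = p d *\<^sub>R V d - integral {0..d} (\<lambda>t. p' t *\<^sub>R V t)"
    using 1 by simp
  have 3: "cmod (integral {0..d} (\<lambda>t. p' t *\<^sub>R V t)) \<le> integral {0..d} (\<lambda>t. - p' t * (\<epsilon> * t + \<eta>))"
  proof (rule integral_norm_bound_integral)
    show "cmod (p' t *\<^sub>R V t) \<le> - p' t * (\<epsilon> * t + \<eta>)" if "t \<in> {0..d}" for t
      using p(3)[OF that] V[OF that] by (auto simp: V_def abs_of_nonpos intro: mult_left_mono_neg)
  qed (intro integrable_continuous_real continuous_intros p(2) cV)+
  \<comment> \<open>The same integration by parts for the majorant; its boundary term at
    \<open>d\<close> cancels the bound for \<open>p d *\<^sub>R V d\<close>.\<close>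
  have "((\<lambda>t. p t * (\<epsilon> * 1) + p' t * (\<epsilon> * t + \<eta>)) has_integral p d * (\<epsilon> * d + \<eta>) - p 0 * (\<epsilon> * 0 + \<eta>)) {0..d}"
  proof (rule fundamental_theorem_of_calculus[OF \<open>0 \<le> d\<close>])
    fix t assume "t \<in> {0..d}"
    then have "((\<lambda>t. p t * (\<epsilon> * t + \<eta>)) has_real_derivative p t * (\<epsilon> * 1) + p' t * (\<epsilon> * t + \<eta>)) (at t within {0..d})"
      by (auto intro!: derivative_eq_intros p(1))
    then show "((\<lambda>t. p t * (\<epsilon> * t + \<eta>)) has_vector_derivative p t * (\<epsilon> * 1) + p' t * (\<epsilon> * t + \<eta>)) (at t within {0..d})"
      by (simp add: has_real_derivative_iff_has_vector_derivative)
  qed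
  then have "integral {0..d} (\<lambda>t. p t * \<epsilon> + p' t * (\<epsilon> * t + \<eta>)) = p d * (\<epsilon> * d + \<eta>) - p 0 * \<eta>"
    by (simp add: integral_unique)
  moreover have "integral {0..d} (\<lambda>t. p t * \<epsilon> + p' t * (\<epsilon> * t + \<eta>)) =
     integral {0..d} p * \<epsilon> + integral {0..d} (\<lambda>t. p' t * (\<epsilon> * t + \<eta>))"
    by (subst Henstock_Kurzweil_Integration.integral_add)
      (auto intro!: integrable_continuous_real continuous_intros cp p(2))
  moreover have "integral {0..d} (\<lambda>t. - p' t * (\<epsilon> * t + \<eta>)) = - integral {0..d} (\<lambda>t. p' t * (\<epsilon> * t + \<eta>))"
    by (simp only: mult_minus_left integral_neg)
  ultimately have 4: "integral {0..d} (\<lambda>t. - p' t * (\<epsilon> * t + \<eta>)) = p 0 * \<eta> + \<epsilon> * integral {0..d} p - p d * (\<epsilon> * d + \<eta>)"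
    by (simp only: mult.commute[of \<epsilon> "integral {0..d} p"])
  have "cmod (p d *\<^sub>R V d) \<le> p d * (\<epsilon> * d + \<eta>)"
    using V[of d] p(4) \<open>0 \<le> d\<close> by (auto simp: V_def intro: mult_left_mono)
  then show ?thesis
    unfolding 2 using 3 4 norm_triangle_ineq4[of "p d *\<^sub>R V d" "integral {0..d} (\<lambda>t. p' t *\<^sub>R V t)"] by linarith
qed

section \<open>The Poisson kernel as an approximate identity\<close>

lemma poisson_denominator_pos:
  fixes \<rho> t :: real
  assumes "0 \<le> \<rho>" "\<rho> < 1"
  shows "0 < 1 - 2 * \<rho> * cos t + \<rho>\<^sup>2"
proof -
  have "\<rho> * cos t \<le> \<rho> * 1" using assms mult_left_mono[of "cos t" 1 \<rho>] by simp
  moreover have "0 < (1 - \<rho>)\<^sup>2" using assms by simp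
  ultimately show ?thesis by (simp add: power2_eq_square algebra_simps)
qed

lemma poisson_nonneg: "0 \<le> \<rho> \<Longrightarrow> \<rho> < 1 \<Longrightarrow> 0 \<le> poisson \<rho> t"
  unfolding poisson_def using poisson_denominator_pos[of \<rho> t]
  by (intro divide_nonneg_nonneg) (auto simp: power_le_one)

lemma continuous_on_poisson:
  assumes "0 \<le> \<rho>" "\<rho> < 1"
  shows "continuous_on A (poisson \<rho>)"
proof -
  have "1 - 2 * \<rho> * cos t + \<rho>\<^sup>2 \<noteq> 0" for t using poisson_denominator_pos[OF assms, of t] by simp
  then show ?thesis unfolding poisson_def[abs_def] by (intro continuous_intros) auto
qed

lemma poisson_decreasing:
  assumes "0 \<le> \<rho>" "\<rho> < 1" "0 \<le> s" "s \<le> t" "t \<le> pi"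
  shows "poisson \<rho> t \<le> poisson \<rho> s"
proof -
  have "\<rho> * cos t \<le> \<rho> * cos s" using assms by (intro mult_left_mono cos_monotone_0_pi_le) auto
  then show ?thesis
    unfolding poisson_def using poisson_denominator_pos[OF assms(1,2)] assms(1,2)
    by (intro divide_left_mono) (auto simp: power_le_one)
qed

lemma integral_poisson:
  assumes "0 \<le> \<rho>" "\<rho> < 1"
  shows "(poisson \<rho> has_integral 2 * pi) {-pi..pi}"
proof -
  have "((\<lambda>t. of_real (poisson \<rho> t) * 1) has_integral (of_real (2 * pi) * (1::complex))) {-pi..pi}"
    using poisson_holomorphic[of "\<lambda>_. 1" 2 \<rho>] assms by simp
  from has_integral_Re[OF this] show ?thesis by simp
qed

lemma poisson_tendsto_0:
  assumes "0 < d" "d \<le> pi"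
  shows "((\<lambda>\<rho>. poisson \<rho> d) \<longlongrightarrow> 0) (at_left 1)"
proof -
  have "cos d < cos 0" using assms by (intro cos_monotone_0_pi) auto
  then have "1 - 2 * 1 * cos d + 1\<^sup>2 \<noteq> 0" by simp
  then have "((\<lambda>\<rho>. poisson \<rho> d) \<longlongrightarrow> (1 - 1\<^sup>2) / (1 - 2 * 1 * cos d + 1\<^sup>2)) (at_left 1)"
    unfolding poisson_def by (intro tendsto_intros)
  then show ?thesis by simp
qed

lemma integral_fold_symmetric:
  fixes q :: "real \<Rightarrow> complex"
  assumes "continuous_on {-a..a} q" "0 \<le> a"
  shows "integral {-a..a} q = integral {0..a} (\<lambda>t. q t + q (- t))"
proof -
  have "integral {-a..0} q + integral {0..a} q = integral {-a..a} q"
    using assms by (intro Henstock_Kurzweil_Integration.integral_combine integrable_continuous_real) auto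
  moreover have "integral {-a..0} q = integral {0..a} (\<lambda>t. q (- t))"
    using Henstock_Kurzweil_Integration.integral_reflect_real[of a 0 "\<lambda>t. q (- t)"] by simp
  moreover have "integral {0..a} (\<lambda>t. q t + q (- t)) = integral {0..a} q + integral {0..a} (\<lambda>t. q (- t))"
    using assms by (intro Henstock_Kurzweil_Integration.integral_add integrable_continuous_real
        continuous_on_compose2[OF assms(1)] continuous_intros continuous_on_subset[OF assms(1)]) auto
  ultimately show ?thesis by (simp add: add.commute)
qed

text \<open>Fatou's theorem at a point: for radial limits it is enough that the one-sided averages
  of \<open>u\<close> at \<open>\<theta>\<close> tend to \<open>L\<close>, because the Poisson
  kernel is even and decreasing in the distance from its peak. Since \<open>F\<close> has no
  boundary values yet, the Poisson formula is used on the circles of radius \<open>r n\<close>,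
  where the primitive of \<open>F\<close> is close to that of \<open>u\<close>.\<close>

lemma radial_limit_of_derivative:
  fixes h g :: "complex \<Rightarrow> complex" and u :: "real \<Rightarrow> complex"
  defines "F \<equiv> \<lambda>z. h z + cnj (g z)"
  assumes hol: "h holomorphic_on ball 0 1" "g holomorphic_on ball 0 1"
    and bound: "\<And>z. z \<in> ball 0 1 \<Longrightarrow> cmod (F z) \<le> M"
    and r: "\<And>n :: nat. 0 \<le> r n" "\<And>n. r n < 1" "r \<longlonglongrightarrow> 1"
    and u: "u integrable_on {-pi..pi}"
      "(\<lambda>n. integral {-pi..pi} (\<lambda>t. cmod (F (of_real (r n) * cis t) - u t))) \<longlonglongrightarrow> 0"
      "\<And>n. (\<lambda>t. cmod (F (of_real (r n) * cis t) - u t)) integrable_on {-pi..pi}"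
    and \<theta>: "- pi < \<theta>" "\<theta> < pi"
    and right: "\<And>e. 0 < e \<Longrightarrow> \<exists>d>0. \<forall>t. 0 < t \<and> t < d \<longrightarrow> cmod (integral {\<theta>..\<theta> + t} u - t *\<^sub>R L) \<le> e * t"
    and left: "\<And>e. 0 < e \<Longrightarrow> \<exists>d>0. \<forall>t. 0 < t \<and> t < d \<longrightarrow> cmod (integral {\<theta> - t..\<theta>} u - t *\<^sub>R L) \<le> e * t"
  shows "radial_limit F \<theta> L"
  unfolding radial_limit_def
proof (rule tendstoI)
  fix e :: real assume "0 < e"
  \<comment> \<open>The two sides contribute \<open>2 * \<epsilon>\<close>, and the kernel has mass
    \<open>2 * pi\<close>; with \<open>e / 4\<close> this is half of the admissible
    \<open>2 * pi * e\<close>.\<close>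
  define \<epsilon> where "\<epsilon> = e / 4"
  have "0 < \<epsilon>" using \<open>0 < e\<close> by (simp add: \<epsilon>_def)
  obtain d1 where d1: "0 < d1" "\<And>t. 0 < t \<Longrightarrow> t < d1 \<Longrightarrow> cmod (integral {\<theta>..\<theta> + t} u - t *\<^sub>R L) \<le> \<epsilon> * t"
    using right[OF \<open>0 < \<epsilon>\<close>] by blast
  obtain d2 where d2: "0 < d2" "\<And>t. 0 < t \<Longrightarrow> t < d2 \<Longrightarrow> cmod (integral {\<theta> - t..\<theta>} u - t *\<^sub>R L) \<le> \<epsilon> * t"
    using left[OF \<open>0 < \<epsilon>\<close>] by blast
  obtain d where d: "0 < d" "d < d1" "d < d2" "d < pi - \<theta>" "d < pi + \<theta>"
    using dense[of 0 "min (min d1 d2) (min (pi - \<theta>) (pi + \<theta>))"] d1 d2 \<theta> by auto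
  have d_pi: "d \<le> pi" using d by linarith
  have contF: "continuous_on (ball 0 1) F"
    unfolding F_def using hol[THEN holomorphic_on_imp_continuous_on] by (intro continuous_intros)
  define U where "U n t = F (of_real (r n) * cis t)" for n t
  have contU: "continuous_on A (U n)" for n A
    unfolding U_def by (rule continuous_on_compose2[OF contF]) (use r in \<open>auto intro!: continuous_intros simp: norm_mult\<close>)
  have U_bound: "cmod (U n t) \<le> M" for n t
    unfolding U_def using r(1,2)[of n] by (intro bound) (simp add: norm_mult)
  define \<eta> where "\<eta> n = integral {-pi..pi} (\<lambda>t. cmod (U n t - u t))" for n
  have \<eta>_lim: "\<eta> \<longlonglongrightarrow> 0" using u(2) by (simp add: \<eta>_def[abs_def] U_def)
  have U_int: "(\<lambda>t. cmod (U n t - u t)) integrable_on {-pi..pi}" for n using u(3) by (simp add: U_def)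
  have sub: "cmod (integral {a..b} (U n) - integral {a..b} u) \<le> \<eta> n" if "-pi \<le> a" "b \<le> pi" for a b n
  proof -
    have ss: "{a..b} \<subseteq> {-pi..pi}" using that by auto
    have i: "u integrable_on {a..b}" "(\<lambda>t. cmod (U n t - u t)) integrable_on {a..b}"
      using integrable_on_subinterval[OF u(1) ss] integrable_on_subinterval[OF U_int ss] by auto
    have "integral {a..b} (U n) - integral {a..b} u = integral {a..b} (\<lambda>t. U n t - u t)"
      by (rule Henstock_Kurzweil_Integration.integral_diff[OF integrable_continuous_real[OF contU] i(1), symmetric])
    also have "cmod \<dots> \<le> integral {a..b} (\<lambda>t. cmod (U n t - u t))"
      by (rule integral_norm_bound_integral[OF integrable_diff[OF integrable_continuous_real[OF contU] i(1)] i(2)]) simp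
    also have "\<dots> \<le> \<eta> n" unfolding \<eta>_def
      by (rule integral_subset_le[OF ss i(2) U_int]) auto
    finally show ?thesis .
  qed
  \<comment> \<open>An even kernel sees only the sum over the points \<open>\<theta> + t\<close> and
    \<open>\<theta> - t\<close>, so the integral folds onto \<open>{0..pi}\<close>, where the kernel
    decreases.\<close>
  define v where "v n t = (U n (\<theta> + t) - L) + (U n (\<theta> - t) - L)" for n t
  have contUv: "continuous_on A (\<lambda>t. U n (\<theta> + t))" "continuous_on A (\<lambda>t. U n (\<theta> - t))" for n A
    using continuous_on_compose2[OF contU[of UNIV n], of A "\<lambda>t. \<theta> + t"]
      continuous_on_compose2[OF contU[of UNIV n], of A "\<lambda>t. \<theta> - t"]
    by (simp_all add: continuous_intros)
  have contv: "continuous_on A (v n)" for n A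
    unfolding v_def by (intro continuous_intros contUv)
  \<comment> \<open>On each side, replacing the circle of radius \<open>r n\<close> by the limit
    function costs at most the mean distance \<open>\<eta> n\<close>, whatever the length
    \<open>t\<close>.\<close>
  have V: "cmod (integral {0..t} (v n)) \<le> (2 * \<epsilon>) * t + 2 * \<eta> n" if "t \<in> {0..d}" for n t
  proof (cases "t = 0")
    case True
    have "0 \<le> \<eta> n" unfolding \<eta>_def by (rule integral_nonneg[OF U_int]) auto
    then show ?thesis using True by simp
  next
    case False
    with that have t: "0 < t" "t < d1" "t < d2" using d by auto
    have 1: "integral {0..t} (\<lambda>s. U n (\<theta> + s)) = integral {\<theta>..\<theta> + t} (U n)"
      using integral_shift_real_ivl[where a = \<theta> and b = "\<theta> + t" and f = "U n" and c = \<theta>] by (simp add: add.commute)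
    have 2: "integral {0..t} (\<lambda>s. U n (\<theta> - s)) = integral {\<theta> - t..\<theta>} (U n)"
    proof -
      have "integral {0..t} (\<lambda>s. U n (\<theta> - s)) = integral {-t..0} (\<lambda>s. U n (\<theta> + s))"
        using Henstock_Kurzweil_Integration.integral_reflect_real[of 0 "-t" "\<lambda>s. U n (\<theta> + s)"] by simp
      also have "\<dots> = integral {\<theta> - t..\<theta>} (U n)"
        using integral_shift_real_ivl[where a = "\<theta> - t" and b = \<theta> and f = "U n" and c = \<theta>] by (simp add: add.commute)
      finally show ?thesis .
    qed
    have "v n = (\<lambda>s. (U n (\<theta> + s) + U n (\<theta> - s)) - 2 * L)" by (simp add: v_def fun_eq_iff)
    then have "integral {0..t} (v n) = integral {0..t} (\<lambda>s. U n (\<theta> + s) + U n (\<theta> - s)) - integral {0..t} (\<lambda>s. 2 * L)"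
      using Henstock_Kurzweil_Integration.integral_diff[of "\<lambda>s. U n (\<theta> + s) + U n (\<theta> - s)" "{0..t}" "\<lambda>s. 2 * L"]
      by (simp add: integrable_continuous_real continuous_intros contUv)
    also have "\<dots> = integral {\<theta>..\<theta> + t} (U n) + integral {\<theta> - t..\<theta>} (U n) - t *\<^sub>R (2 * L)"
      using t unfolding 1[symmetric] 2[symmetric]
      by (subst Henstock_Kurzweil_Integration.integral_add) (auto intro!: integrable_continuous_real contUv)
    finally have eq: "integral {0..t} (v n) = (integral {\<theta>..\<theta> + t} (U n) - integral {\<theta>..\<theta> + t} u) +
        (integral {\<theta> - t..\<theta>} (U n) - integral {\<theta> - t..\<theta>} u) +
        (integral {\<theta>..\<theta> + t} u - t *\<^sub>R L) + (integral {\<theta> - t..\<theta>} u - t *\<^sub>R L)"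
      by (simp add: algebra_simps scaleR_2[symmetric])
    have "cmod (integral {0..t} (v n)) \<le> \<eta> n + \<eta> n + \<epsilon> * t + \<epsilon> * t"
      unfolding eq using that d t
      by (intro norm_triangle_le add_mono sub d1(2) d2(2)) auto
    then show ?thesis by simp
  qed
  define B where "B = 2 * M + 2 * cmod L"
  have v_bound: "cmod (v n t) \<le> B" for n t
    unfolding v_def B_def using U_bound[of n "\<theta> + t"] U_bound[of n "\<theta> - t"]
      norm_triangle_ineq[of "U n (\<theta> + t) - L" "U n (\<theta> - t) - L"]
      norm_triangle_ineq4[of "U n (\<theta> + t)" L] norm_triangle_ineq4[of "U n (\<theta> - t)" L] by linarith
  have main: "2 * pi * cmod (F (of_real \<rho> * cis \<theta>) - L) \<le> 2 * \<epsilon> * (2 * pi) + pi * (poisson \<rho> d * B)"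
    if \<rho>: "0 \<le> \<rho>" "\<rho> < 1" for \<rho>
  proof -
    note cP = continuous_on_poisson[OF \<rho>]
    have "2 * pi * cmod (F (of_real (r n) * cis \<theta> * of_real \<rho>) - L) \<le> poisson \<rho> 0 * (2 * \<eta> n) + 2 * \<epsilon> * (2 * pi) + pi * (poisson \<rho> d * B)" for n
    proof -
      have "norm (of_real (r n) * cis \<theta>) < 1" using r(1,2)[of n] by (simp add: norm_mult)
      from holomorphic_on_scaled_disc2[OF hol this] obtain s where s: "1 < s"
        "(\<lambda>w. h (of_real (r n) * cis \<theta> * w)) holomorphic_on ball 0 s" "(\<lambda>w. g (of_real (r n) * cis \<theta> * w)) holomorphic_on ball 0 s"
        by blast
      have eqU: "F (of_real (r n) * cis \<theta> * cis t) = U n (\<theta> + t)" for t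
        by (simp add: U_def mult.assoc cis_mult)
      from poisson_harmonic[OF s(2,3,1) \<rho>]
      have "((\<lambda>t. of_real (poisson \<rho> t) * U n (\<theta> + t)) has_integral 2 * pi * F (of_real (r n) * cis \<theta> * of_real \<rho>)) {-pi..pi}"
        unfolding eqU[symmetric] F_def .
      moreover have "((\<lambda>t. of_real (poisson \<rho> t) * L) has_integral (of_real (2 * pi) * L)) {-pi..pi}"
        using integral_poisson[OF \<rho>] by (intro has_integral_mult_left has_integral_of_real)
      ultimately have "((\<lambda>t. of_real (poisson \<rho> t) * U n (\<theta> + t) - of_real (poisson \<rho> t) * L)
         has_integral 2 * pi * F (of_real (r n) * cis \<theta> * of_real \<rho>) - of_real (2 * pi) * L) {-pi..pi}"
        by (rule has_integral_diff)
      then have "integral {-pi..pi} (\<lambda>t. poisson \<rho> t *\<^sub>R (U n (\<theta> + t) - L)) = of_real (2 * pi) * (F (of_real (r n) * cis \<theta> * of_real \<rho>) - L)"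
        by (intro integral_unique) (simp add: scaleR_conv_of_real algebra_simps)
      moreover have "integral {-pi..pi} (\<lambda>t. poisson \<rho> t *\<^sub>R (U n (\<theta> + t) - L)) = integral {0..pi} (\<lambda>t. poisson \<rho> t *\<^sub>R v n t)"
      proof -
        have "continuous_on {-pi..pi} (\<lambda>t. poisson \<rho> t *\<^sub>R (U n (\<theta> + t) - L))"
          by (intro continuous_intros cP contUv)
        note fold = integral_fold_symmetric[OF this pi_ge_zero]
        have "poisson \<rho> (- t) = poisson \<rho> t" for t by (simp add: poisson_def)
        then show ?thesis
          unfolding fold by (simp only: v_def scaleR_add_right add_uminus_conv_diff)
      qed
      moreover have "integral {0..pi} (\<lambda>t. poisson \<rho> t *\<^sub>R v n t) =
         integral {0..d} (\<lambda>t. poisson \<rho> t *\<^sub>R v n t) + integral {d..pi} (\<lambda>t. poisson \<rho> t *\<^sub>R v n t)"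
        using d d_pi by (intro Henstock_Kurzweil_Integration.integral_combine[symmetric] integrable_continuous_real continuous_intros cP contv) auto
      ultimately have eq: "of_real (2 * pi) * (F (of_real (r n) * cis \<theta> * of_real \<rho>) - L) =
         integral {0..d} (\<lambda>t. poisson \<rho> t *\<^sub>R v n t) + integral {d..pi} (\<lambda>t. poisson \<rho> t *\<^sub>R v n t)" by simp
      have n0: "1 - 2 * \<rho> * cos t + \<rho>\<^sup>2 \<noteq> 0" for t using poisson_denominator_pos[OF \<rho>, of t] by simp
      define p' where "p' t = - ((1 - \<rho>\<^sup>2) * (2 * \<rho> * sin t)) / (1 - 2 * \<rho> * cos t + \<rho>\<^sup>2)\<^sup>2" for t
      have "cmod (integral {0..d} (\<lambda>t. poisson \<rho> t *\<^sub>R v n t)) \<le> poisson \<rho> 0 * (2 * \<eta> n) + (2 * \<epsilon>) * integral {0..d} (poisson \<rho>)"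
      proof (rule norm_integral_kernel_le[of _ _ _ p'])
        show "(poisson \<rho> has_real_derivative p' t) (at t within {0..d})" for t
          unfolding poisson_def[abs_def] p'_def
          by (rule derivative_eq_intros refl n0 | simp add: n0 power2_eq_square)+
        show "continuous_on {0..d} p'" unfolding p'_def by (intro continuous_intros) (simp add: n0)
        show "p' t \<le> 0" if "t \<in> {0..d}" for t
        proof -
          have "0 \<le> sin t" using that d_pi by (intro sin_ge_zero) auto
          moreover have "0 \<le> 1 - \<rho>\<^sup>2" using \<rho> by (simp add: power_le_one)
          ultimately have "0 \<le> (1 - \<rho>\<^sup>2) * (2 * \<rho> * sin t)" using \<rho> by (intro mult_nonneg_nonneg) auto
          then show ?thesis by (simp add: p'_def divide_nonpos_nonneg)
        qed
      qed (use d contv poisson_nonneg[OF \<rho>] V in auto)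
      also have "integral {0..d} (poisson \<rho>) \<le> integral {-pi..pi} (poisson \<rho>)"
        using d d_pi poisson_nonneg[OF \<rho>] by (intro integral_subset_le integrable_continuous_real cP) auto
      also have "integral {-pi..pi} (poisson \<rho>) = 2 * pi" using integral_poisson[OF \<rho>] by (rule integral_unique)
      finally have 1: "cmod (integral {0..d} (\<lambda>t. poisson \<rho> t *\<^sub>R v n t)) \<le> poisson \<rho> 0 * (2 * \<eta> n) + 2 * \<epsilon> * (2 * pi)"
        using \<open>0 < \<epsilon>\<close> by simp
      have "cmod (integral {d..pi} (\<lambda>t. poisson \<rho> t *\<^sub>R v n t)) \<le> integral {d..pi} (\<lambda>t. poisson \<rho> d * B)"
      proof (rule integral_norm_bound_integral)
        show "cmod (poisson \<rho> t *\<^sub>R v n t) \<le> poisson \<rho> d * B" if "t \<in> {d..pi}" for t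
          using that d poisson_nonneg[OF \<rho>] v_bound poisson_decreasing[OF \<rho>, of d t]
          by (simp add: mult_mono)
      qed (intro integrable_continuous_real continuous_intros cP contv)+
      also have "\<dots> = (pi - d) * (poisson \<rho> d * B)" using d_pi by simp
      also have "\<dots> \<le> pi * (poisson \<rho> d * B)"
        using d order_trans[OF norm_ge_zero v_bound] poisson_nonneg[OF \<rho>] by (intro mult_right_mono mult_nonneg_nonneg) auto
      finally have 2: "cmod (integral {d..pi} (\<lambda>t. poisson \<rho> t *\<^sub>R v n t)) \<le> pi * (poisson \<rho> d * B)" .
      have "2 * pi * cmod (F (of_real (r n) * cis \<theta> * of_real \<rho>) - L) = cmod (of_real (2 * pi) * (F (of_real (r n) * cis \<theta> * of_real \<rho>) - L))"
        by (simp only: norm_mult norm_of_real) simp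
      also have "\<dots> \<le> poisson \<rho> 0 * (2 * \<eta> n) + 2 * \<epsilon> * (2 * pi) + pi * (poisson \<rho> d * B)"
        unfolding eq using 1 2 by (intro norm_triangle_le) linarith
      finally show ?thesis .
    qed
    moreover have "(\<lambda>n. 2 * pi * cmod (F (of_real (r n) * cis \<theta> * of_real \<rho>) - L)) \<longlonglongrightarrow> 2 * pi * cmod (F (of_real \<rho> * cis \<theta>) - L)"
    proof -
      have "isCont F (of_real \<rho> * cis \<theta>)"
        using contF \<rho> by (auto simp: continuous_on_eq_continuous_at norm_mult)
      moreover have "(\<lambda>n. of_real (r n) * cis \<theta> * of_real \<rho>) \<longlonglongrightarrow> of_real 1 * cis \<theta> * of_real \<rho>"
        using r(3) by (intro tendsto_intros)
      ultimately have "(\<lambda>n. F (of_real (r n) * cis \<theta> * of_real \<rho>)) \<longlonglongrightarrow> F (of_real \<rho> * cis \<theta>)"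
        by (intro isCont_tendsto_compose[of _ F]) (simp_all add: mult.commute)
      then show ?thesis by (intro tendsto_intros)
    qed
    \<comment> \<open>The order of limits matters: \<open>poisson \<rho> 0\<close> is unbounded as
      \<open>\<rho>\<close> tends to 1, so \<open>n\<close> goes to infinity first, for fixed
      \<open>\<rho>\<close>.\<close>
    moreover have "(\<lambda>n. poisson \<rho> 0 * (2 * \<eta> n) + 2 * \<epsilon> * (2 * pi) + pi * (poisson \<rho> d * B)) \<longlonglongrightarrow>
       poisson \<rho> 0 * (2 * 0) + 2 * \<epsilon> * (2 * pi) + pi * (poisson \<rho> d * B)"
      using \<eta>_lim by (intro tendsto_intros)
    ultimately show ?thesis
      using LIMSEQ_le by (metis (no_types, lifting) add_0 mult_zero_right)
  qed
  have "((\<lambda>\<rho>. 2 * \<epsilon> * (2 * pi) + pi * (poisson \<rho> d * B)) \<longlongrightarrow> 2 * \<epsilon> * (2 * pi) + pi * (0 * B)) (at_left 1)"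
    using d d_pi by (intro tendsto_intros poisson_tendsto_0) auto
  moreover have "2 * \<epsilon> * (2 * pi) + pi * (0 * B) < 2 * pi * e" using \<open>0 < e\<close> by (simp add: \<epsilon>_def)
  ultimately have "\<forall>\<^sub>F \<rho> in at_left 1. 2 * \<epsilon> * (2 * pi) + pi * (poisson \<rho> d * B) < 2 * pi * e"
    by (rule order_tendstoD)
  moreover have "\<forall>\<^sub>F \<rho> in at_left 1. \<rho> \<in> {0<..<1::real}" by (rule eventually_at_left_real) simp
  ultimately show "\<forall>\<^sub>F \<rho> in at_left 1. dist (F (of_real \<rho> * cis \<theta>)) L < e"
  proof eventually_elim
    case (elim \<rho>)
    then have "0 \<le> \<rho>" "\<rho> < 1" by auto
    from le_less_trans[OF main[OF this] elim(1)]
    have "cmod (F (of_real \<rho> * cis \<theta>) - L) < e" by (subst (asm) mult_less_cancel_left_pos) auto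
    then show ?case by (simp add: dist_norm)
  qed
qed

text \<open>Lebesgue's differentiation theorem in one-sided form. The function is extended by 0 so
  that it is integrable over every interval, and \<open>d\<close> is kept below \<open>b - x\<close>
  so that the extension is never seen.\<close>

lemma indefinite_integral_right_derivative:
  fixes u :: "real \<Rightarrow> complex"
  assumes "u integrable_on {a..b}"
  obtains N where "negligible N"
    "\<And>x e. x \<notin> N \<Longrightarrow> a < x \<Longrightarrow> x < b \<Longrightarrow> 0 < e \<Longrightarrow>
      \<exists>d>0. \<forall>t. 0 < t \<and> t < d \<longrightarrow> cmod (integral {x..x + t} u - t *\<^sub>R u x) \<le> e * t"
proof -
  define U where "U x = (if x \<in> {a..b} then u x else 0)" for x
  have "(U has_integral integral {a..b} u) UNIV"
    unfolding U_def[abs_def] has_integral_restrict_UNIV using assms by (rule integrable_integral)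
  then have "U integrable_on cbox x y" for x y
    using integrable_on_subcbox[of U UNIV x y] by blast
  from integrable_ccontinuous_explicit[OF this] obtain N where N: "negligible N"
    "\<And>x e. x \<notin> N \<Longrightarrow> 0 < e \<Longrightarrow> \<exists>d>0. \<forall>h. 0 < h \<and> h < d \<longrightarrow>
        norm (integral (cbox x (x + h *\<^sub>R One)) U /\<^sub>R h ^ DIM(real) - U x) < e"
    by blast
  show ?thesis
  proof (rule that[OF N(1)])
    fix x e :: real assume x: "x \<notin> N" "a < x" "x < b" "0 < e"
    from N(2)[OF x(1,4)] obtain d where d: "0 < d" "\<And>h. 0 < h \<Longrightarrow> h < d \<Longrightarrow>
        norm (integral (cbox x (x + h *\<^sub>R One)) U /\<^sub>R h ^ DIM(real) - U x) < e" by blast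
    have "cmod (integral {x..x + t} u - t *\<^sub>R u x) \<le> e * t" if t: "0 < t" "t < min d (b - x)" for t
    proof -
      have eq: "integral {x..x + t} U = integral {x..x + t} u"
        using x t by (intro integral_cong) (auto simp: U_def)
      have "cmod (integral {x..x + t} u /\<^sub>R t - u x) < e"
        using d(2)[of t] t x unfolding eq[symmetric] by (simp add: U_def)
      moreover have "integral {x..x + t} u - t *\<^sub>R u x = t *\<^sub>R (integral {x..x + t} u /\<^sub>R t - u x)"
        using t by (simp add: scaleR_diff_right)
      then have "cmod (integral {x..x + t} u - t *\<^sub>R u x) = t * cmod (integral {x..x + t} u /\<^sub>R t - u x)"
        using t by simp
      ultimately show ?thesis using t by (simp add: mult.commute)
    qed
    then show "\<exists>d>0. \<forall>t. 0 < t \<and> t < d \<longrightarrow> cmod (integral {x..x + t} u - t *\<^sub>R u x) \<le> e * t"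
      using d(1) x by (intro exI[of _ "min d (b - x)"]) auto
  qed
qed

text \<open>Reflection exchanges left and right averages and maps null sets to null sets.\<close>

lemma indefinite_integral_left_derivative:
  fixes u :: "real \<Rightarrow> complex"
  assumes "u integrable_on {a..b}"
  obtains N where "negligible N"
    "\<And>x e. x \<notin> N \<Longrightarrow> a < x \<Longrightarrow> x < b \<Longrightarrow> 0 < e \<Longrightarrow>
      \<exists>d>0. \<forall>t. 0 < t \<and> t < d \<longrightarrow> cmod (integral {x - t..x} u - t *\<^sub>R u x) \<le> e * t"
proof -
  have "(\<lambda>x. u (- x)) integrable_on {-b..-a}"
    using assms by (simp add: Henstock_Kurzweil_Integration.integrable_reflect_real)
  from indefinite_integral_right_derivative[OF this] obtain N where N: "negligible N"
    "\<And>x e. x \<notin> N \<Longrightarrow> - b < x \<Longrightarrow> x < - a \<Longrightarrow> 0 < e \<Longrightarrow>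
      \<exists>d>0. \<forall>t. 0 < t \<and> t < d \<longrightarrow> cmod (integral {x..x + t} (\<lambda>x. u (- x)) - t *\<^sub>R u (- x)) \<le> e * t"
    by metis
  have "negligible (uminus ` N)"
    using N(1) by (intro negligible_differentiable_image_negligible) (auto intro!: derivative_intros)
  then show ?thesis
  proof (rule that)
    fix x e :: real assume x: "x \<notin> uminus ` N" "a < x" "x < b" "0 < e"
    then have "- x \<notin> N" by (metis image_eqI minus_minus)
    moreover have "integral {- x..- x + t} (\<lambda>x. u (- x)) = integral {x - t..x} u" for t
      using Henstock_Kurzweil_Integration.integral_reflect_real[where a = "x - t" and b = x and f = u] by simp
    ultimately show "\<exists>d>0. \<forall>t. 0 < t \<and> t < d \<longrightarrow> cmod (integral {x - t..x} u - t *\<^sub>R u x) \<le> e * t"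
      using N(2)[of "- x" e] x by simp
  qed
qed

lemma radial_limits_almost_everywhere:
  fixes h g :: "complex \<Rightarrow> complex"
  assumes hol: "h holomorphic_on ball 0 1" "g holomorphic_on ball 0 1"
    and bound: "\<And>z. z \<in> ball 0 1 \<Longrightarrow> cmod (h z + cnj (g z)) \<le> M"
  obtains N where "negligible N" "\<And>\<theta>. - pi < \<theta> \<Longrightarrow> \<theta> < pi \<Longrightarrow> \<theta> \<notin> N \<Longrightarrow> \<exists>L. radial_limit (\<lambda>z. h z + cnj (g z)) \<theta> L"
proof -
  obtain r u where r: "\<And>n :: nat. 0 \<le> r n" "\<And>n. r n < 1" "r \<longlonglongrightarrow> 1"
    and u: "u integrable_on {-pi..pi}" "\<And>t. t \<in> {-pi..pi} \<Longrightarrow> cmod (u t) \<le> M"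
    "(\<lambda>n. integral {-pi..pi} (\<lambda>t. cmod (h (of_real (r n) * cis t) + cnj (g (of_real (r n) * cis t)) - u t))) \<longlonglongrightarrow> 0"
    "\<And>n. (\<lambda>t. cmod (h (of_real (r n) * cis t) + cnj (g (of_real (r n) * cis t)) - u t)) integrable_on {-pi..pi}"
    by (rule harmonic_circle_limits[OF hol bound], assumption, rule that)
  obtain N1 where N1: "negligible N1"
    "\<And>x e. x \<notin> N1 \<Longrightarrow> -pi < x \<Longrightarrow> x < pi \<Longrightarrow> 0 < e \<Longrightarrow>
      \<exists>d>0. \<forall>t. 0 < t \<and> t < d \<longrightarrow> cmod (integral {x..x + t} u - t *\<^sub>R u x) \<le> e * t"
    by (rule indefinite_integral_right_derivative[OF u(1)]) (rule that)
  obtain N2 where N2: "negligible N2"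
    "\<And>x e. x \<notin> N2 \<Longrightarrow> -pi < x \<Longrightarrow> x < pi \<Longrightarrow> 0 < e \<Longrightarrow>
      \<exists>d>0. \<forall>t. 0 < t \<and> t < d \<longrightarrow> cmod (integral {x - t..x} u - t *\<^sub>R u x) \<le> e * t"
    by (rule indefinite_integral_left_derivative[OF u(1)]) (rule that)
  show ?thesis
  proof (rule that)
    show "negligible (N1 \<union> N2)" using N1(1) N2(1) by (rule negligible_Un)
    fix \<theta> assume \<theta>: "- pi < \<theta>" "\<theta> < pi" "\<theta> \<notin> N1 \<union> N2"
    then have "\<theta> \<notin> N1" "\<theta> \<notin> N2" by auto
    from radial_limit_of_derivative[OF hol bound r u(1,3,4) \<theta>(1,2) N1(2)[OF this(1) \<theta>(1,2)] N2(2)[OF this(2) \<theta>(1,2)]]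
    show "\<exists>L. radial_limit (\<lambda>z. h z + cnj (g z)) \<theta> L" by blast
  qed
qed

text \<open>A rotation brings the interval to start at angle 0; cutting it at \<open>pi\<close>
  keeps it within the range of the almost everywhere statement, and a nondegenerate interval is not
  a null set.\<close>

lemma radial_limits_dense:
  fixes h g :: "complex \<Rightarrow> complex"
  assumes hol: "h holomorphic_on ball 0 1" "g holomorphic_on ball 0 1"
    and bound: "\<And>z. z \<in> ball 0 1 \<Longrightarrow> cmod (h z + cnj (g z)) \<le> M"
    and "x < y"
  obtains \<theta> L where "x < \<theta>" "\<theta> < y" "radial_limit (\<lambda>z. h z + cnj (g z)) \<theta> L"
proof -
  have rot: "(\<lambda>w. k (cis x * w)) holomorphic_on ball 0 1" if "k holomorphic_on ball 0 1" for k
    by (intro holomorphic_on_compose_gen[OF _ that, unfolded o_def] holomorphic_intros) (auto simp: norm_mult)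
  have "cmod (h (cis x * z) + cnj (g (cis x * z))) \<le> M" if "z \<in> ball 0 1" for z
    using that by (intro bound) (simp add: norm_mult)
  then obtain N where N: "negligible N" "\<And>\<theta>. - pi < \<theta> \<Longrightarrow> \<theta> < pi \<Longrightarrow> \<theta> \<notin> N \<Longrightarrow>
      \<exists>L. radial_limit (\<lambda>z. h (cis x * z) + cnj (g (cis x * z))) \<theta> L"
    by (rule radial_limits_almost_everywhere[OF rot[OF hol(1)] rot[OF hol(2)]]) (assumption, rule that)
  have "\<not> negligible {0<..<min (y - x) pi}"
    using negligible_interval(2)[of 0 "min (y - x) pi"] \<open>x < y\<close> by (simp add: min_le_iff_disj not_le)
  then obtain \<theta> where \<theta>: "\<theta> \<in> {0<..<min (y - x) pi}" "\<theta> \<notin> N"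
    using N(1) negligible_subset by blast
  then obtain L where "radial_limit (\<lambda>z. h (cis x * z) + cnj (g (cis x * z))) \<theta> L"
    using N(2)[of \<theta>] by auto
  then have "radial_limit (\<lambda>z. h z + cnj (g z)) (x + \<theta>) L"
    by (simp add: radial_limit_def cis_mult[symmetric] mult_ac)
  then show ?thesis using that[of "x + \<theta>" L] \<theta> by auto
qed

section \<open>The boundary function of a homeomorphism onto a Jordan domain\<close>

lemma near_on_arc_mono: "near_on_arc f \<alpha> \<beta> p \<epsilon> \<Longrightarrow> \<epsilon> \<le> \<epsilon>' \<Longrightarrow> near_on_arc f \<alpha> \<beta> p \<epsilon>'"
  unfolding near_on_arc_def by (meson order_less_le_trans)

lemma near_on_arc_radial_limit:
  assumes "near_on_arc f \<alpha> \<beta> p \<epsilon>" "radial_limit f \<theta> w" "\<alpha> < \<theta>" "\<theta> < \<beta>"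
  shows "dist w p \<le> \<epsilon>"
proof -
  obtain \<rho> where \<rho>: "\<rho> < 1" "\<And>r. \<rho> < r \<Longrightarrow> r < 1 \<Longrightarrow> dist (f (of_real r * cis \<theta>)) p < \<epsilon>"
    using assms unfolding near_on_arc_def by blast
  have "((\<lambda>r. dist (f (of_real r * cis \<theta>)) p) \<longlongrightarrow> dist w p) (at_left 1)"
    using assms(2) unfolding radial_limit_def by (intro tendsto_intros)
  moreover have "\<forall>\<^sub>F r in at_left 1. dist (f (of_real r * cis \<theta>)) p \<le> \<epsilon>"
    using eventually_at_left_real[OF \<rho>(1)] by eventually_elim (use \<rho>(2) in \<open>auto intro: less_imp_le\<close>)
  ultimately show ?thesis by (rule tendsto_upperbound) simp
qed

text \<open>The omitted arcs \<open>[\<theta>1, \<theta>1']\<close> and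
  \<open>[\<theta>2, \<theta>2']\<close> are disjoint modulo \<open>2 * pi\<close>, so the two long
  arcs cover the circle and \<open>f\<close> would be within \<open>\<epsilon>\<close> of
  \<open>p\<close> near all of it. This is impossible when \<open>\<epsilon>\<close> is a third of
  the distance between two points of the boundary curve.\<close>

lemma not_near_on_whole_circle:
  fixes \<gamma> :: "real \<Rightarrow> complex"
  assumes f: "continuous_on (ball 0 1) f"
    and \<gamma>: "simple_path \<gamma>" "frontier (f ` ball 0 1) = path_image \<gamma>" and op: "open (f ` ball 0 1)"
  obtains \<epsilon> where "0 < \<epsilon>"
    "\<And>\<theta>1 \<theta>1' \<theta>2 \<theta>2' p. \<theta>1 < \<theta>1' \<Longrightarrow> \<theta>1' < \<theta>2 \<Longrightarrow> \<theta>2 < \<theta>2' \<Longrightarrow> \<theta>2' < \<theta>1 + 2 * pi \<Longrightarrow>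
       near_on_arc f \<theta>1' (\<theta>1 + 2 * pi) p \<epsilon> \<Longrightarrow> near_on_arc f \<theta>2' (\<theta>2 + 2 * pi) p \<epsilon> \<Longrightarrow> False"
proof -
  have inj: "\<gamma> 0 \<noteq> \<gamma> (1/2)"
  proof -
    have "loop_free \<gamma>" using \<gamma>(1) by (simp add: simple_path_def)
    from this[unfolded loop_free_def, rule_format, of 0 "1/2"] show ?thesis by auto
  qed
  define \<epsilon> where "\<epsilon> = dist (\<gamma> 0) (\<gamma> (1/2)) / 3"
  have "0 < \<epsilon>" using inj by (simp add: \<epsilon>_def)
  moreover have False if *: "\<theta>1 < \<theta>1'" "\<theta>1' < \<theta>2" "\<theta>2 < \<theta>2'" "\<theta>2' < \<theta>1 + 2 * pi"
     "near_on_arc f \<theta>1' (\<theta>1 + 2 * pi) p \<epsilon>" "near_on_arc f \<theta>2' (\<theta>2 + 2 * pi) p \<epsilon>" for \<theta>1 \<theta>1' \<theta>2 \<theta>2' p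
  proof -
    obtain \<rho>1 \<rho>2 where \<rho>1: "0 \<le> \<rho>1" "\<rho>1 < 1" "\<And>r t. \<rho>1 < r \<Longrightarrow> r < 1 \<Longrightarrow> \<theta>1' < t \<Longrightarrow> t < \<theta>1 + 2 * pi \<Longrightarrow> dist (f (of_real r * cis t)) p < \<epsilon>"
      and \<rho>2: "0 \<le> \<rho>2" "\<rho>2 < 1" "\<And>r t. \<rho>2 < r \<Longrightarrow> r < 1 \<Longrightarrow> \<theta>2' < t \<Longrightarrow> t < \<theta>2 + 2 * pi \<Longrightarrow> dist (f (of_real r * cis t)) p < \<epsilon>"
      using *(5,6) unfolding near_on_arc_def by metis
    define \<rho> where "\<rho> = max \<rho>1 \<rho>2"
    have close: "dist (f z) p < \<epsilon>" if z: "\<rho> < norm z" "norm z < 1" for z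
    proof -
      obtain t where t: "\<theta>2 \<le> t" "t < \<theta>2 + 2 * pi" "z = of_real (norm z) * cis t"
        by (rule polar_decomposition)
      show ?thesis
      proof (cases "\<theta>2' < t")
        case True
        then show ?thesis using \<rho>2(3)[of "norm z" t] t z by (auto simp: \<rho>_def)
      next
        case False
        then show ?thesis using \<rho>1(3)[of "norm z" t] t z * by (auto simp: \<rho>_def)
      qed
    qed
    have "\<rho> < 1" using \<rho>1 \<rho>2 by (simp add: \<rho>_def)
    \<comment> \<open>Away from a compact subdisc all values are near \<open>p\<close>. The image of
      the subdisc is closed and contained in the open image, so frontier points can only arise from
      values near \<open>p\<close>.\<close>
    have fr: "q \<in> cball p \<epsilon>" if "q \<in> path_image \<gamma>" for q
    proof -
      have q: "q \<in> closure (f ` ball 0 1)" "q \<notin> f ` ball 0 1"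
        using that \<gamma>(2) op unfolding frontier_def by (auto simp: interior_open)
      have "compact (f ` cball 0 \<rho>)"
        using \<open>\<rho> < 1\<close> by (intro compact_continuous_image continuous_on_subset[OF f]) auto
      then have cl: "closed (f ` cball 0 \<rho>)" by (rule compact_imp_closed)
      have "f ` ball 0 1 \<subseteq> f ` cball 0 \<rho> \<union> cball p \<epsilon>"
        using close by (force simp: dist_commute)
      then have "closure (f ` ball 0 1) \<subseteq> f ` cball 0 \<rho> \<union> cball p \<epsilon>"
        using cl by (intro closure_minimal closed_Un) auto
      moreover have "f ` cball 0 \<rho> \<subseteq> f ` ball 0 1" using \<open>\<rho> < 1\<close> by auto
      ultimately show ?thesis using q by blast
    qed
    have "\<gamma> 0 \<in> path_image \<gamma>" "\<gamma> (1/2) \<in> path_image \<gamma>" by (auto simp: path_image_def)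
    with fr have "dist p (\<gamma> 0) \<le> \<epsilon>" "dist p (\<gamma> (1/2)) \<le> \<epsilon>" by auto
    then have "dist (\<gamma> 0) (\<gamma> (1/2)) \<le> \<epsilon> + \<epsilon>"
      using dist_triangle3[of "\<gamma> 0" "\<gamma> (1/2)" p] by linarith
    then have "3 * \<epsilon> \<le> \<epsilon> + \<epsilon>" by (simp add: \<epsilon>_def)
    then show False using \<open>0 < \<epsilon>\<close> by simp
  qed
  ultimately show ?thesis using that by blast
qed

definition has_radial_limit :: "(complex \<Rightarrow> complex) \<Rightarrow> real \<Rightarrow> bool" where
  "has_radial_limit f \<theta> \<longleftrightarrow> (\<exists>w. radial_limit f \<theta> w)"

text \<open>The radial limits are shown to converge to some \<open>a\<close> as the angle increases
  to \<open>\<theta>0\<close>; for any two nearby angles, \<open>f\<close> is then near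
  \<open>a\<close> over the short arc or over its long complement. If one pair fails for the short
  arc, its long arc is good, and no pair of later angles can have a good long arc too, as the two
  would cover the circle.\<close>

lemma left_limit_on_arcs:
  fixes \<gamma> :: "real \<Rightarrow> complex"
  assumes f: "continuous_on (ball 0 1) f" "inj_on f (ball 0 1)" "bounded (f ` ball 0 1)"
    and \<gamma>: "simple_path \<gamma>" "pathfinish \<gamma> = pathstart \<gamma>" "frontier (f ` ball 0 1) = path_image \<gamma>"
    and dense: "\<And>x y. x < y \<Longrightarrow> \<exists>\<theta>. x < \<theta> \<and> \<theta> < y \<and> has_radial_limit f \<theta>"
  shows "\<exists>a. \<forall>\<epsilon>>0. \<exists>\<delta>>0. \<forall>\<theta> \<theta>'. has_radial_limit f \<theta> \<and> has_radial_limit f \<theta>' \<and>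
     \<theta>0 - \<delta> < \<theta> \<and> \<theta> < \<theta>' \<and> \<theta>' < \<theta>0 \<longrightarrow> near_on_arc f \<theta> \<theta>' a \<epsilon>"
proof -
  define w where "w \<theta> = (SOME w. radial_limit f \<theta> w)" for \<theta>
  have w: "radial_limit f \<theta> (w \<theta>)" if "has_radial_limit f \<theta>" for \<theta>
    using that unfolding has_radial_limit_def w_def by (rule someI_ex)
  have alt: "\<exists>\<delta>>0. \<forall>\<theta>1 \<theta>2. has_radial_limit f \<theta>1 \<and> has_radial_limit f \<theta>2 \<and> \<theta>1 < \<theta>2 \<and> \<theta>2 < \<theta>1 + 2 * pi \<and>
      dist (w \<theta>1) p < \<delta> \<and> dist (w \<theta>2) p < \<delta> \<longrightarrow> near_on_arc f \<theta>1 \<theta>2 p \<epsilon> \<or> near_on_arc f \<theta>2 (\<theta>1 + 2 * pi) p \<epsilon>"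
    if "0 < \<epsilon>" for p \<epsilon>
    using near_on_arc_alternative[OF f \<gamma> that] w by metis
  have rl_in: "w \<theta> \<in> closure (f ` ball 0 1)" if "has_radial_limit f \<theta>" for \<theta>
  proof (rule Lim_in_closed_set)
    show "((\<lambda>r. f (of_real r * cis \<theta>)) \<longlongrightarrow> w \<theta>) (at_left 1)" using w[OF that] unfolding radial_limit_def .
    have "f (of_real r * cis \<theta>) \<in> closure (f ` ball 0 1)" if "0 < r" "r < 1" for r
      using that closure_subset by (auto simp: norm_mult intro!: subsetD[OF closure_subset])
    then show "\<forall>\<^sub>F r in at_left 1. f (of_real r * cis \<theta>) \<in> closure (f ` ball 0 1)"
      using eventually_at_left_real[of 0 1] by (auto elim!: eventually_mono)
  qed simp_all
  have "\<exists>\<theta>. \<theta>0 - 1 / real (Suc n) < \<theta> \<and> \<theta> < \<theta>0 \<and> has_radial_limit f \<theta>" for n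
    by (rule dense) simp
  then obtain \<alpha> where \<alpha>: "\<And>n. \<theta>0 - 1 / real (Suc n) < \<alpha> n" "\<And>n. \<alpha> n < \<theta>0" "\<And>n. has_radial_limit f (\<alpha> n)"
    by metis
  have "bounded (range (w \<circ> \<alpha>))"
    using rl_in \<alpha>(3) by (intro bounded_subset[OF bounded_closure[OF f(3)]]) auto
  then obtain a and s :: "nat \<Rightarrow> nat" where s: "strict_mono s" "((w \<circ> \<alpha>) \<circ> s) \<longlonglongrightarrow> a"
    using bounded_imp_convergent_subsequence by blast
  have \<alpha>_lim: "\<alpha> \<longlonglongrightarrow> \<theta>0"
  proof (rule tendsto_sandwich[of "\<lambda>n. \<theta>0 - 1 / real (Suc n)" _ _ "\<lambda>_. \<theta>0"])
    show "(\<lambda>n. \<theta>0 - 1 / real (Suc n)) \<longlonglongrightarrow> \<theta>0"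
      using tendsto_diff[OF tendsto_const LIMSEQ_inverse_real_of_nat, of \<theta>0] by (simp add: inverse_eq_divide)
  qed (use \<alpha> in \<open>auto intro!: always_eventually less_imp_le\<close>)
  have good: "\<exists>\<theta>. x < \<theta> \<and> \<theta> < \<theta>0 \<and> has_radial_limit f \<theta> \<and> dist (w \<theta>) a < \<eta>" if "x < \<theta>0" "0 < \<eta>" for x \<eta>
  proof -
    have "\<forall>\<^sub>F n in sequentially. x < \<alpha> (s n)"
      using LIMSEQ_subseq_LIMSEQ[OF \<alpha>_lim s(1)] that(1) by (auto simp: o_def order_tendsto_iff)
    moreover have "\<forall>\<^sub>F n in sequentially. dist (w (\<alpha> (s n))) a < \<eta>"
      using tendstoD[OF s(2) that(2)] by (simp add: o_def)
    ultimately have "\<forall>\<^sub>F n in sequentially. x < \<alpha> (s n) \<and> dist (w (\<alpha> (s n))) a < \<eta>"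
      by eventually_elim simp
    then obtain n where "x < \<alpha> (s n) \<and> dist (w (\<alpha> (s n))) a < \<eta>"
      using eventually_happens by fastforce
    then show ?thesis using \<alpha> by blast
  qed
  \<comment> \<open>The candidate \<open>a\<close> is a cluster value. If the radial limits did not
    converge to it, angles with limits near \<open>a\<close> and angles with limits far from
    \<open>a\<close> would alternate arbitrarily close to \<open>\<theta>0\<close>.\<close>
  have lim: "\<exists>\<delta>>0. \<forall>\<theta>. has_radial_limit f \<theta> \<and> \<theta>0 - \<delta> < \<theta> \<and> \<theta> < \<theta>0 \<longrightarrow> dist (w \<theta>) a < \<eta>" if \<eta>: "0 < \<eta>" for \<eta>
  proof (rule ccontr)
    assume not: "\<not> ?thesis"
    have bad: "\<exists>\<theta>. x < \<theta> \<and> \<theta> < \<theta>0 \<and> has_radial_limit f \<theta> \<and> \<eta> \<le> dist (w \<theta>) a" if "x < \<theta>0" for x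
      using not that by (metis diff_diff_eq2 diff_gt_0_iff_gt not_le add_diff_cancel_left')
    have "0 < \<eta> / 2" using \<eta> by simp
    from alt[OF this, of a] obtain \<delta> where \<delta>: "0 < \<delta>" "\<And>\<theta>1 \<theta>2. has_radial_limit f \<theta>1 \<Longrightarrow> has_radial_limit f \<theta>2 \<Longrightarrow> \<theta>1 < \<theta>2 \<Longrightarrow> \<theta>2 < \<theta>1 + 2 * pi \<Longrightarrow>
      dist (w \<theta>1) a < \<delta> \<Longrightarrow> dist (w \<theta>2) a < \<delta> \<Longrightarrow> near_on_arc f \<theta>1 \<theta>2 a (\<eta> / 2) \<or> near_on_arc f \<theta>2 (\<theta>1 + 2 * pi) a (\<eta> / 2)"
      by blast
    obtain \<theta>1 where 1: "\<theta>0 - pi < \<theta>1" "\<theta>1 < \<theta>0" "has_radial_limit f \<theta>1" "dist (w \<theta>1) a < \<delta>"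
      using good[of "\<theta>0 - pi" \<delta>] \<delta>(1) by auto
    obtain \<theta>2 where 2: "\<theta>1 < \<theta>2" "\<theta>2 < \<theta>0" "has_radial_limit f \<theta>2" "\<eta> \<le> dist (w \<theta>2) a"
      using bad[OF 1(2)] by auto
    obtain \<theta>3 where 3: "\<theta>2 < \<theta>3" "\<theta>3 < \<theta>0" "has_radial_limit f \<theta>3" "dist (w \<theta>3) a < \<delta>"
      using good[OF 2(2) \<delta>(1)] by auto
    obtain \<theta>4 where 4: "\<theta>3 < \<theta>4" "\<theta>4 < \<theta>0" "has_radial_limit f \<theta>4" "\<eta> \<le> dist (w \<theta>4) a"
      using bad[OF 3(2)] by auto
    \<comment> \<open>Four alternating angles suffice: the far angle \<open>\<theta>2\<close> lies
      on one of the two arcs cut off by the near angles \<open>\<theta>1\<close> and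
      \<open>\<theta>3\<close>, and the far angle \<open>\<theta>4\<close> on the other.\<close>
    have "near_on_arc f \<theta>1 \<theta>3 a (\<eta> / 2) \<or> near_on_arc f \<theta>3 (\<theta>1 + 2 * pi) a (\<eta> / 2)"
      using 1 2 3 pi_gt_zero by (intro \<delta>(2)) linarith+
    then show False
    proof
      assume "near_on_arc f \<theta>1 \<theta>3 a (\<eta> / 2)"
      then have "dist (w \<theta>2) a \<le> \<eta> / 2"
        using w[OF 2(3)] 2(1) 3(1) by (rule near_on_arc_radial_limit)
      with 2 \<eta> show False by simp
    next
      assume "near_on_arc f \<theta>3 (\<theta>1 + 2 * pi) a (\<eta> / 2)"
      then have "dist (w \<theta>4) a \<le> \<eta> / 2"
        using w[OF 4(3)] 4(1) by (rule near_on_arc_radial_limit) (use 1 4 pi_gt_zero in linarith)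
      with 4 \<eta> show False by simp
    qed
  qed
  have op: "open (f ` ball 0 1)" using invariance_of_domain[OF f(1) open_ball f(2)] .
  obtain \<epsilon>0 where \<epsilon>0: "0 < \<epsilon>0"
    "\<And>\<theta>1 \<theta>1' \<theta>2 \<theta>2' p. \<theta>1 < \<theta>1' \<Longrightarrow> \<theta>1' < \<theta>2 \<Longrightarrow> \<theta>2 < \<theta>2' \<Longrightarrow> \<theta>2' < \<theta>1 + 2 * pi \<Longrightarrow>
       near_on_arc f \<theta>1' (\<theta>1 + 2 * pi) p \<epsilon>0 \<Longrightarrow> near_on_arc f \<theta>2' (\<theta>2 + 2 * pi) p \<epsilon>0 \<Longrightarrow> False"
    using not_near_on_whole_circle[OF f(1) \<gamma>(1,3) op] by metis
  show ?thesis
  proof (intro exI[of _ a] allI impI)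
    fix \<epsilon> :: real assume "0 < \<epsilon>"
    \<comment> \<open>Capping \<open>\<epsilon>\<close> at \<open>\<epsilon>0\<close> makes two
      overlapping long arcs contradictory.\<close>
    define \<epsilon>' where "\<epsilon>' = min \<epsilon> \<epsilon>0"
    have "0 < \<epsilon>'" using \<open>0 < \<epsilon>\<close> \<epsilon>0 by (simp add: \<epsilon>'_def)
    from alt[OF this, of a] obtain \<eta> where \<eta>: "0 < \<eta>" "\<And>\<theta>1 \<theta>2. has_radial_limit f \<theta>1 \<Longrightarrow> has_radial_limit f \<theta>2 \<Longrightarrow> \<theta>1 < \<theta>2 \<Longrightarrow> \<theta>2 < \<theta>1 + 2 * pi \<Longrightarrow>
      dist (w \<theta>1) a < \<eta> \<Longrightarrow> dist (w \<theta>2) a < \<eta> \<Longrightarrow> near_on_arc f \<theta>1 \<theta>2 a \<epsilon>' \<or> near_on_arc f \<theta>2 (\<theta>1 + 2 * pi) a \<epsilon>'"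
      by blast
    obtain \<delta>' where \<delta>': "0 < \<delta>'" "\<And>\<theta>. has_radial_limit f \<theta> \<Longrightarrow> \<theta>0 - \<delta>' < \<theta> \<Longrightarrow> \<theta> < \<theta>0 \<Longrightarrow> dist (w \<theta>) a < \<eta>"
      using lim[OF \<eta>(1)] by blast
    define \<delta> where "\<delta> = min \<delta>' pi"
    have \<delta>: "0 < \<delta>" "\<delta> \<le> pi" "\<delta> \<le> \<delta>'" using \<delta>' by (auto simp: \<delta>_def)
    have pair: "near_on_arc f \<theta> \<theta>' a \<epsilon>' \<or> near_on_arc f \<theta>' (\<theta> + 2 * pi) a \<epsilon>'"
      if "has_radial_limit f \<theta>" "has_radial_limit f \<theta>'" "\<theta>0 - \<delta> < \<theta>" "\<theta> < \<theta>'" "\<theta>' < \<theta>0" for \<theta> \<theta>'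
      using that \<delta> pi_gt_zero by (intro \<eta>(2) \<delta>'(2)) linarith+
    show "\<exists>\<delta>>0. \<forall>\<theta> \<theta>'. has_radial_limit f \<theta> \<and> has_radial_limit f \<theta>' \<and>
     \<theta>0 - \<delta> < \<theta> \<and> \<theta> < \<theta>' \<and> \<theta>' < \<theta>0 \<longrightarrow> near_on_arc f \<theta> \<theta>' a \<epsilon>"
    proof (cases "\<exists>\<theta>1 \<theta>1'. has_radial_limit f \<theta>1 \<and> has_radial_limit f \<theta>1' \<and>
     \<theta>0 - \<delta> < \<theta>1 \<and> \<theta>1 < \<theta>1' \<and> \<theta>1' < \<theta>0 \<and> \<not> near_on_arc f \<theta>1 \<theta>1' a \<epsilon>'")
      case True
      then obtain \<theta>1 \<theta>1' where 1: "has_radial_limit f \<theta>1" "has_radial_limit f \<theta>1'"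
        "\<theta>0 - \<delta> < \<theta>1" "\<theta>1 < \<theta>1'" "\<theta>1' < \<theta>0" "\<not> near_on_arc f \<theta>1 \<theta>1' a \<epsilon>'" by blast
      then have n1: "near_on_arc f \<theta>1' (\<theta>1 + 2 * pi) a \<epsilon>0"
        using pair[of \<theta>1 \<theta>1'] near_on_arc_mono[of _ _ _ _ \<epsilon>' \<epsilon>0] by (auto simp: \<epsilon>'_def)
      show ?thesis
      \<comment> \<open>The failing pair fixes the neighbourhood: beyond \<open>\<theta>1'\<close>
        every pair has its omitted arc disjoint from \<open>[\<theta>1, \<theta>1']\<close>.\<close>
      proof (intro exI[of _ "\<theta>0 - \<theta>1'"] conjI allI impI)
        show "0 < \<theta>0 - \<theta>1'" using 1 by simp
        fix \<theta> \<theta>' assume *: "has_radial_limit f \<theta> \<and> has_radial_limit f \<theta>' \<and>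
           \<theta>0 - (\<theta>0 - \<theta>1') < \<theta> \<and> \<theta> < \<theta>' \<and> \<theta>' < \<theta>0"
        have "\<not> near_on_arc f \<theta>' (\<theta> + 2 * pi) a \<epsilon>'"
        proof
          assume "near_on_arc f \<theta>' (\<theta> + 2 * pi) a \<epsilon>'"
          then have "near_on_arc f \<theta>' (\<theta> + 2 * pi) a \<epsilon>0"
            by (rule near_on_arc_mono) (simp add: \<epsilon>'_def)
          moreover have "\<theta>1' < \<theta>" "\<theta>' < \<theta>1 + 2 * pi" using * 1 \<delta> pi_gt_zero by linarith+
          ultimately show False using \<epsilon>0(2)[of \<theta>1 \<theta>1' \<theta> \<theta>' a] 1(4) * n1 by blast
        qed
        then have "near_on_arc f \<theta> \<theta>' a \<epsilon>'" using pair[of \<theta> \<theta>'] * 1 by auto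
        then show "near_on_arc f \<theta> \<theta>' a \<epsilon>" by (rule near_on_arc_mono) (simp add: \<epsilon>'_def)
      qed
    next
      case False
      have "near_on_arc f \<theta> \<theta>' a \<epsilon>" if "near_on_arc f \<theta> \<theta>' a \<epsilon>'" for \<theta> \<theta>'
        using that by (rule near_on_arc_mono) (simp add: \<epsilon>'_def)
      then show ?thesis using False \<delta>(1) by blast
    qed
  qed
qed

lemma near_on_arc_cnj: "near_on_arc (\<lambda>z. f (cnj z)) \<alpha> \<beta> p \<epsilon> \<longleftrightarrow> near_on_arc f (- \<beta>) (- \<alpha>) p \<epsilon>"
proof -
  have *: "(\<forall>t. P t) \<longleftrightarrow> (\<forall>t. P (- t))" for P :: "real \<Rightarrow> bool" by (metis minus_minus)
  show ?thesis
    unfolding near_on_arc_def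
    by (subst (2) *) (auto simp: cis_cnj)
qed

lemma has_radial_limit_cnj: "has_radial_limit (\<lambda>z. f (cnj z)) \<theta> \<longleftrightarrow> has_radial_limit f (- \<theta>)"
  by (simp add: has_radial_limit_def radial_limit_def cis_cnj)

text \<open>Precomposing \<open>f\<close> with complex conjugation preserves the disc and the image
  and reverses angles, which turns right limits into left limits.\<close>

lemma right_limit_on_arcs:
  fixes \<gamma> :: "real \<Rightarrow> complex"
  assumes f: "continuous_on (ball 0 1) f" "inj_on f (ball 0 1)" "bounded (f ` ball 0 1)"
    and \<gamma>: "simple_path \<gamma>" "pathfinish \<gamma> = pathstart \<gamma>" "frontier (f ` ball 0 1) = path_image \<gamma>"
    and dense: "\<And>x y. x < y \<Longrightarrow> \<exists>\<theta>. x < \<theta> \<and> \<theta> < y \<and> has_radial_limit f \<theta>"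
  shows "\<exists>a. \<forall>\<epsilon>>0. \<exists>\<delta>>0. \<forall>\<theta> \<theta>'. has_radial_limit f \<theta> \<and> has_radial_limit f \<theta>' \<and>
     \<theta>0 < \<theta> \<and> \<theta> < \<theta>' \<and> \<theta>' < \<theta>0 + \<delta> \<longrightarrow> near_on_arc f \<theta> \<theta>' a \<epsilon>"
proof -
  let ?f = "\<lambda>z. f (cnj z)"
  have D: "cnj ` ball 0 1 = ball 0 1"
  proof (intro equalityI subsetI)
    fix x :: complex assume "x \<in> ball 0 1"
    then show "x \<in> cnj ` ball 0 1" by (intro image_eqI[of x cnj "cnj x"]) auto
  qed auto
  have im: "?f ` ball 0 1 = f ` ball 0 1" by (subst (2) D[symmetric]) (simp only: image_image)
  have 1: "continuous_on (ball 0 1) ?f"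
    by (rule continuous_on_compose2[OF f(1) continuous_on_cnj[OF continuous_on_id]]) auto
  have 2: "inj_on ?f (ball 0 1)"
  proof (rule inj_onI)
    fix x y :: complex assume "x \<in> ball 0 1" "y \<in> ball 0 1" "f (cnj x) = f (cnj y)"
    then have "cnj x = cnj y" using inj_onD[OF f(2), of "cnj x" "cnj y"] by simp
    then show "x = y" by simp
  qed
  have 3: "\<exists>\<theta>. x < \<theta> \<and> \<theta> < y \<and> has_radial_limit ?f \<theta>" if "x < y" for x y
  proof -
    obtain \<theta> where "- y < \<theta>" "\<theta> < - x" "has_radial_limit f \<theta>" using dense[of "-y" "-x"] \<open>x < y\<close> by fastforce
    then show ?thesis by (intro exI[of _ "- \<theta>"]) (simp add: has_radial_limit_cnj)
  qed
  obtain a where a: "\<And>\<epsilon>. 0 < \<epsilon> \<Longrightarrow> \<exists>\<delta>>0. \<forall>\<theta> \<theta>'. has_radial_limit ?f \<theta> \<and> has_radial_limit ?f \<theta>' \<and>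
     - \<theta>0 - \<delta> < \<theta> \<and> \<theta> < \<theta>' \<and> \<theta>' < - \<theta>0 \<longrightarrow> near_on_arc ?f \<theta> \<theta>' a \<epsilon>"
    using left_limit_on_arcs[OF 1 2 f(3)[folded im] \<gamma>(1,2) \<gamma>(3)[folded im] 3, of "- \<theta>0"] by blast
  show ?thesis
  proof (intro exI[of _ a] allI impI)
    fix \<epsilon> :: real assume "0 < \<epsilon>"
    from a[OF this] obtain \<delta> where \<delta>: "0 < \<delta>" "\<And>\<theta> \<theta>'. has_radial_limit ?f \<theta> \<Longrightarrow> has_radial_limit ?f \<theta>' \<Longrightarrow>
     - \<theta>0 - \<delta> < \<theta> \<Longrightarrow> \<theta> < \<theta>' \<Longrightarrow> \<theta>' < - \<theta>0 \<Longrightarrow> near_on_arc ?f \<theta> \<theta>' a \<epsilon>" by blast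
    have "near_on_arc f \<theta> \<theta>' a \<epsilon>" if "has_radial_limit f \<theta>" "has_radial_limit f \<theta>'" "\<theta>0 < \<theta>" "\<theta> < \<theta>'" "\<theta>' < \<theta>0 + \<delta>" for \<theta> \<theta>'
      using \<delta>(2)[of "- \<theta>'" "- \<theta>"] that by (simp add: has_radial_limit_cnj near_on_arc_cnj)
    then show "\<exists>\<delta>>0. \<forall>\<theta> \<theta>'. has_radial_limit f \<theta> \<and> has_radial_limit f \<theta>' \<and>
     \<theta>0 < \<theta> \<and> \<theta> < \<theta>' \<and> \<theta>' < \<theta>0 + \<delta> \<longrightarrow> near_on_arc f \<theta> \<theta>' a \<epsilon>" using \<delta>(1) by blast
  qed
qed

section \<open>From arcs to unrestricted limits at boundary points\<close>

lemma at_cis_within_ball_neq_bot: "at (cis s) within ball 0 1 \<noteq> bot"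
  using islimpt_ball[of "cis s" 0 1] by (simp add: trivial_limit_within)

lemma boundary_function_eq_Some_iff:
  "boundary_function f (cis s) = Some L \<longleftrightarrow> (f \<longlongrightarrow> L) (at (cis s) within ball 0 1)"
  unfolding boundary_function_def
  using tendsto_Lim[OF at_cis_within_ball_neq_bot, of f] by auto

text \<open>Near \<open>cis s\<close> an angle of \<open>z\<close> is chosen continuously as
  \<open>s + Arg (z * cis (- s))\<close>: the rotated point is close to 1, away from the branch cut
  of \<open>Arg\<close>.\<close>

lemma near_on_arc_eventually:
  assumes "near_on_arc f \<alpha> \<beta> p \<epsilon>" "\<alpha> < s" "s < \<beta>"
  shows "\<forall>\<^sub>F z in at (cis s) within ball 0 1. dist (f z) p < \<epsilon>"
proof -
  obtain \<rho> where \<rho>: "\<rho> < 1" "\<And>r t. \<rho> < r \<Longrightarrow> r < 1 \<Longrightarrow> \<alpha> < t \<Longrightarrow> t < \<beta> \<Longrightarrow> dist (f (of_real r * cis t)) p < \<epsilon>"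
    using assms(1) unfolding near_on_arc_def by blast
  let ?F = "at (cis s) within ball 0 1"
  let ?t = "\<lambda>z. s + Arg (z * cis (- s))"
  have "isCont Arg (cis s * cis (- s))"
    by (rule continuous_at_Arg) (simp add: cis_mult)
  then have "(?t \<longlongrightarrow> s + Arg (cis s * cis (- s))) ?F"
    by (intro tendsto_intros isCont_tendsto_compose[of _ Arg])
  then have t: "(?t \<longlongrightarrow> s) ?F" by (simp add: cis_mult)
  have "(norm \<longlongrightarrow> norm (cis s)) ?F" by (intro tendsto_intros)
  then have "\<forall>\<^sub>F z in ?F. \<rho> < norm z" using \<rho>(1) by (auto simp: order_tendsto_iff)
  moreover have "\<forall>\<^sub>F z in ?F. \<alpha> < ?t z" "\<forall>\<^sub>F z in ?F. ?t z < \<beta>"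
    using t assms(2,3) by (auto simp: order_tendsto_iff)
  moreover have "\<forall>\<^sub>F z in ?F. z \<in> ball 0 1" by (simp add: eventually_at_filter)
  ultimately show ?thesis
  proof eventually_elim
    case (elim z)
    have "z * cis (- s) = of_real (norm z) * cis (Arg (z * cis (- s)))"
      using rcis_cmod_Arg[of "z * cis (- s)"] unfolding rcis_def norm_mult norm_cis mult_1_right by (rule sym)
    from arg_cong[OF this, of "\<lambda>x. x * cis s"]
    have "z * cis (- s) * cis s = of_real (norm z) * cis (?t z)"
      by (simp only: mult.assoc cis_mult) (simp only: add.commute)
    then have "z = of_real (norm z) * cis (?t z)"
      by (simp add: mult.assoc cis_mult)
    then show ?case using \<rho>(2)[of "norm z" "?t z"] elim by simp
  qed
qed

text \<open>A Cauchy criterion: the centre \<open>p\<close> may change with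
  \<open>\<epsilon>\<close>, so the limit is first produced by compactness along one sequence and
  then seen to be within \<open>\<epsilon> / 2\<close> of each \<open>p\<close>.\<close>

lemma boundary_function_exists:
  assumes "bounded (f ` ball 0 1)" "\<And>\<epsilon>. 0 < \<epsilon> \<Longrightarrow> \<exists>\<alpha> \<beta> p. \<alpha> < s \<and> s < \<beta> \<and> near_on_arc f \<alpha> \<beta> p \<epsilon>"
  shows "boundary_function f (cis s) \<noteq> None"
proof -
  let ?F = "at (cis s) within ball 0 1"
  have "cis s islimpt ball 0 1" using islimpt_ball[of "cis s" 0 1] by simp
  then obtain z where z: "\<And>n :: nat. z n \<in> ball 0 1 - {cis s}" "z \<longlonglongrightarrow> cis s"
    unfolding islimpt_sequential by blast
  have "bounded (range (\<lambda>n. f (z n)))"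
    using z(1) by (intro bounded_subset[OF assms(1)]) auto
  then obtain L and k :: "nat \<Rightarrow> nat" where k: "strict_mono k" "((\<lambda>n. f (z n)) \<circ> k) \<longlonglongrightarrow> L"
    using bounded_imp_convergent_subsequence by blast
  have zb: "norm (z n) < 1" "z n \<noteq> cis s" for n
    using z(1)[of n] by auto
  have "filterlim z ?F sequentially"
    using z(2) zb by (simp add: filterlim_at)
  then have zk: "filterlim (\<lambda>n. z (k n)) ?F sequentially"
    using k(1) filterlim_compose filterlim_subseq by blast
  have "(f \<longlongrightarrow> L) ?F"
  proof (rule tendstoI)
    fix \<epsilon> :: real assume "0 < \<epsilon>"
    then have "0 < \<epsilon> / 2" by simp
    from assms(2)[OF this] obtain \<alpha> \<beta> p where "\<alpha> < s" "s < \<beta>" "near_on_arc f \<alpha> \<beta> p (\<epsilon> / 2)" by blast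
    then have ev: "\<forall>\<^sub>F z in ?F. dist (f z) p < \<epsilon> / 2" using near_on_arc_eventually by blast
    have "(\<lambda>n. dist (f (z (k n))) p) \<longlonglongrightarrow> dist L p"
      using k(2) by (intro tendsto_intros) (simp add: o_def)
    moreover have "\<forall>\<^sub>F n in sequentially. dist (f (z (k n))) p \<le> \<epsilon> / 2"
      using eventually_compose_filterlim[OF ev zk] by (auto elim: eventually_mono)
    ultimately have Lp: "dist L p \<le> \<epsilon> / 2" by (rule tendsto_upperbound) simp
    from ev show "\<forall>\<^sub>F z in ?F. dist (f z) L < \<epsilon>"
    proof eventually_elim
      case (elim z)
      then show ?case using Lp dist_triangle2[of "f z" L p] by simp
    qed
  qed
  then show ?thesis by (simp add: boundary_function_eq_Some_iff[symmetric])
qed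

lemma countable_imp_AE_notin:
  fixes B :: "real set"
  assumes "countable B"
  shows "AE s in lebesgue. s \<notin> B"
  by (rule AE_completion[OF AE_not_in[OF countable_imp_null_set_lborel[OF assms]]])

text \<open>Call an angle bad for \<open>\<epsilon>\<close> if no arc around it is nearly constant
  to within \<open>\<epsilon>\<close>. The one-sided limits at a point \<open>x\<close> make all
  angles close to \<open>x\<close> but different from it good, so bad angles do not accumulate and
  are countable. Where no \<open>1 / (n + 1)\<close> is bad, the boundary function exists.\<close>

lemma Jordan_boundary_function:
  fixes \<gamma> :: "real \<Rightarrow> complex"
  assumes f: "continuous_on (ball 0 1) f" "inj_on f (ball 0 1)" "bounded (f ` ball 0 1)"
    and \<gamma>: "simple_path \<gamma>" "pathfinish \<gamma> = pathstart \<gamma>" "frontier (f ` ball 0 1) = path_image \<gamma>"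
    and dense: "\<And>x y. x < y \<Longrightarrow> \<exists>\<theta>. x < \<theta> \<and> \<theta> < y \<and> has_radial_limit f \<theta>"
  shows countable_boundary_function_None: "countable {s. boundary_function f (cis s) = None}"
    and boundary_function_ess_lim_left: "\<exists>a. ess_lim_left (\<lambda>s. boundary_function f (cis s)) \<theta>0 a"
    and boundary_function_ess_lim_right: "\<exists>b. ess_lim_right (\<lambda>s. boundary_function f (cis s)) \<theta>0 b"
proof -
  define bad where "bad \<epsilon> = {s. \<not> (\<exists>\<alpha> \<beta> p. \<alpha> < s \<and> s < \<beta> \<and> near_on_arc f \<alpha> \<beta> p \<epsilon>)}" for \<epsilon>
  obtain al where left: "\<And>x \<epsilon>. 0 < \<epsilon> \<Longrightarrow> \<exists>\<delta>>0. \<forall>\<theta> \<theta>'. has_radial_limit f \<theta> \<and> has_radial_limit f \<theta>' \<and>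
     x - \<delta> < \<theta> \<and> \<theta> < \<theta>' \<and> \<theta>' < x \<longrightarrow> near_on_arc f \<theta> \<theta>' (al x) \<epsilon>"
    using left_limit_on_arcs[OF f \<gamma> dense] by metis
  obtain ar where right: "\<And>x \<epsilon>. 0 < \<epsilon> \<Longrightarrow> \<exists>\<delta>>0. \<forall>\<theta> \<theta>'. has_radial_limit f \<theta> \<and> has_radial_limit f \<theta>' \<and>
     x < \<theta> \<and> \<theta> < \<theta>' \<and> \<theta>' < x + \<delta> \<longrightarrow> near_on_arc f \<theta> \<theta>' (ar x) \<epsilon>"
    using right_limit_on_arcs[OF f \<gamma> dense] by metis
  have around: "\<exists>\<theta> \<theta>'. has_radial_limit f \<theta> \<and> has_radial_limit f \<theta>' \<and> x < \<theta> \<and> \<theta> < s \<and> s < \<theta>' \<and> \<theta>' < y"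
    if "x < s" "s < y" for x s y
    using dense[OF that(1)] dense[OF that(2)] by blast
  have "countable (bad \<epsilon>)" if "0 < \<epsilon>" for \<epsilon>
  proof -
    have "\<not> x islimpt bad \<epsilon>" for x
    proof -
      obtain a \<delta>1 where 1: "0 < \<delta>1" "\<And>\<theta> \<theta>'. has_radial_limit f \<theta> \<Longrightarrow> has_radial_limit f \<theta>' \<Longrightarrow>
         x - \<delta>1 < \<theta> \<Longrightarrow> \<theta> < \<theta>' \<Longrightarrow> \<theta>' < x \<Longrightarrow> near_on_arc f \<theta> \<theta>' a \<epsilon>"
        using left[OF \<open>0 < \<epsilon>\<close>, of x] by blast
      obtain b \<delta>2 where 2: "0 < \<delta>2" "\<And>\<theta> \<theta>'. has_radial_limit f \<theta> \<Longrightarrow> has_radial_limit f \<theta>' \<Longrightarrow>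
         x < \<theta> \<Longrightarrow> \<theta> < \<theta>' \<Longrightarrow> \<theta>' < x + \<delta>2 \<Longrightarrow> near_on_arc f \<theta> \<theta>' b \<epsilon>"
        using right[OF \<open>0 < \<epsilon>\<close>, of x] by blast
      have "s \<notin> bad \<epsilon>" if s: "s \<in> ball x (min \<delta>1 \<delta>2)" "s \<noteq> x" for s
      proof (cases "s < x")
        case True
        obtain \<theta> \<theta>' where "has_radial_limit f \<theta>" "has_radial_limit f \<theta>'" "x - \<delta>1 < \<theta>" "\<theta> < s" "s < \<theta>'" "\<theta>' < x"
          using around[of "x - \<delta>1" s x] True s by (auto simp: dist_real_def)
        then have "near_on_arc f \<theta> \<theta>' a \<epsilon>" "\<theta> < s" "s < \<theta>'" using 1(2) by auto
        then show ?thesis unfolding bad_def by blast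
      next
        case False
        with s have "x < s" by simp
        obtain \<theta> \<theta>' where "has_radial_limit f \<theta>" "has_radial_limit f \<theta>'" "x < \<theta>" "\<theta> < s" "s < \<theta>'" "\<theta>' < x + \<delta>2"
          using around[of x s "x + \<delta>2"] \<open>x < s\<close> s by (auto simp: dist_real_def)
        then have "near_on_arc f \<theta> \<theta>' b \<epsilon>" "\<theta> < s" "s < \<theta>'" using 2(2) by auto
        then show ?thesis unfolding bad_def by blast
      qed
      then show ?thesis
        using 1(1) 2(1) unfolding islimpt_def by (metis centre_in_ball min_less_iff_conj open_ball)
    qed
    then have "bad \<epsilon> sparse_in UNIV" unfolding sparse_in_def by blast
    from sparse_imp_countable[OF open_UNIV this] show ?thesis by simp
  qed
  then have "countable (\<Union>n. bad (1 / real (Suc n)))" by simp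
  moreover have sub: "{s. boundary_function f (cis s) = None} \<subseteq> (\<Union>n. bad (1 / real (Suc n)))"
  proof (rule subsetI, rule ccontr)
    fix s assume s: "s \<in> {s. boundary_function f (cis s) = None}" "s \<notin> (\<Union>n. bad (1 / real (Suc n)))"
    have "boundary_function f (cis s) \<noteq> None"
    proof (rule boundary_function_exists[OF f(3)])
      fix \<epsilon> :: real assume "0 < \<epsilon>"
      then obtain n where n: "1 / real (Suc n) < \<epsilon>" using nat_approx_posE by blast
      obtain \<alpha> \<beta> p where "\<alpha> < s" "s < \<beta>" "near_on_arc f \<alpha> \<beta> p (1 / real (Suc n))"
        using s(2) unfolding bad_def by blast
      then show "\<exists>\<alpha> \<beta> p. \<alpha> < s \<and> s < \<beta> \<and> near_on_arc f \<alpha> \<beta> p \<epsilon>"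
        using near_on_arc_mono n by (meson less_imp_le)
    qed
    with s(1) show False by simp
  qed
  ultimately show c: "countable {s. boundary_function f (cis s) = None}" by (rule countable_subset[rotated])
  \<comment> \<open>The strict estimate on the arc becomes a weak one in the limit, hence the use of
    \<open>\<epsilon> / 2\<close>.\<close>
  have close: "\<exists>w. boundary_function f (cis s) = Some w \<and> dist w a < \<epsilon>"
    if "s \<notin> {s. boundary_function f (cis s) = None}" "near_on_arc f \<alpha> \<beta> a (\<epsilon> / 2)" "\<alpha> < s" "s < \<beta>" "0 < \<epsilon>" for s a \<alpha> \<beta> \<epsilon>
  proof -
    from that(1) obtain w where w: "boundary_function f (cis s) = Some w" by auto
    then have "((\<lambda>z. dist (f z) a) \<longlongrightarrow> dist w a) (at (cis s) within ball 0 1)"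
      by (intro tendsto_intros) (simp add: boundary_function_eq_Some_iff)
    moreover have "\<forall>\<^sub>F z in at (cis s) within ball 0 1. dist (f z) a \<le> \<epsilon> / 2"
      using near_on_arc_eventually[OF that(2-4)] by (auto elim: eventually_mono)
    ultimately have "dist w a \<le> \<epsilon> / 2"
      using at_cis_within_ball_neq_bot by (rule tendsto_upperbound)
    with w \<open>0 < \<epsilon>\<close> show ?thesis by auto
  qed
  let ?a = "al \<theta>0" and ?b = "ar \<theta>0"
  have "ess_lim_left (\<lambda>s. boundary_function f (cis s)) \<theta>0 ?a"
    unfolding ess_lim_left_def
  proof (intro allI impI)
    fix \<epsilon> :: real assume "0 < \<epsilon>"
    then have "0 < \<epsilon> / 2" by simp
    from left[OF this, of \<theta>0] obtain \<delta> where \<delta>: "0 < \<delta>" "\<And>\<theta> \<theta>'. has_radial_limit f \<theta> \<Longrightarrow> has_radial_limit f \<theta>' \<Longrightarrow>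
     \<theta>0 - \<delta> < \<theta> \<Longrightarrow> \<theta> < \<theta>' \<Longrightarrow> \<theta>' < \<theta>0 \<Longrightarrow> near_on_arc f \<theta> \<theta>' ?a (\<epsilon> / 2)" by blast
    have "AE s in lebesgue. s \<in> {\<theta>0 - \<delta><..<\<theta>0} \<longrightarrow> (\<exists>w. boundary_function f (cis s) = Some w \<and> dist w ?a < \<epsilon>)"
      using countable_imp_AE_notin[OF c]
    proof eventually_elim
      case (elim s)
      show ?case
      proof
        assume s: "s \<in> {\<theta>0 - \<delta><..<\<theta>0}"
        then obtain \<theta> \<theta>' where "has_radial_limit f \<theta>" "has_radial_limit f \<theta>'" "\<theta>0 - \<delta> < \<theta>" "\<theta> < s" "s < \<theta>'" "\<theta>' < \<theta>0"
          using around[of "\<theta>0 - \<delta>" s \<theta>0] by auto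
        then show "\<exists>w. boundary_function f (cis s) = Some w \<and> dist w ?a < \<epsilon>"
          using \<delta>(2)[of \<theta> \<theta>'] by (intro close[OF elim _ _ _ \<open>0 < \<epsilon>\<close>, of \<theta> \<theta>']) auto
      qed
    qed
    then show "\<exists>\<delta>>0. AE s in lebesgue. s \<in> {\<theta>0 - \<delta><..<\<theta>0} \<longrightarrow> (\<exists>w. boundary_function f (cis s) = Some w \<and> dist w ?a < \<epsilon>)"
      using \<delta>(1) by blast
  qed
  then show "\<exists>a. ess_lim_left (\<lambda>s. boundary_function f (cis s)) \<theta>0 a" ..
  have "ess_lim_right (\<lambda>s. boundary_function f (cis s)) \<theta>0 ?b"
    unfolding ess_lim_right_def
  proof (intro allI impI)
    fix \<epsilon> :: real assume "0 < \<epsilon>"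
    then have "0 < \<epsilon> / 2" by simp
    from right[OF this, of \<theta>0] obtain \<delta> where \<delta>: "0 < \<delta>" "\<And>\<theta> \<theta>'. has_radial_limit f \<theta> \<Longrightarrow> has_radial_limit f \<theta>' \<Longrightarrow>
     \<theta>0 < \<theta> \<Longrightarrow> \<theta> < \<theta>' \<Longrightarrow> \<theta>' < \<theta>0 + \<delta> \<Longrightarrow> near_on_arc f \<theta> \<theta>' ?b (\<epsilon> / 2)" by blast
    have "AE s in lebesgue. s \<in> {\<theta>0<..<\<theta>0 + \<delta>} \<longrightarrow> (\<exists>w. boundary_function f (cis s) = Some w \<and> dist w ?b < \<epsilon>)"
      using countable_imp_AE_notin[OF c]
    proof eventually_elim
      case (elim s)
      show ?case
      proof
        assume s: "s \<in> {\<theta>0<..<\<theta>0 + \<delta>}"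
        then obtain \<theta> \<theta>' where "has_radial_limit f \<theta>" "has_radial_limit f \<theta>'" "\<theta>0 < \<theta>" "\<theta> < s" "s < \<theta>'" "\<theta>' < \<theta>0 + \<delta>"
          using around[of \<theta>0 s "\<theta>0 + \<delta>"] by auto
        then show "\<exists>w. boundary_function f (cis s) = Some w \<and> dist w ?b < \<epsilon>"
          using \<delta>(2)[of \<theta> \<theta>'] by (intro close[OF elim _ _ _ \<open>0 < \<epsilon>\<close>, of \<theta> \<theta>']) auto
      qed
    qed
    then show "\<exists>\<delta>>0. AE s in lebesgue. s \<in> {\<theta>0<..<\<theta>0 + \<delta>} \<longrightarrow> (\<exists>w. boundary_function f (cis s) = Some w \<and> dist w ?b < \<epsilon>)"
      using \<delta>(1) by blast
  qed
  then show "\<exists>b. ess_lim_right (\<lambda>s. boundary_function f (cis s)) \<theta>0 b" ..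
qed

section \<open>Asymptotics of the derivative at a jump\<close>

lemma AE_lebesgue_negligible:
  assumes "AE x in lebesgue. P x"
  obtains N where "negligible N" "\<And>x. x \<notin> N \<Longrightarrow> P x"
proof -
  from assms obtain N where "{x \<in> space lebesgue. \<not> P x} \<subseteq> N" "emeasure lebesgue N = 0" "N \<in> sets lebesgue"
    by (rule AE_E)
  then show ?thesis
    by (intro that[of N]) (auto simp: negligible_iff_null_sets null_sets_def)
qed

lemma negligible_shift:
  fixes N :: "real set"
  assumes "negligible N"
  shows "negligible {t. c + t \<in> N}"
proof -
  have "{t. c + t \<in> N} = (\<lambda>x. - c + x) ` N" by (force simp: image_iff)
  then show ?thesis using negligible_translation[OF assms] by metis
qed

text \<open>This is why \<open>1 - r\<close> is the right normalisation of the derivative: up to the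
  factor \<open>1 / (1 - \<rho>\<^sup>2)\<close> the kernel is as concentrated as the Poisson kernel
  and has the same mass.\<close>

lemma norm_deriv_kernel:
  assumes "0 \<le> \<rho>" "\<rho> < 1"
  shows "cmod (cis t / (cis t - of_real \<rho>)\<^sup>2) = poisson \<rho> t / (1 - \<rho>\<^sup>2)"
proof -
  have "1 - \<rho>\<^sup>2 \<noteq> 0" using assms by (simp add: power2_eq_1_iff)
  then show ?thesis
    by (simp add: norm_divide norm_power norm_cis_minus_real poisson_def)
qed

lemma has_integral_deriv_kernel:
  assumes "0 \<le> \<rho>" "\<rho> < 1" "\<alpha> \<le> \<beta>"
  shows "((\<lambda>t. cis t / (cis t - of_real \<rho>)\<^sup>2) has_integral
     \<i> / (cis \<beta> - of_real \<rho>) - \<i> / (cis \<alpha> - of_real \<rho>)) {\<alpha>..\<beta>}"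
proof (rule fundamental_theorem_of_calculus[OF assms(3)])
  fix t :: real
  have "cis t \<noteq> of_real \<rho>"
  proof
    assume "cis t = of_real \<rho>"
    then have "cmod (cis t) = cmod (of_real \<rho>)" by (rule arg_cong)
    then show False using assms by simp
  qed
  then have "((\<lambda>z. \<i> / (exp (\<i> * z) - of_real \<rho>)) has_field_derivative
      exp (\<i> * of_real t) / (exp (\<i> * of_real t) - of_real \<rho>)\<^sup>2) (at (of_real t))"
    unfolding cis_conv_exp
    by (auto intro!: derivative_eq_intros simp: divide_simps power2_eq_square) (simp add: algebra_simps complex_eq_iff)
  from has_vector_derivative_real_field[OF this, of "{\<alpha>..\<beta>}"]
  show "((\<lambda>t. \<i> / (cis t - of_real \<rho>)) has_vector_derivative cis t / (cis t - of_real \<rho>)\<^sup>2) (at t within {\<alpha>..\<beta>})"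
    unfolding cis_conv_exp .
qed

lemma deriv_scaled:
  assumes "h holomorphic_on ball 0 1" "norm (c * z) < 1"
  shows "deriv (\<lambda>w. h (c * w)) z = c * deriv h (c * z)"
proof (rule DERIV_imp_deriv)
  have "(h has_field_derivative deriv h (c * z)) (at (c * z))"
    using assms by (intro holomorphic_derivI[OF assms(1)]) auto
  moreover have "((\<lambda>w. c * w) has_field_derivative c) (at z)"
    by (auto intro!: derivative_eq_intros)
  ultimately have "((\<lambda>w. h (c * w)) has_field_derivative deriv h (c * z) * c) (at z)"
    by (rule DERIV_chain2)
  then show "((\<lambda>w. h (c * w)) has_field_derivative c * deriv h (c * z)) (at z)"
    by (simp only: mult.commute)
qed

text \<open>The boundary function is compared with the step function equal to \<open>a\<close> on
  the left half circle and \<open>b\<close> on the right one. The step function contributes an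
  explicit main term; the difference is small near the jump, and far from it the kernel is small.
  \<open>E\<close> is the error after scaling by \<open>2 * pi * (1 - \<rho>)\<close>, where
  \<open>(1 - \<rho>) / (1 - \<rho>\<^sup>2)\<close> becomes
  \<open>1 / (1 + \<rho>)\<close>.\<close>

lemma jump_asymptotics:
  fixes h g :: "complex \<Rightarrow> complex"
  defines "F \<equiv> \<lambda>z. h z + cnj (g z)"
  assumes hol: "h holomorphic_on ball 0 1" "g holomorphic_on ball 0 1"
    and bound: "\<And>z. z \<in> ball 0 1 \<Longrightarrow> cmod (F z) \<le> M"
    and ctb: "countable {s. boundary_function F (cis s) = None}"
    and left: "ess_lim_left (\<lambda>s. boundary_function F (cis s)) \<theta> a"
    and right: "ess_lim_right (\<lambda>s. boundary_function F (cis s)) \<theta> b"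
  shows "((\<lambda>r. (1 - r) * cmod (deriv h (of_real r * cis \<theta>))) \<longlongrightarrow> cmod (a - b) / (2 * pi)) (at_left 1)"
proof -
  define B where "B = M + cmod a + cmod b"
  have "0 \<le> M" using order_trans[OF norm_ge_zero bound, of 0] by simp
  define E where "E \<rho> = of_real (2 * pi * (1 - \<rho>)) * (cis \<theta> * deriv h (of_real \<rho> * cis \<theta>)) - (a - b) * (2 * \<i> / (1 + of_real \<rho>))" for \<rho>
  have E_bound: "\<exists>\<delta>. 0 < \<delta> \<and> \<delta> \<le> pi \<and> (\<forall>\<rho>. 0 \<le> \<rho> \<and> \<rho> < 1 \<longrightarrow> cmod (E \<rho>) \<le> 2 * pi * \<epsilon> + 2 * pi * B * poisson \<rho> \<delta>)"
    if "0 < \<epsilon>" for \<epsilon>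
  proof -
    obtain \<delta>1 where \<delta>1: "0 < \<delta>1" "AE s in lebesgue. s \<in> {\<theta> - \<delta>1<..<\<theta>} \<longrightarrow> (\<exists>w. boundary_function F (cis s) = Some w \<and> dist w a < \<epsilon>)"
      using left \<open>0 < \<epsilon>\<close> unfolding ess_lim_left_def by blast
    obtain \<delta>2 where \<delta>2: "0 < \<delta>2" "AE s in lebesgue. s \<in> {\<theta><..<\<theta> + \<delta>2} \<longrightarrow> (\<exists>w. boundary_function F (cis s) = Some w \<and> dist w b < \<epsilon>)"
      using right \<open>0 < \<epsilon>\<close> unfolding ess_lim_right_def by blast
    obtain N1 where N1: "negligible N1" "\<And>s. s \<notin> N1 \<Longrightarrow> s \<in> {\<theta> - \<delta>1<..<\<theta>} \<longrightarrow> (\<exists>w. boundary_function F (cis s) = Some w \<and> dist w a < \<epsilon>)"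
      using AE_lebesgue_negligible[OF \<delta>1(2)] by blast
    obtain N2 where N2: "negligible N2" "\<And>s. s \<notin> N2 \<Longrightarrow> s \<in> {\<theta><..<\<theta> + \<delta>2} \<longrightarrow> (\<exists>w. boundary_function F (cis s) = Some w \<and> dist w b < \<epsilon>)"
      using AE_lebesgue_negligible[OF \<delta>2(2)] by blast
    obtain N3 where N3: "negligible N3" "\<And>s. s \<notin> N3 \<Longrightarrow> s \<notin> {s. boundary_function F (cis s) = None}"
      using AE_lebesgue_negligible[OF countable_imp_AE_notin[OF ctb]] by blast
    define \<delta> where "\<delta> = min (min \<delta>1 \<delta>2) pi"
    have \<delta>: "0 < \<delta>" "\<delta> \<le> pi" "\<delta> \<le> \<delta>1" "\<delta> \<le> \<delta>2" using \<delta>1 \<delta>2 by (auto simp: \<delta>_def)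
    \<comment> \<open>Angles are measured from \<open>\<theta>\<close>. The point 0 is added because
      neither one-sided estimate speaks about it.\<close>
    define N where "N = insert 0 ({t. \<theta> + t \<in> N1} \<union> {t. \<theta> + t \<in> N2} \<union> {t. \<theta> + t \<in> N3})"
    have "negligible N"
      unfolding N_def negligible_insert by (intro negligible_Un negligible_shift N1 N2 N3)
    define \<sigma> where "\<sigma> t = (if t < 0 then a else b)" for t :: real
    \<comment> \<open>On the exceptional null set \<open>u\<close> follows the step function, so the
      estimates for \<open>u - \<sigma>\<close> hold at every point.\<close>
    define u where "u t = (if t \<in> N then \<sigma> t else the (boundary_function F (cis (\<theta> + t))))" for t
    have bf: "boundary_function F (cis (\<theta> + t)) = Some (u t)" if "t \<notin> N" for t
      using N3(2)[of "\<theta> + t"] that by (auto simp: N_def u_def)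
    have near: "cmod (u t - \<sigma> t) \<le> \<epsilon>" if "\<bar>t\<bar> < \<delta>" for t
    proof (cases "t \<in> N")
      case True
      then show ?thesis using \<open>0 < \<epsilon>\<close> by (simp add: u_def)
    next
      case False
      then have *: "\<theta> + t \<notin> N1" "\<theta> + t \<notin> N2" "t \<noteq> 0" by (auto simp: N_def)
      show ?thesis
      proof (cases "t < 0")
        case True
        then have "dist (u t) a < \<epsilon>" using N1(2)[OF *(1)] bf[OF False] that \<delta> by auto
        then show ?thesis using True by (simp add: \<sigma>_def dist_norm)
      next
        case False
        then have "dist (u t) b < \<epsilon>" using N2(2)[OF *(2)] bf[OF \<open>t \<notin> N\<close>] that \<delta> *(3) by auto
        then show ?thesis using False by (simp add: \<sigma>_def dist_norm)
      qed
    qed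
    \<comment> \<open>The index is shifted so that already the radius for \<open>n = 0\<close> is
      positive.\<close>
    define R where "R n = 1 - 1 / real (Suc (Suc n))" for n
    have R: "0 < R n" "R n < 1" for n by (auto simp: R_def)
    have R_lim: "R \<longlonglongrightarrow> 1"
      unfolding R_def[abs_def] by (rule LIMSEQ_Suc[OF LIMSEQ_one_minus_inverse_Suc])
    define V where "V n t = (if t \<in> N then \<sigma> t else F (of_real (R n) * cis (\<theta> + t)))" for n t
    have V_lim: "(\<lambda>n. V n t) \<longlonglongrightarrow> u t" for t
    proof (cases "t \<in> N")
      case False
      have "(\<lambda>n. of_real (R n) * cis (\<theta> + t)) \<longlonglongrightarrow> of_real 1 * cis (\<theta> + t)"
        using R_lim by (intro tendsto_intros)
      moreover have "of_real (R n) * cis (\<theta> + t) \<in> ball 0 1" for n using R[of n] by (simp add: norm_mult)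
      moreover have "of_real (R n) * cis (\<theta> + t) \<noteq> cis (\<theta> + t)" for n using R[of n] by simp
      ultimately have "filterlim (\<lambda>n. of_real (R n) * cis (\<theta> + t)) (at (cis (\<theta> + t)) within ball 0 1) sequentially"
        by (simp add: filterlim_at)
      moreover have "(F \<longlongrightarrow> u t) (at (cis (\<theta> + t)) within ball 0 1)"
        using bf[OF False] by (simp add: boundary_function_eq_Some_iff)
      ultimately have "(\<lambda>n. F (of_real (R n) * cis (\<theta> + t))) \<longlonglongrightarrow> u t" by (rule filterlim_compose[rotated])
      then show ?thesis using False by (simp add: V_def)
    qed (simp add: V_def u_def)
    have \<sigma>_bound: "cmod (\<sigma> t) \<le> B - M" for t by (simp add: \<sigma>_def B_def)
    have V_bound: "cmod (V n t) \<le> B" for n t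
    proof (cases "t \<in> N")
      case True
      then show ?thesis using \<sigma>_bound[of t] \<open>0 \<le> M\<close> by (simp add: V_def)
    next
      case False
      have "cmod (F (of_real (R n) * cis (\<theta> + t))) \<le> M" using R[of n] by (intro bound) (simp add: norm_mult)
      moreover have "M \<le> B" by (simp add: B_def)
      ultimately show ?thesis using False by (simp add: V_def)
    qed
    have u_bound: "cmod (u t - \<sigma> t) \<le> B" for t
    proof (cases "t \<in> N")
      case True
      then show ?thesis using \<open>0 \<le> M\<close> by (simp add: u_def B_def)
    next
      case False
      have "cmod (V n t) \<le> M" for n using False R[of n] by (auto simp: V_def norm_mult intro!: bound)
      then have "cmod (u t) \<le> M" using tendsto_norm[OF V_lim[of t]] by (intro LIMSEQ_le_const2) auto
      then show ?thesis using \<sigma>_bound[of t] norm_triangle_ineq4[of "u t" "\<sigma> t"] by linarith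
    qed
    have "cmod (E \<rho>) \<le> 2 * pi * \<epsilon> + 2 * pi * B * poisson \<rho> \<delta>" if \<rho>: "0 \<le> \<rho>" "\<rho> < 1" for \<rho>
    proof -
      let ?k = "\<lambda>t. cis t / (cis t - of_real \<rho>)\<^sup>2"
      have \<rho>2: "0 < 1 - \<rho>\<^sup>2" using \<rho> by (simp add: abs_square_less_1)
      have VI: "((\<lambda>t. ?k t * V n t) has_integral 2 * pi * (of_real (R n) * cis \<theta> * deriv h (of_real (R n) * cis \<theta> * of_real \<rho>))) {-pi..pi}" for n
      proof -
        have c: "norm (of_real (R n) * cis \<theta>) < 1" using R[of n] by (simp add: norm_mult)
        from holomorphic_on_scaled_disc2[OF hol this] obtain s where s: "1 < s"
          "(\<lambda>w. h (of_real (R n) * cis \<theta> * w)) holomorphic_on ball 0 s" "(\<lambda>w. g (of_real (R n) * cis \<theta> * w)) holomorphic_on ball 0 s"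
          by blast
        have "norm (of_real (R n) * cis \<theta> * of_real \<rho>) < 1"
        proof -
          have "R n * \<rho> \<le> R n * 1" using R[of n] \<rho> by (intro mult_left_mono) auto
          then have "R n * \<rho> < 1" using R(2)[of n] by linarith
          then show ?thesis using R[of n] \<rho> by (simp add: norm_mult)
        qed
        note d = deriv_scaled[OF hol(1) this]
        have "((\<lambda>t. ?k t * F (of_real (R n) * cis \<theta> * cis t)) has_integral
            2 * pi * (of_real (R n) * cis \<theta> * deriv h (of_real (R n) * cis \<theta> * of_real \<rho>))) {-pi..pi}"
          using deriv_harmonic[OF s(2,3,1) \<rho>] unfolding d F_def .
        then show ?thesis
          by (rule has_integral_spike[OF \<open>negligible N\<close>, rotated]) (simp add: V_def mult.assoc cis_mult)
      qed
      have k_bound: "cmod (?k t) \<le> poisson \<rho> 0 / (1 - \<rho>\<^sup>2)" if "t \<in> {-pi..pi}" for t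
      proof -
        have "poisson \<rho> t = poisson \<rho> \<bar>t\<bar>" by (simp add: poisson_def)
        also have "\<dots> \<le> poisson \<rho> 0" using that by (intro poisson_decreasing[OF \<rho>]) auto
        finally show ?thesis unfolding norm_deriv_kernel[OF \<rho>] using \<rho>2 by (intro divide_right_mono) auto
      qed
      have dc: "(\<lambda>t. ?k t * u t) integrable_on {-pi..pi}"
        "(\<lambda>n. integral {-pi..pi} (\<lambda>t. ?k t * V n t)) \<longlonglongrightarrow> integral {-pi..pi} (\<lambda>t. ?k t * u t)"
      proof -
        have 1: "\<And>n. (\<lambda>t. ?k t * V n t) integrable_on {-pi..pi}" using VI by blast
        have 2: "(\<lambda>t. poisson \<rho> 0 / (1 - \<rho>\<^sup>2) * B) integrable_on {-pi..pi}" by (rule integrable_const_ivl)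
        have 3: "\<And>n t. t \<in> {-pi..pi} \<Longrightarrow> norm (?k t * V n t) \<le> poisson \<rho> 0 / (1 - \<rho>\<^sup>2) * B"
          unfolding norm_mult using k_bound V_bound \<rho>2 poisson_nonneg[OF \<rho>]
          by (intro mult_mono) auto
        have 4: "\<And>t. t \<in> {-pi..pi} \<Longrightarrow> (\<lambda>n. ?k t * V n t) \<longlonglongrightarrow> ?k t * u t" by (intro tendsto_intros V_lim)
        show "(\<lambda>t. ?k t * u t) integrable_on {-pi..pi}" by (rule dominated_convergence(1)[OF 1 2 3 4])
        show "(\<lambda>n. integral {-pi..pi} (\<lambda>t. ?k t * V n t)) \<longlonglongrightarrow> integral {-pi..pi} (\<lambda>t. ?k t * u t)"
          by (rule dominated_convergence(2)[OF 1 2 3 4])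
      qed
      have DV: "(\<lambda>n. 2 * pi * (of_real (R n) * cis \<theta> * deriv h (of_real (R n) * cis \<theta> * of_real \<rho>))) \<longlonglongrightarrow>
          2 * pi * (of_real 1 * cis \<theta> * deriv h (of_real \<rho> * cis \<theta>))"
      proof -
        have "deriv h holomorphic_on ball 0 1" by (intro holomorphic_deriv hol) auto
        then have "continuous_on (ball 0 1) (deriv h)" by (rule holomorphic_on_imp_continuous_on)
        then have "isCont (deriv h) (of_real \<rho> * cis \<theta>)"
          using \<rho> by (auto simp: continuous_on_eq_continuous_at norm_mult)
        moreover have "(\<lambda>n. of_real (R n) * cis \<theta> * of_real \<rho>) \<longlonglongrightarrow> of_real 1 * cis \<theta> * of_real \<rho>"
          using R_lim by (intro tendsto_intros)
        ultimately have "(\<lambda>n. deriv h (of_real (R n) * cis \<theta> * of_real \<rho>)) \<longlonglongrightarrow> deriv h (of_real \<rho> * cis \<theta>)"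
          by (intro isCont_tendsto_compose[of _ "deriv h"]) (simp_all add: mult.commute)
        then show ?thesis using R_lim by (intro tendsto_intros)
      qed
      have uI: "integral {-pi..pi} (\<lambda>t. ?k t * u t) = 2 * pi * (cis \<theta> * deriv h (of_real \<rho> * cis \<theta>))"
        using LIMSEQ_unique[OF dc(2)[unfolded integral_unique[OF VI]] DV] by simp
      \<comment> \<open>The primitive \<open>\<i> / (cis t - \<rho>)\<close> takes the same value at
        \<open>-pi\<close> and \<open>pi\<close>, so the two half circles give opposite integrals
        and only the difference \<open>a - b\<close> survives.\<close>
      have k1: "(?k has_integral 2 * \<i> / (1 - (of_real \<rho>)\<^sup>2)) {-pi..0}" "(?k has_integral - (2 * \<i> / (1 - (of_real \<rho>)\<^sup>2))) {0..pi}"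
      proof -
        have ne: "complex_of_real (1 - \<rho>) \<noteq> 0" "complex_of_real (1 + \<rho>) \<noteq> 0" "complex_of_real (1 - \<rho>\<^sup>2) \<noteq> 0"
          unfolding of_real_eq_0_iff using \<rho> \<rho>2 by auto
        have eq: "\<i> / (1 - of_real \<rho>) - \<i> / (- 1 - of_real \<rho>) = 2 * \<i> / (1 - (of_real \<rho>)\<^sup>2)"
        proof -
          have f: "(- 1 - complex_of_real \<rho>) = - (1 + of_real \<rho>)" "1 - (complex_of_real \<rho>)\<^sup>2 = (1 - of_real \<rho>) * (1 + of_real \<rho>)"
            by (simp_all add: power2_eq_square algebra_simps)
          have gen: "\<i> / x - \<i> / (- y) = 2 * \<i> / (x * y)" if "x \<noteq> 0" "y \<noteq> 0" "x + y = 2" for x y :: complex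
          proof -
            have "\<i> / x - \<i> / (- y) = \<i> * (x + y) / (x * y)"
              using that(1,2) by (simp add: add_frac_eq algebra_simps)
            then show ?thesis using that(3) by (simp add: mult.commute)
          qed
          show ?thesis unfolding f by (rule gen) (use ne in simp_all)
        qed
        have "cis (- pi) = - 1" by (simp add: complex_eq_iff)
        then show "(?k has_integral 2 * \<i> / (1 - (of_real \<rho>)\<^sup>2)) {-pi..0}"
          using has_integral_deriv_kernel[OF \<rho>, of "-pi" 0] eq by simp
        show "(?k has_integral - (2 * \<i> / (1 - (of_real \<rho>)\<^sup>2))) {0..pi}"
          using has_integral_deriv_kernel[OF \<rho>, of 0 pi] unfolding eq[symmetric] by simp
      qed
      have "((\<lambda>t. ?k t * \<sigma> t) has_integral 2 * \<i> / (1 - (of_real \<rho>)\<^sup>2) * a) {-pi..0}"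
        by (rule has_integral_spike[of "{0}", OF _ _ has_integral_mult_left[OF k1(1)]]) (auto simp: \<sigma>_def)
      moreover have "((\<lambda>t. ?k t * \<sigma> t) has_integral - (2 * \<i> / (1 - (of_real \<rho>)\<^sup>2)) * b) {0..pi}"
        by (rule has_integral_spike[of "{}", OF _ _ has_integral_mult_left[OF k1(2)]]) (auto simp: \<sigma>_def)
      ultimately have \<sigma>I: "((\<lambda>t. ?k t * \<sigma> t) has_integral 2 * \<i> / (1 - (of_real \<rho>)\<^sup>2) * a + - (2 * \<i> / (1 - (of_real \<rho>)\<^sup>2)) * b) {-pi..pi}"
        by (rule has_integral_combine[of "-pi" 0 pi, rotated 2]) auto
      have diff: "((\<lambda>t. ?k t * u t - ?k t * \<sigma> t) has_integral
          2 * pi * (cis \<theta> * deriv h (of_real \<rho> * cis \<theta>)) - (2 * \<i> / (1 - (of_real \<rho>)\<^sup>2) * a + - (2 * \<i> / (1 - (of_real \<rho>)\<^sup>2)) * b)) {-pi..pi}"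
        using has_integral_diff[OF integrable_integral[OF dc(1)] \<sigma>I] unfolding uI .
      have bI: "((\<lambda>t. (\<epsilon> * poisson \<rho> t + B * poisson \<rho> \<delta>) / (1 - \<rho>\<^sup>2)) has_integral
          (\<epsilon> * (2 * pi) + B * poisson \<rho> \<delta> * (2 * pi)) / (1 - \<rho>\<^sup>2)) {-pi..pi}"
      proof -
        have "((\<lambda>t. B * poisson \<rho> \<delta>) has_integral B * poisson \<rho> \<delta> * (2 * pi)) {-pi..pi}"
          using has_integral_const_real[of "B * poisson \<rho> \<delta>" "-pi" pi] by (simp add: mult.commute)
        then show ?thesis
          by (intro has_integral_divide has_integral_add has_integral_mult_right integral_poisson[OF \<rho>])
      qed
      have "0 \<le> B" using order_trans[OF norm_ge_zero V_bound] .
      \<comment> \<open>For \<open>|t| < \<delta>\<close> the function is within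
        \<open>\<epsilon>\<close> of the step; elsewhere it is bounded by \<open>B\<close> and the
        kernel is at most its value at \<open>\<delta>\<close>. The two bounds are added to avoid
        splitting the integral.\<close>
      have pw: "cmod (?k t * u t - ?k t * \<sigma> t) \<le> (\<epsilon> * poisson \<rho> t + B * poisson \<rho> \<delta>) / (1 - \<rho>\<^sup>2)" if "t \<in> {-pi..pi}" for t
      proof -
        have "poisson \<rho> t * cmod (u t - \<sigma> t) \<le> \<epsilon> * poisson \<rho> t + B * poisson \<rho> \<delta>"
        proof (cases "\<bar>t\<bar> < \<delta>")
          case True
          have "poisson \<rho> t * cmod (u t - \<sigma> t) \<le> poisson \<rho> t * \<epsilon>"
            using near[OF True] poisson_nonneg[OF \<rho>] by (rule mult_left_mono)
          then show ?thesis using mult_nonneg_nonneg[OF \<open>0 \<le> B\<close> poisson_nonneg[OF \<rho>, of \<delta>]] by (simp add: mult.commute)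
        next
          case False
          have "poisson \<rho> t = poisson \<rho> \<bar>t\<bar>" by (simp add: poisson_def)
          also have "\<dots> \<le> poisson \<rho> \<delta>" using that False \<delta> by (intro poisson_decreasing[OF \<rho>]) auto
          finally have "poisson \<rho> t * cmod (u t - \<sigma> t) \<le> poisson \<rho> \<delta> * B"
            using u_bound poisson_nonneg[OF \<rho>] by (intro mult_mono) auto
          then show ?thesis using mult_nonneg_nonneg[OF less_imp_le[OF \<open>0 < \<epsilon>\<close>] poisson_nonneg[OF \<rho>, of t]] by (simp add: mult.commute)
        qed
        then have "poisson \<rho> t * cmod (u t - \<sigma> t) / (1 - \<rho>\<^sup>2) \<le> (\<epsilon> * poisson \<rho> t + B * poisson \<rho> \<delta>) / (1 - \<rho>\<^sup>2)"
          using \<rho>2 by (intro divide_right_mono) auto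
        moreover have "cmod (?k t * u t - ?k t * \<sigma> t) = poisson \<rho> t * cmod (u t - \<sigma> t) / (1 - \<rho>\<^sup>2)"
          unfolding right_diff_distrib[symmetric] norm_mult norm_deriv_kernel[OF \<rho>] by simp
        ultimately show ?thesis by simp
      qed
      let ?X = "2 * pi * (cis \<theta> * deriv h (of_real \<rho> * cis \<theta>)) - (2 * \<i> / (1 - (of_real \<rho>)\<^sup>2) * a + - (2 * \<i> / (1 - (of_real \<rho>)\<^sup>2)) * b)"
      have X: "cmod ?X \<le> (\<epsilon> * (2 * pi) + B * poisson \<rho> \<delta> * (2 * pi)) / (1 - \<rho>\<^sup>2)"
        using integral_norm_bound_integral[OF has_integral_integrable[OF diff] has_integral_integrable[OF bI] pw]
        unfolding integral_unique[OF diff] integral_unique[OF bI] .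
      have E: "E \<rho> = of_real (1 - \<rho>) * ?X"
      proof -
        have ne: "complex_of_real (1 - \<rho>) \<noteq> 0" "complex_of_real (1 + \<rho>) \<noteq> 0"
          unfolding of_real_eq_0_iff using \<rho> by auto
        have f: "1 - (complex_of_real \<rho>)\<^sup>2 = (1 - of_real \<rho>) * (1 + of_real \<rho>)"
          by (simp add: power2_eq_square algebra_simps)
        have "of_real (1 - \<rho>) * (2 * \<i> / (1 - (complex_of_real \<rho>)\<^sup>2)) = 2 * \<i> / (1 + of_real \<rho>)"
          unfolding f using ne by simp
        moreover have "of_real (1 - \<rho>) * (of_real (2 * pi) * d - (q * a + - q * b)) =
            of_real (2 * pi * (1 - \<rho>)) * d - (a - b) * (of_real (1 - \<rho>) * q)" for d q
          by (simp add: algebra_simps)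
        ultimately show ?thesis unfolding E_def by (simp only:)
      qed
      have "cmod (E \<rho>) = (1 - \<rho>) * cmod ?X" unfolding E norm_mult norm_of_real using \<rho> by simp
      also have "\<dots> \<le> (1 - \<rho>\<^sup>2) * ((\<epsilon> * (2 * pi) + B * poisson \<rho> \<delta> * (2 * pi)) / (1 - \<rho>\<^sup>2))"
      proof (rule mult_mono[OF _ X])
        have "\<rho> * \<rho> \<le> \<rho> * 1" using \<rho> by (intro mult_left_mono) auto
        then show "1 - \<rho> \<le> 1 - \<rho>\<^sup>2" by (simp add: power2_eq_square)
      qed (use \<rho>2 in auto)
      also have "\<dots> = 2 * pi * \<epsilon> + 2 * pi * B * poisson \<rho> \<delta>"
      proof -
        have cancel: "(1 - \<rho>\<^sup>2) * (x / (1 - \<rho>\<^sup>2)) = x" for x using \<rho>2 by simp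
        show ?thesis unfolding cancel by (simp add: algebra_simps)
      qed
      finally show ?thesis .
    qed
    then show ?thesis using \<delta>(1,2) by blast
  qed
  have "(E \<longlongrightarrow> 0) (at_left 1)"
  proof (rule tendstoI)
    fix e :: real assume "0 < e"
    \<comment> \<open>With this choice \<open>2 * pi * \<epsilon>\<close> is \<open>e / 2\<close>;
      the Poisson term vanishes in the limit for fixed \<open>\<delta>\<close>.\<close>
    define \<epsilon> where "\<epsilon> = e / (4 * pi)"
    have "0 < \<epsilon>" using \<open>0 < e\<close> by (simp add: \<epsilon>_def)
    from E_bound[OF this] obtain \<delta> where \<delta>: "0 < \<delta>" "\<delta> \<le> pi"
      "\<And>\<rho>. 0 \<le> \<rho> \<Longrightarrow> \<rho> < 1 \<Longrightarrow> cmod (E \<rho>) \<le> 2 * pi * \<epsilon> + 2 * pi * B * poisson \<rho> \<delta>" by blast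
    have "((\<lambda>\<rho>. 2 * pi * \<epsilon> + 2 * pi * B * poisson \<rho> \<delta>) \<longlongrightarrow> 2 * pi * \<epsilon> + 2 * pi * B * 0) (at_left 1)"
      by (intro tendsto_intros poisson_tendsto_0 \<delta>)
    moreover have "2 * pi * \<epsilon> + 2 * pi * B * 0 < e" using \<open>0 < e\<close> by (simp add: \<epsilon>_def)
    ultimately have "\<forall>\<^sub>F \<rho> in at_left 1. 2 * pi * \<epsilon> + 2 * pi * B * poisson \<rho> \<delta> < e"
      by (rule order_tendstoD)
    moreover have "\<forall>\<^sub>F \<rho> in at_left 1. \<rho> \<in> {0<..<1::real}" by (rule eventually_at_left_real) simp
    ultimately show "\<forall>\<^sub>F \<rho> in at_left 1. dist (E \<rho>) 0 < e"
    proof eventually_elim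
      case (elim \<rho>)
      then have "0 \<le> \<rho>" "\<rho> < 1" by auto
      from le_less_trans[OF \<delta>(3)[OF this] elim(1)] show ?case by simp
    qed
  qed
  moreover have "((\<lambda>\<rho>. (a - b) * (2 * \<i> / (1 + of_real \<rho>))) \<longlongrightarrow> (a - b) * (2 * \<i> / (1 + of_real 1))) (at_left 1)"
    by (intro tendsto_intros) simp
  ultimately have "((\<lambda>\<rho>. E \<rho> + (a - b) * (2 * \<i> / (1 + of_real \<rho>))) \<longlongrightarrow> 0 + (a - b) * (2 * \<i> / (1 + of_real 1))) (at_left 1)"
    by (rule tendsto_add)
  then have "((\<lambda>\<rho>. of_real (2 * pi * (1 - \<rho>)) * (cis \<theta> * deriv h (of_real \<rho> * cis \<theta>))) \<longlongrightarrow> (a - b) * \<i>) (at_left 1)"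
    by (simp add: E_def)
  from tendsto_divide[OF tendsto_norm[OF this] tendsto_const[of "2 * pi"]]
  have "((\<lambda>\<rho>. cmod (of_real (2 * pi * (1 - \<rho>)) * (cis \<theta> * deriv h (of_real \<rho> * cis \<theta>))) / (2 * pi)) \<longlongrightarrow> cmod (a - b) / (2 * pi)) (at_left 1)"
    by (simp add: norm_mult)
  then show ?thesis
  proof (rule Lim_transform_eventually)
    have "\<forall>\<^sub>F \<rho> in at_left 1. \<rho> \<in> {0<..<1::real}" by (rule eventually_at_left_real) simp
    then show "\<forall>\<^sub>F \<rho> in at_left 1. cmod (of_real (2 * pi * (1 - \<rho>)) * (cis \<theta> * deriv h (of_real \<rho> * cis \<theta>))) / (2 * pi) =
        (1 - \<rho>) * cmod (deriv h (of_real \<rho> * cis \<theta>))"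
      by eventually_elim (simp only: norm_mult norm_of_real norm_cis, simp)
  qed
qed

section \<open>The jump criterion\<close>

text \<open>Near the circle the bound is inherited from \<open>f\<close>, and on the remaining
  compact disc it comes from continuity.\<close>

lemma bounded_of_close_near_circle:
  fixes f F :: "complex \<Rightarrow> complex"
  assumes "continuous_on (ball 0 1) F" "bounded (f ` ball 0 1)"
    and "\<rho> < 1" "\<And>z. \<rho> < norm z \<Longrightarrow> norm z < 1 \<Longrightarrow> dist (f z) (F z) < \<epsilon>"
  obtains M where "\<And>z. z \<in> ball 0 1 \<Longrightarrow> cmod (F z) \<le> M"
proof -
  have "compact (F ` cball 0 \<rho>)"
    using \<open>\<rho> < 1\<close> by (intro compact_continuous_image continuous_on_subset[OF assms(1)]) auto
  then have "bounded (F ` cball 0 \<rho>)" by (rule compact_imp_bounded)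
  then obtain M1 where "\<forall>x\<in>F ` cball 0 \<rho>. cmod x \<le> M1"
    unfolding bounded_iff by blast
  then have M1: "cmod (F z) \<le> M1" if "norm z \<le> \<rho>" for z
    using that by simp
  obtain M2 where M2: "\<And>z. z \<in> ball 0 1 \<Longrightarrow> cmod (f z) \<le> M2"
    using assms(2) unfolding bounded_iff by blast
  have "cmod (F z) \<le> max M1 (M2 + \<epsilon>)" if "z \<in> ball 0 1" for z
  proof (cases "norm z \<le> \<rho>")
    case False
    then have "dist (f z) (F z) < \<epsilon>" using that by (intro assms(4)) auto
    moreover have "cmod (F z) \<le> cmod (f z) + dist (f z) (F z)"
      using norm_triangle_sub[of "F z" "f z"] by (simp add: dist_norm norm_minus_commute)
    ultimately show ?thesis using M2[OF that] by linarith
  qed (use M1 in \<open>auto simp: le_max_iff_disj\<close>)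
  then show ?thesis using that by blast
qed

theorem theorem2:
  fixes f F1 F2 H1 G1 H2 G2 :: "complex \<Rightarrow> complex" and \<Omega> :: "complex set" and \<theta>0 :: real
  assumes "H1 holomorphic_on ball 0 1" and "G1 holomorphic_on ball 0 1"
    and "H2 holomorphic_on ball 0 1" and "G2 holomorphic_on ball 0 1"
    and "harmonic_mapping_on (ball 0 1) F1" and "harmonic_mapping_on (ball 0 1) F2"
    and "\<And>z. z \<in> ball 0 1 \<Longrightarrow> F1 z = H1 z + cnj (G1 z)"
    and "\<And>z. z \<in> ball 0 1 \<Longrightarrow> F2 z = H2 z + cnj (G2 z)"
    and "\<And>z. z \<in> ball 0 1 \<Longrightarrow> f z = F1 z + of_real ((norm z)\<^sup>2) * F2 z"
    and "biharmonic_mapping_on (ball 0 1) f"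
    and "inj_on f (ball 0 1)"
    and "bounded_rectifiable_Jordan_domain \<Omega>" and "f ` ball 0 1 = \<Omega>"
    and "F2 \<in> o[filtercomap norm (at_left 1)](\<lambda>z. of_real (1 / (1 - norm z)))"
  shows "has_jump_at (boundary_function f) \<theta>0 \<longleftrightarrow>
    (\<exists>c>0. ((\<lambda>r. (1 - r) * norm (deriv H1 (of_real r * cis \<theta>0) + deriv H2 (of_real r * cis \<theta>0)))
       \<longlongrightarrow> c) (at_left 1))"
proof -
  note hol = assms(1-4) and F1 = assms(7) and F2 = assms(8) and f_eq = assms(9) and inj = assms(11)
    and dom = assms(12) and image = assms(13) and small = assms(14)
  define h where "h z = H1 z + H2 z" for z
  define g where "g z = G1 z + G2 z" for z
  let ?F = "\<lambda>z. h z + cnj (g z)"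
  have hol_h: "h holomorphic_on ball 0 1" and hol_g: "g holomorphic_on ball 0 1"
    unfolding h_def[abs_def] g_def[abs_def] using hol by (auto intro: holomorphic_on_add)
  have contF: "continuous_on (ball 0 1) ?F"
    using hol_h hol_g by (intro continuous_intros holomorphic_on_imp_continuous_on)
  have contf: "continuous_on (ball 0 1) f"
  proof -
    have "continuous_on (ball 0 1) (\<lambda>z. (H1 z + cnj (G1 z)) + of_real ((norm z)\<^sup>2) * (H2 z + cnj (G2 z)))"
      using hol by (intro continuous_intros holomorphic_on_imp_continuous_on)
    then show ?thesis by (rule continuous_on_eq) (simp add: f_eq F1 F2)
  qed
  have close: "\<exists>\<rho><1. \<forall>z. \<rho> < norm z \<and> norm z < 1 \<longrightarrow> dist (f z) (?F z) < \<epsilon>" if "0 < \<epsilon>" for \<epsilon>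
  proof -
    \<comment> \<open>One factor \<open>1 - |z|\<close> of \<open>1 - |z|^2\<close> cancels the
      allowed growth of \<open>F2\<close> and the other factor is below 2, so
      \<open>\<epsilon> / 4\<close> leaves \<open>\<epsilon> / 2\<close>.\<close>
    have "0 < \<epsilon> / 4" using that by simp
    from landau_o.smallD[OF small this]
    obtain P where P: "eventually P (at_left (1::real))"
      "\<And>z. P (norm z) \<Longrightarrow> norm (F2 z) \<le> \<epsilon> / 4 * norm (complex_of_real (1 / (1 - norm z)))"
      unfolding eventually_filtercomap by blast
    obtain \<rho> where \<rho>: "\<rho> < 1" "\<And>r. \<rho> < r \<Longrightarrow> r < 1 \<Longrightarrow> P r"
      using P(1) unfolding eventually_at_left_field by blast
    have "dist (f z) (?F z) < \<epsilon>" if z: "\<rho> < norm z" "norm z < 1" for z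
    proof -
      have "f z - ?F z = - (of_real (1 - (norm z)\<^sup>2) * F2 z)"
        using z by (simp add: f_eq F1 F2 h_def g_def algebra_simps)
      then have "dist (f z) (?F z) = (1 - (norm z)\<^sup>2) * norm (F2 z)"
        using z by (simp add: dist_norm norm_mult abs_square_le_1 del: of_real_diff of_real_power)
      also have "\<dots> \<le> (1 - (norm z)\<^sup>2) * (\<epsilon> / 4 * (1 / (1 - norm z)))"
      proof (rule mult_left_mono)
        have "norm (complex_of_real (1 / (1 - norm z))) = 1 / (1 - norm z)"
          using z by (simp only: norm_of_real) simp
        then show "norm (F2 z) \<le> \<epsilon> / 4 * (1 / (1 - norm z))"
          using P(2)[OF \<rho>(2)[OF z]] by simp
      qed (use z in \<open>simp add: power_le_one\<close>)
      also have "\<dots> = (1 + norm z) * (\<epsilon> / 4)"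
      proof -
        have "1 - (norm z)\<^sup>2 = (1 + norm z) * (1 - norm z)" by (simp add: power2_eq_square algebra_simps)
        moreover have "x * (c * (1 / x)) = c" if "x \<noteq> 0" for x c :: real using that by simp
        from this[of "1 - norm z" "\<epsilon> / 4"] have "(1 - norm z) * (\<epsilon> / 4 * (1 / (1 - norm z))) = \<epsilon> / 4"
          using z by linarith
        ultimately show ?thesis by (simp only: mult.assoc)
      qed
      also have "\<dots> \<le> 2 * (\<epsilon> / 4)" using z \<open>0 < \<epsilon>\<close> by (intro mult_right_mono) auto
      also have "\<dots> < \<epsilon>" using \<open>0 < \<epsilon>\<close> by simp
      finally show ?thesis .
    qed
    then show ?thesis using \<rho>(1) by blast
  qed
  obtain \<gamma> where \<gamma>: "simple_path \<gamma>" "pathfinish \<gamma> = pathstart \<gamma>" "frontier (f ` ball 0 1) = path_image \<gamma>"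
    and bd: "bounded (f ` ball 0 1)"
    using dom unfolding bounded_rectifiable_Jordan_domain_def image by blast
  obtain M where M: "\<And>z. z \<in> ball 0 1 \<Longrightarrow> cmod (?F z) \<le> M"
    using close[of 1] bounded_of_close_near_circle[OF contF bd] by (metis zero_less_one)
  have diff_0: "((\<lambda>z. f z - ?F z) \<longlongrightarrow> 0) (at (cis s) within ball 0 1)" for s
  proof (rule tendstoI)
    fix \<epsilon> :: real assume "0 < \<epsilon>"
    from close[OF this] obtain \<rho> where \<rho>: "\<rho> < 1" "\<And>z. \<rho> < norm z \<Longrightarrow> norm z < 1 \<Longrightarrow> dist (f z) (?F z) < \<epsilon>" by blast
    have "(norm \<longlongrightarrow> norm (cis s)) (at (cis s) within ball 0 1)" by (intro tendsto_intros)
    then have "\<forall>\<^sub>F z in at (cis s) within ball 0 1. \<rho> < norm z"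
      using \<rho>(1) by (auto simp: order_tendsto_iff)
    moreover have "\<forall>\<^sub>F z in at (cis s) within ball 0 1. z \<in> ball 0 1" by (simp add: eventually_at_filter)
    ultimately show "\<forall>\<^sub>F z in at (cis s) within ball 0 1. dist (f z - ?F z) 0 < \<epsilon>"
      by eventually_elim (use \<rho>(2) in \<open>simp add: dist_norm\<close>)
  qed
  have limits_iff: "(f \<longlongrightarrow> L) (at (cis s) within ball 0 1) \<longleftrightarrow> (?F \<longlongrightarrow> L) (at (cis s) within ball 0 1)" for s L
    using Lim_transform[OF _ diff_0, of L s] Lim_transform2[OF _ diff_0, of L s] by blast
  have bf_eq: "boundary_function f (cis s) = boundary_function ?F (cis s)" for s
    by (metis (no_types, lifting) boundary_function_eq_Some_iff limits_iff option.exhaust)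
  have dense: "\<exists>\<theta>. x < \<theta> \<and> \<theta> < y \<and> has_radial_limit f \<theta>" if xy: "x < y" for x y
  proof -
    obtain \<theta> L where \<theta>: "x < \<theta>" "\<theta> < y" "radial_limit ?F \<theta> L"
      by (rule radial_limits_dense[OF hol_h hol_g M xy]) (assumption, rule that)
    have "((\<lambda>r. f (of_real r * cis \<theta>) - ?F (of_real r * cis \<theta>)) \<longlongrightarrow> 0) (at_left 1)"
    proof (rule tendstoI)
      fix \<epsilon> :: real assume "0 < \<epsilon>"
      from close[OF this] obtain \<rho> where \<rho>: "\<rho> < 1" "\<And>z. \<rho> < norm z \<Longrightarrow> norm z < 1 \<Longrightarrow> dist (f z) (?F z) < \<epsilon>" by blast
      have "\<forall>\<^sub>F r in at_left 1. r \<in> {max 0 \<rho><..<1}" by (rule eventually_at_left_real) (use \<rho> in simp)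
      then show "\<forall>\<^sub>F r in at_left 1. dist (f (of_real r * cis \<theta>) - ?F (of_real r * cis \<theta>)) 0 < \<epsilon>"
      proof eventually_elim
        case (elim r)
        then have "dist (f (of_real r * cis \<theta>)) (?F (of_real r * cis \<theta>)) < \<epsilon>"
          by (intro \<rho>(2)) (auto simp: norm_mult)
        then show ?case by (simp add: dist_norm)
      qed
    qed
    from tendsto_add[OF this \<theta>(3)[unfolded radial_limit_def]]
    have "radial_limit f \<theta> L" by (simp add: radial_limit_def)
    with \<theta> show ?thesis unfolding has_radial_limit_def by blast
  qed
  note J = Jordan_boundary_function[OF contf inj bd \<gamma> dense]
  have asym: "((\<lambda>r. (1 - r) * norm (deriv H1 (of_real r * cis \<theta>0) + deriv H2 (of_real r * cis \<theta>0))) \<longlongrightarrow> cmod (a - b) / (2 * pi)) (at_left 1)"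
    if "ess_lim_left (\<lambda>s. boundary_function f (cis s)) \<theta>0 a" "ess_lim_right (\<lambda>s. boundary_function f (cis s)) \<theta>0 b" for a b
  proof -
    have "((\<lambda>r. (1 - r) * cmod (deriv h (of_real r * cis \<theta>0))) \<longlongrightarrow> cmod (a - b) / (2 * pi)) (at_left 1)"
      using jump_asymptotics[OF hol_h hol_g M J(1)[unfolded bf_eq] that[unfolded bf_eq]] by blast
    then show ?thesis
    proof (rule Lim_transform_eventually)
      have "\<forall>\<^sub>F r in at_left 1. r \<in> {0<..<1::real}" by (rule eventually_at_left_real) simp
      then show "\<forall>\<^sub>F r in at_left 1. (1 - r) * cmod (deriv h (of_real r * cis \<theta>0)) =
         (1 - r) * norm (deriv H1 (of_real r * cis \<theta>0) + deriv H2 (of_real r * cis \<theta>0))"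
      proof eventually_elim
        case (elim r)
        then have "of_real r * cis \<theta>0 \<in> ball 0 1" by (simp add: norm_mult)
        then have "H1 field_differentiable at (of_real r * cis \<theta>0)" "H2 field_differentiable at (of_real r * cis \<theta>0)"
          using hol by (auto intro: holomorphic_on_imp_differentiable_at)
        then show ?case unfolding h_def[abs_def] by (simp add: deriv_add)
      qed
    qed
  qed
  show ?thesis
  proof
    assume "has_jump_at (boundary_function f) \<theta>0"
    then obtain a b where ab: "ess_lim_left (\<lambda>s. boundary_function f (cis s)) \<theta>0 a"
      "ess_lim_right (\<lambda>s. boundary_function f (cis s)) \<theta>0 b" "a \<noteq> b"
      unfolding has_jump_at_def by blast
    then have "0 < cmod (a - b) / (2 * pi)" by simp
    with asym[OF ab(1,2)] show "\<exists>c>0. ((\<lambda>r. (1 - r) * norm (deriv H1 (of_real r * cis \<theta>0) + deriv H2 (of_real r * cis \<theta>0))) \<longlongrightarrow> c) (at_left 1)"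
      by blast
  next
    assume "\<exists>c>0. ((\<lambda>r. (1 - r) * norm (deriv H1 (of_real r * cis \<theta>0) + deriv H2 (of_real r * cis \<theta>0))) \<longlongrightarrow> c) (at_left 1)"
    then obtain c where c: "0 < c" "((\<lambda>r. (1 - r) * norm (deriv H1 (of_real r * cis \<theta>0) + deriv H2 (of_real r * cis \<theta>0))) \<longlongrightarrow> c) (at_left 1)"
      by blast
    \<comment> \<open>The one-sided limits exist without any assumption on the derivative, so the
      given limit must be \<open>cmod (a - b) / (2 * pi)\<close> by uniqueness, and its positivity
      separates \<open>a\<close> from \<open>b\<close>.\<close>
    obtain a b where ab: "ess_lim_left (\<lambda>s. boundary_function f (cis s)) \<theta>0 a" "ess_lim_right (\<lambda>s. boundary_function f (cis s)) \<theta>0 b"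
      using J(2)[of \<theta>0] J(3)[of \<theta>0] by blast
    have "cmod (a - b) / (2 * pi) = c"
      by (rule tendsto_unique[OF _ asym[OF ab] c(2)]) simp
    with c(1) have "a \<noteq> b" by auto
    with ab show "has_jump_at (boundary_function f) \<theta>0" unfolding has_jump_at_def by blast
  qed
qed

end
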